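(* Let $d\ge 2$ be an integer. (i) If $4\le p<\infty$ and $\Lambda\subseteq\mathbb{D}^d$ is a simply interpolating sequence for $H^p(\mathbb{D}^d)$, then $\Lambda$ is also universally interpolating for $H^p(\mathbb{D}^d)$. (ii) For every $1\le p\le 2$ there exists a sequence in $\mathbb{D}^d$ that is simply interpolating for $H^p(\mathbb{D}^d)$ but is not universally interpolating for $H^p(\mathbb{D}^d)$.
   Context: $\mathbb{D}$ is the open unit disc, $\mathbb{T}$ the unit circle, $m$ the normalized Haar (probability) measure on $\mathbb{T}^d$. For $1\le p<\infty$, $H^p(\mathbb{D}^d)$ is the space of holomorphic functions $f$ on $\mathbb{D}^d$ with $\|f\|_p^p:=\sup_{0<r<1}\int_{\mathbb{T}^d}|f(rz)|^p\,dm(z)<\infty$. For a sequence $\Lambda=(\lambda_n)_n\subseteq\mathbb{D}^d$, $\lambda_n=(\lambda_n^1,\dots,\lambda_n^d)$, and $f\in H^p(\mathbb{D}^d)$, set $$T^p_\Lambda(f)=\Big(f(\lambda_n)\prod_{i=1}^d(1-|\lambda_n^i|^2)^{1/p}\Big)_n .$$ $\Lambda$ is simply interpolating for $H^p(\mathbb{D}^d)$ if $T^p_\Lambda(H^p(\mathbb{D}^d))\supseteq\ell^p$, and universally interpolating for $H^p(\mathbb{D}^d)$ if $T^p_\Lambda(H^p(\mathbb{D}^d))=\ell^p$. *)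

theory Defs
  imports "HOL-Probability.Probability"
begin

definition polydisc :: "(complex ^ 'd::finite) set" where
  "polydisc = {z. \<forall>i. norm (z $ i) < 1}"

definition torus :: "(complex ^ 'd::finite) set" where
  "torus = {z. \<forall>i. norm (z $ i) = 1}"

definition circle_measure :: "complex measure" where
  "circle_measure = distr (uniform_measure lborel {0..<2 * pi}) borel cis"

text \<open>Normalized Haar measure on the torus, as the product of the normalized arc length
  measures; it is carried by the ambient space and vanishes off \<^const>\<open>torus\<close>
  (\<open>emeasure_torus\<close> below).\<close>

definition torus_measure :: "(complex ^ 'd::finite) measure" where
  "torus_measure = distr (\<Pi>\<^sub>M i\<in>UNIV. circle_measure) borel vec_lambda"

text \<open>Complex differentiability in several variables: \<^const>\<open>has_derivative\<close> provides a
  real-linear derivative, which is required to be complex-linear.\<close>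

definition sv_holomorphic_on :: "(complex ^ 'd::finite \<Rightarrow> complex) \<Rightarrow> (complex ^ 'd) set \<Rightarrow> bool" where
  "sv_holomorphic_on f S \<longleftrightarrow>
     (\<forall>z\<in>S. \<exists>D. (f has_derivative D) (at z) \<and> (\<forall>c v. D (c *s v) = c * D v))"

definition hardy_norm_powr :: "real \<Rightarrow> (complex ^ 'd::finite \<Rightarrow> complex) \<Rightarrow> ennreal" where
  "hardy_norm_powr p f =
     (SUP r\<in>{0<..<1::real}. \<integral>\<^sup>+z\<in>torus. ennreal (norm (f (r *\<^sub>R z)) powr p) \<partial>torus_measure)"

text \<open>Elements of the Hardy space are total functions; their values off the polydisc are
  irrelevant.\<close>

definition hardy_space :: "real \<Rightarrow> (complex ^ 'd::finite \<Rightarrow> complex) set" where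
  "hardy_space p = {f. sv_holomorphic_on f polydisc \<and> hardy_norm_powr p f < \<infinity>}"

definition ell_p :: "real \<Rightarrow> (nat \<Rightarrow> complex) set" where
  "ell_p p = {a. summable (\<lambda>n. norm (a n) powr p)}"

definition interp_map ::
    "real \<Rightarrow> (nat \<Rightarrow> complex ^ 'd::finite) \<Rightarrow> (complex ^ 'd \<Rightarrow> complex) \<Rightarrow> nat \<Rightarrow> complex" where
  "interp_map p \<Lambda> f = (\<lambda>n. f (\<Lambda> n) * of_real (\<Prod>i\<in>UNIV. (1 - (norm (\<Lambda> n $ i))\<^sup>2) powr (1 / p)))"

definition simply_interpolating :: "real \<Rightarrow> (nat \<Rightarrow> complex ^ 'd::finite) \<Rightarrow> bool" where
  "simply_interpolating p \<Lambda> \<longleftrightarrow> ell_p p \<subseteq> interp_map p \<Lambda> ` hardy_space p"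

definition universally_interpolating :: "real \<Rightarrow> (nat \<Rightarrow> complex ^ 'd::finite) \<Rightarrow> bool" where
  "universally_interpolating p \<Lambda> \<longleftrightarrow> interp_map p \<Lambda> ` hardy_space p = ell_p p"

lemma prob_space_circle_measure: "prob_space circle_measure"
  unfolding circle_measure_def
  by (intro prob_space.prob_space_distr prob_space_uniform_measure)
     (auto simp: measurable_cong_sets[OF sets_uniform_measure refl]
        intro!: borel_measurable_continuous_onI continuous_intros)

lemma sets_circle_measure [simp, measurable_cong]: "sets circle_measure = sets borel"
  by (simp add: circle_measure_def)

lemma space_circle_measure [simp]: "space circle_measure = UNIV"
  by (simp add: circle_measure_def)

lemma AE_circle_measure: "AE z in circle_measure. norm z = 1"
proof -
  have "cis \<in> uniform_measure lborel {0..<2 * pi} \<rightarrow>\<^sub>M borel"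
    by (auto simp: measurable_cong_sets[OF sets_uniform_measure refl]
        intro!: borel_measurable_continuous_onI continuous_intros)
  then show ?thesis
    unfolding circle_measure_def by (subst AE_distr_iff) auto
qed

lemma measurable_vec_lambda_circle [measurable]:
  "vec_lambda \<in> (\<Pi>\<^sub>M i\<in>(UNIV::'d::finite set). circle_measure) \<rightarrow>\<^sub>M (borel :: (complex ^ 'd) measure)"
proof (rule borel_measurable_euclidean_space[THEN iffD2], rule ballI)
  fix b :: "complex ^ 'd" assume "b \<in> Basis"
  then obtain i u where b: "b = axis i u" by (auto simp: Basis_vec_def)
  have "(\<lambda>x. x i) \<in> (\<Pi>\<^sub>M i\<in>(UNIV::'d set). circle_measure) \<rightarrow>\<^sub>M borel"
    by (subst measurable_cong_sets[OF refl sets_circle_measure[symmetric]]) simp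
  then show "(\<lambda>x. vec_lambda x \<bullet> b) \<in> borel_measurable (\<Pi>\<^sub>M i\<in>UNIV. circle_measure)"
    by (simp add: b inner_axis)
qed

lemma prob_space_torus_measure: "prob_space (torus_measure :: (complex ^ 'd::finite) measure)"
proof -
  interpret prob_space circle_measure by (rule prob_space_circle_measure)
  interpret product_prob_space "\<lambda>_. circle_measure" "UNIV :: 'd set" ..
  show ?thesis
    unfolding torus_measure_def
    by (intro prob_space.prob_space_distr measurable_vec_lambda_circle) (rule P.prob_space_axioms)
qed

lemma closed_torus: "closed (torus :: (complex ^ 'd::finite) set)"
  unfolding torus_def by (intro closed_Collect_all closed_Collect_eq continuous_intros)

lemma emeasure_torus: "emeasure torus_measure (torus :: (complex ^ 'd::finite) set) = 1"
proof -
  interpret prob_space circle_measure by (rule prob_space_circle_measure)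
  interpret product_prob_space "\<lambda>_. circle_measure" "UNIV :: 'd set" ..
  interpret T: prob_space "torus_measure :: (complex ^ 'd) measure"
    by (rule prob_space_torus_measure)
  have circ: "emeasure circle_measure {z. norm z = 1} = 1"
  proof (rule prob_space.emeasure_eq_1_AE[OF prob_space_circle_measure])
    have "closed {z::complex. norm z = 1}" by (intro closed_Collect_eq continuous_intros)
    then show "{z. norm z = 1} \<in> sets circle_measure" by simp
    show "AE x in circle_measure. x \<in> {z. norm z = 1}" using AE_circle_measure by simp
  qed
  have meas: "{z. norm z = 1} \<in> sets circle_measure"
    by (auto intro!: borel_closed closed_Collect_eq continuous_intros)
  have "emeasure torus_measure (torus :: (complex ^ 'd) set) =
      emeasure (\<Pi>\<^sub>M i\<in>(UNIV::'d set). circle_measure)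
        (vec_lambda -` (torus :: (complex ^ 'd) set) \<inter> space (\<Pi>\<^sub>M i\<in>(UNIV::'d set). circle_measure))"
    unfolding torus_measure_def
    by (intro emeasure_distr measurable_vec_lambda_circle borel_closed closed_torus)
  also have "vec_lambda -` (torus :: (complex ^ 'd) set) \<inter> space (\<Pi>\<^sub>M i\<in>(UNIV::'d set). circle_measure)
      = (\<Pi>\<^sub>E i\<in>UNIV. {z. norm z = 1})"
    by (auto simp: torus_def space_PiM PiE_def Pi_def)
  also have "emeasure (\<Pi>\<^sub>M i\<in>(UNIV::'d set). circle_measure) \<dots> = 1"
    using meas circ by (subst emeasure_PiM) auto
  finally show ?thesis .
qed

end

theory Submission
  imports Defs "HOL-Complex_Analysis.Conformal_Mappings"
begin

text \<open>For (i), which holds for \<open>p \<ge> 3\<close>, a gliding hump gives interpolants of any \<open>N\<close> values with norm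
  bounded independently of \<open>N\<close>. To bound the values of \<open>g\<close> on \<open>\<lambda>\<^sub>1, \<dots>, \<lambda>\<^sub>N\<close>, take
  interpolants \<open>G\<^sub>k\<close> of \<open>\<omega>\<^sup>j\<^sup>k g(\<lambda>\<^sub>j)\<close> with \<open>\<omega>\<close> a primitive \<open>N\<close>th root of unity and let \<open>F\<^sub>j\<close> be their discrete
  Fourier transform, so that \<open>F\<^sub>j(\<lambda>\<^sub>j) = g(\<lambda>\<^sub>j)\<close> and \<open>\<Sum>|F\<^sub>j|\<^sup>2\<close> is the mean of the \<open>|G\<^sub>k|\<^sup>2\<close>. The Poisson inequality
  for \<open>F\<^sub>j\<^sup>2 g\<close>, multiplied by \<open>|g(\<lambda>\<^sub>j)|\<close> to the power \<open>p - 3\<close> and split by Young's inequality, can be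
  summed over \<open>j\<close> and absorbed.

  For (ii), take the points \<open>(z, w)\<close> with \<open>z\<close> to the power \<open>100\<^sup>i\<close> equal to \<open>1/2\<close> and
  \<open>exp (- \<zeta>(w) / 100\<^sup>i) = 1/2\<close>, where \<open>\<zeta>(w) = (1 + w) / (1 - w)\<close> and \<open>i\<close> ranges over the naturals.
  The function dual to a point of block \<open>i\<close> is a Lagrange interpolant within the block times inner functions
  vanishing in \<open>z\<close> on the blocks \<open>m < i\<close> and in \<open>w\<close> on the blocks \<open>m > i\<close>. A factor \<open>z\<close> to the power
  \<open>2 * 100\<^sup>m\<close> per earlier block makes distinct blocks orthogonal, which yields weighted bounds for sums of dual
  functions in \<open>L\<^sup>1\<close> and \<open>L\<^sup>2\<close>, and in between by Marcinkiewicz interpolation. Every block \<open>i \<le> n\<close> has mass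
  bounded below for the square of the normalized Szego kernel in \<open>w\<close> at a point depending only on \<open>n\<close>,
  so the sequence violates the Carleson condition.\<close>

subsection \<open>Poisson integrals on the torus\<close>

text \<open>In (i) only the sum of the |F_j|^2 is controlled pointwise, so two factors F_j and one g
  are spent on each point, and the exponent p - 3 that remains must be nonnegative. The data of the
  G_k have the same moduli as g on the sequence, so the sum to be bounded returns on the right-hand
  side; it is therefore kept finite, and the estimates carry free small constants.

  In (ii) the zeros in z and in w run in opposite directions because, at a point of block i, z to
  the power 100^m has modulus 2 to the power -100^(m-i), whereas exp (- zeta(w) / 100^m) has modulus
  2 to the power -100^(i-m). So the z-factors of earlier blocks and the w-factors of later blocks
  are nearly unimodular there, and dividing by them is harmless; the base 100 keeps the sum of their
  defects below 1/2.

  Universality speaks of one function at a time, so the failure of the Carleson condition for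
  growing n is condensed into one explicit function with non-summable values.\<close>

definition poisson :: "complex \<Rightarrow> complex \<Rightarrow> real" where
  "poisson a z = (1 - (norm a)\<^sup>2) / (norm (1 - cnj a * z))\<^sup>2"

lemma poisson_nonneg: "norm a < 1 \<Longrightarrow> 0 \<le> poisson a z"
  by (simp add: poisson_def power_le_one abs_square_le_1)

lemma norm_one_minus_cnj_mult_ge:
  assumes "norm z \<le> 1" shows "1 - norm a \<le> norm (1 - cnj a * z)"
proof -
  have "norm (cnj a * z) \<le> norm a * 1"
    using assms unfolding norm_mult complex_mod_cnj by (intro mult_left_mono) auto
  then show ?thesis
    using norm_triangle_ineq2[of 1 "cnj a * z"] by simp
qed

text \<open>This trades a Poisson average at \<open>a\<close> for a plain average, at the price of
  the weight. It follows from |1 - cnj a z| \<ge> 1 - |a| and 1 - |a|^2 \<le> 2 (1 - |a|).\<close>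

lemma poisson_le:
  assumes "norm a < 1" "norm z \<le> 1"
  shows "(1 - (norm a)\<^sup>2) * poisson a z \<le> 4"
proof -
  have pos: "0 < 1 - norm a" using assms by simp
  have le: "1 - norm a \<le> norm (1 - cnj a * z)" by (rule norm_one_minus_cnj_mult_ge) fact
  have "1 - (norm a)\<^sup>2 = (1 - norm a) * (1 + norm a)" by (simp add: power2_eq_square algebra_simps)
  also have "\<dots> \<le> norm (1 - cnj a * z) * 2" using le pos assms by (intro mult_mono) auto
  finally have "1 - (norm a)\<^sup>2 \<le> 2 * norm (1 - cnj a * z)" by simp
  then have "(1 - (norm a)\<^sup>2)\<^sup>2 \<le> (2 * norm (1 - cnj a * z))\<^sup>2"
    using assms by (intro power_mono) (auto simp: abs_square_le_1 power_le_one)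
  then show ?thesis
    unfolding poisson_def using pos le
    by (simp add: divide_le_eq power2_eq_square field_simps)
qed

lemma measurable_poisson [measurable]: "poisson a \<in> borel_measurable borel"
  unfolding poisson_def by measurable

text \<open>Boundary functions are only known to be continuous on the circle. Setting them to 0
  elsewhere makes them Borel without changing any integral against
  \<open>circle_measure\<close>.\<close>

lemma borel_measurable_on_sphere:
  fixes h :: "complex \<Rightarrow> 'b::{second_countable_topology, real_normed_vector}"
  assumes "continuous_on (sphere 0 1) h"
  shows "(\<lambda>z. if norm z = 1 then h z else 0) \<in> borel_measurable borel"
proof -
  have "(\<lambda>z. indicator (sphere 0 1) z *\<^sub>R h z) \<in> borel_measurable borel"
    by (rule borel_measurable_continuous_on_indicator) (use assms in auto)
  also have "(\<lambda>z. indicator (sphere 0 1) z *\<^sub>R h z) = (\<lambda>z. if norm z = 1 then h z else 0)"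
    by (auto simp: indicator_def)
  finally show ?thesis .
qed

lemma measurable_cis_uniform: "cis \<in> uniform_measure lborel {0..<2 * pi} \<rightarrow>\<^sub>M borel"
  by (auto simp: measurable_cong_sets[OF sets_uniform_measure refl]
        intro!: borel_measurable_continuous_onI continuous_intros)

lemma nn_integral_circle_cong:
  assumes "\<And>z. norm z = 1 \<Longrightarrow> f z = g z"
  shows "(\<integral>\<^sup>+ z. f z \<partial>circle_measure) = (\<integral>\<^sup>+ z. g z \<partial>circle_measure)"
  by (rule nn_integral_cong_AE) (use AE_circle_measure assms in \<open>auto elim!: eventually_mono\<close>)

lemma nn_integral_circle_mono:
  assumes "\<And>z. norm z = 1 \<Longrightarrow> f z \<le> g z"
  shows "(\<integral>\<^sup>+ z. f z \<partial>circle_measure) \<le> (\<integral>\<^sup>+ z. g z \<partial>circle_measure)"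
  by (rule nn_integral_mono_AE) (use AE_circle_measure assms in \<open>auto elim!: eventually_mono\<close>)

lemma integrable_circle:
  fixes h :: "complex \<Rightarrow> 'b::{second_countable_topology, banach}"
  assumes "h \<in> borel_measurable borel" "continuous_on (sphere 0 1) h"
  shows "integrable circle_measure h"
proof -
  interpret prob_space circle_measure by (rule prob_space_circle_measure)
  have "compact (h ` sphere 0 1)" using assms by (intro compact_continuous_image) auto
  then obtain B where B: "\<And>z. norm z = 1 \<Longrightarrow> norm (h z) \<le> B"
    using compact_imp_bounded bounded_iff by (metis imageI mem_sphere_0)
  show ?thesis
    by (rule integrable_const_bound[where B=B])
      (use AE_circle_measure assms(1) B in \<open>auto elim!: eventually_mono\<close>)
qed

lemma integral_circle:
  fixes h :: "complex \<Rightarrow> complex"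
  assumes h: "h \<in> borel_measurable borel" "continuous_on (sphere 0 1) h"
  shows "integral\<^sup>L circle_measure h = integral {0..2*pi} (\<lambda>t. h (cis t)) / (2 * pi)"
proof -
  have meas: "(\<lambda>t. h (cis t)) \<in> borel_measurable borel"
    using h(1) by (intro measurable_compose[OF _ h(1)] borel_measurable_continuous_onI continuous_intros)
  have "integral\<^sup>L circle_measure h = (LINT t|uniform_measure lborel {0..<2*pi}. h (cis t))"
    unfolding circle_measure_def by (rule integral_distr[OF measurable_cis_uniform]) (use h in auto)
  also have "\<dots> = (LINT t|lborel. (indicator {0..<2*pi} t / (2 * pi)) *\<^sub>R h (cis t))"
  proof -
    have eq: "uniform_measure lborel {0..<2*pi} = density lborel (\<lambda>t. ennreal (indicator {0..<2*pi} t / (2 * pi)))"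
      unfolding uniform_measure_def
      by (rule density_cong) (auto simp: indicator_def divide_ennreal_def inverse_ennreal inverse_eq_divide)
    show ?thesis unfolding eq
      by (rule integral_density) (use meas in auto)
  qed
  also have "\<dots> = (LINT t|lborel. indicator {0..2*pi} t *\<^sub>R (h (cis t) / (2 * pi)))"
  proof (rule integral_cong_AE)
    show "AE t in lborel. (indicator {0..<2*pi} t / (2 * pi)) *\<^sub>R h (cis t) =
        indicator {0..2*pi} t *\<^sub>R (h (cis t) / (2 * pi))"
      using AE_lborel_singleton[of "2*pi"]
      by eventually_elim (auto simp: indicator_def scaleR_conv_of_real field_simps)
  qed (use meas in auto)
  also have "\<dots> = (LINT t:{0..2*pi}|lborel. h (cis t) / (2 * pi))"
    by (simp only: set_lebesgue_integral_def)
  also have "\<dots> = integral {0..2*pi} (\<lambda>t. h (cis t) / (2 * pi))"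
  proof (rule set_borel_integral_eq_integral)
    have "continuous_on {0..2*pi} (\<lambda>t. h (cis t) / (2 * pi))"
      by (intro continuous_intros continuous_on_compose2[OF h(2)]) auto
    then show "set_integrable lborel {0..2*pi} (\<lambda>t. h (cis t) / (2 * pi))"
      by (rule borel_integrable_atLeastAtMost')
  qed
  also have "\<dots> = integral {0..2*pi} (\<lambda>t. h (cis t)) / (2 * pi)"
    by simp
  finally show ?thesis .
qed

text \<open>On the circle z * cnj z = 1, so the Cauchy kernel takes the form 1 / (1 - a cnj z). The
  separate \<open>H\<close> is a Borel representative that has to agree with the formula on the
  circle only.\<close>

lemma circle_cauchy:
  assumes h: "continuous_on (cball 0 1) h" "h holomorphic_on ball 0 1"
    and H: "H \<in> borel_measurable borel" "\<And>z. norm z = 1 \<Longrightarrow> H z = h z / (1 - a * cnj z)"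
    and a: "norm a < 1"
  shows "integral\<^sup>L circle_measure H = h a"
proof -
  have cont: "continuous_on (sphere 0 1) H"
  proof -
    have "1 - a * cnj z \<noteq> 0" if "norm z = 1" for z
    proof
      assume "1 - a * cnj z = 0"
      then have "norm (a * cnj z) = 1" by (metis eq_iff_diff_eq_0 norm_one)
      with a that show False by (simp add: norm_mult)
    qed
    then have "continuous_on (sphere 0 1) (\<lambda>z. h z / (1 - a * cnj z))"
      by (intro continuous_intros continuous_on_subset[OF h(1)]) auto
    then show ?thesis by (rule continuous_on_cong[THEN iffD1, rotated 2]) (use H(2) in auto)
  qed
  have "((\<lambda>u. h u / (u - a)) has_contour_integral (2 * pi) * \<i> * h a) (circlepath 0 1)"
    using Cauchy_integral_circlepath[OF h, of a] a by simp
  then have "((\<lambda>t. h (cis t) / (cis t - a) * \<i> * cis t) has_integral (2 * pi) * \<i> * h a) {0..2*pi}"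
    unfolding circlepath_def by (subst (asm) has_contour_integral_part_circlepath_iff) auto
  then have "((\<lambda>t. (h (cis t) / (cis t - a) * \<i> * cis t) / \<i>) has_integral ((2 * pi) * \<i> * h a) / \<i>) {0..2*pi}"
    by (rule has_integral_divide)
  moreover have "(h (cis t) / (cis t - a) * \<i> * cis t) / \<i> = H (cis t)" for t
  proof -
    have eq: "cis t - a = cis t * (1 - a * cnj (cis t))"
      by (simp add: algebra_simps cis_cnj cis_mult)
    have "x / (c * d) * \<i> * c / \<i> = x / d" if "c \<noteq> 0" for x c d :: complex
      using that by (cases "d = 0") (auto simp: field_simps)
    from this[OF cis_neq_zero] show ?thesis unfolding eq H(2)[OF norm_cis] .
  qed
  moreover have "(complex_of_real (2 * pi) * \<i> * h a) / \<i> = (2 * pi) * h a"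
    by (simp add: field_simps)
  ultimately have "((\<lambda>t. H (cis t)) has_integral (2 * pi) * h a) {0..2*pi}" by (simp only:)
  then have "integral {0..2*pi} (\<lambda>t. H (cis t)) = (2 * pi) * h a" by (rule integral_unique)
  then show ?thesis using integral_circle[OF H(1) cont] by simp
qed

lemma poisson_sphere:
  assumes "norm z = 1"
  shows "complex_of_real (poisson a z) = (1 - a * cnj a) / (1 - cnj a * z) / (1 - a * cnj z)"
proof -
  have "complex_of_real (poisson a z) = (1 - complex_of_real ((norm a)\<^sup>2)) / complex_of_real ((norm (1 - cnj a * z))\<^sup>2)"
    unfolding poisson_def by simp
  also have "\<dots> = (1 - a * cnj a) / ((1 - cnj a * z) * cnj (1 - cnj a * z))"
    by (simp only: complex_norm_square)
  finally show ?thesis by simp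
qed

text \<open>On the circle the Poisson kernel is a Cauchy kernel times a factor holomorphic in z.
  That factor is absorbed into \<open>h\<close>, and it cancels at z = a.\<close>

lemma circle_poisson:
  assumes h: "continuous_on (cball 0 1) h" "h holomorphic_on ball 0 1"
    and H: "H \<in> borel_measurable borel" "\<And>z. norm z = 1 \<Longrightarrow> H z = h z * poisson a z"
    and a: "norm a < 1"
  shows "integral\<^sup>L circle_measure H = h a"
proof -
  let ?h = "\<lambda>z. h z * ((1 - a * cnj a) / (1 - cnj a * z))"
  have nz: "1 - cnj a * z \<noteq> 0" if "norm z \<le> 1" for z
    using norm_one_minus_cnj_mult_ge[OF that, of a] a by auto
  have "integral\<^sup>L circle_measure H = ?h a"
  proof (rule circle_cauchy[where h="?h", OF _ _ H(1) _ a])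
    show "continuous_on (cball 0 1) ?h"
      using nz by (intro continuous_intros h(1)) auto
    show "?h holomorphic_on ball 0 1"
      using nz by (intro holomorphic_intros h(2)) auto
    show "H z = ?h z / (1 - a * cnj z)" if "norm z = 1" for z
      using H(2)[OF that] poisson_sphere[OF that, of a] by simp
  qed
  also have "\<dots> = h a" using nz[of a] a by (simp add: mult.commute)
  finally show ?thesis .
qed

lemma continuous_on_poisson:
  assumes "norm a < 1" shows "continuous_on (sphere 0 1) (poisson a)"
proof -
  have nz: "1 - cnj a * z \<noteq> 0" if "norm z = 1" for z
    using norm_one_minus_cnj_mult_ge[of z a] that assms by auto
  then show ?thesis unfolding poisson_def by (intro continuous_intros) auto
qed

lemma nn_integral_poisson:
  assumes a: "norm a < 1"
  shows "(\<integral>\<^sup>+ z. ennreal (poisson a z) \<partial>circle_measure) = 1"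
proof -
  have "(LINT z|circle_measure. complex_of_real (poisson a z)) = 1"
    by (rule circle_poisson[where h="\<lambda>_. 1" and a=a]) (use a in \<open>auto intro!: holomorphic_intros\<close>)
  then have "(LINT z|circle_measure. poisson a z) = 1"
    by (metis integral_complex_of_real of_real_eq_1_iff)
  moreover have "integrable circle_measure (poisson a)"
    by (rule integrable_circle) (use continuous_on_poisson[OF a] in auto)
  ultimately show ?thesis
    using poisson_nonneg[OF a] by (subst nn_integral_eq_integral) auto
qed

lemma poisson_submean:
  assumes h: "continuous_on (cball 0 1) h" "h holomorphic_on ball 0 1" and a: "norm a < 1"
  shows "ennreal (norm (h a)) \<le> (\<integral>\<^sup>+ z. ennreal (norm (h z) * poisson a z) \<partial>circle_measure)"
proof -
  let ?H = "\<lambda>z. if norm z = 1 then h z * poisson a z else 0"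
  have cont: "continuous_on (sphere 0 1) (\<lambda>z. h z * poisson a z)"
    by (intro continuous_intros continuous_on_poisson a continuous_on_subset[OF h(1)]) auto
  note meas = borel_measurable_on_sphere[OF cont]
  have cont': "continuous_on (sphere 0 1) ?H"
    by (rule continuous_on_cong[THEN iffD1, rotated 2, OF cont]) auto
  have "ennreal (norm (h a)) = ennreal (norm (integral\<^sup>L circle_measure ?H))"
    by (subst circle_poisson[OF h meas _ a]) auto
  also have "\<dots> \<le> (\<integral>\<^sup>+ z. ennreal (norm (?H z)) \<partial>circle_measure)"
    by (rule integral_norm_bound_ennreal) (rule integrable_circle[OF meas cont'])
  also have "\<dots> = (\<integral>\<^sup>+ z. ennreal (norm (h z) * poisson a z) \<partial>circle_measure)"
    by (rule nn_integral_circle_cong) (use poisson_nonneg[OF a] in \<open>auto simp: norm_mult\<close>)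
  finally show ?thesis .
qed

section \<open>The torus measure and the Poisson inequality in several variables\<close>

definition closed_polydisc :: "(complex ^ 'd::finite) set" where
  "closed_polydisc = {z. \<forall>i. norm (z $ i) \<le> 1}"

lemma closed_closed_polydisc: "closed (closed_polydisc :: (complex ^ 'd::finite) set)"
  unfolding closed_polydisc_def by (intro closed_Collect_all closed_Collect_le continuous_intros)

lemma torus_subset_closed_polydisc: "torus \<subseteq> closed_polydisc"
  by (auto simp: torus_def closed_polydisc_def)

lemma open_polydisc: "open (polydisc :: (complex ^ 'd::finite) set)"
  unfolding polydisc_def Collect_all_eq by (intro open_INT ballI open_Collect_less continuous_intros) auto

lemma sets_torus_measure [simp, measurable_cong]: "sets torus_measure = sets borel"
  by (simp add: torus_measure_def)

lemma space_torus_measure [simp]: "space torus_measure = UNIV"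
  by (simp add: torus_measure_def)

lemma AE_torus_measure: "AE x in torus_measure. x \<in> (torus :: (complex ^ 'd::finite) set)"
proof -
  interpret prob_space "torus_measure :: (complex ^ 'd) measure" by (rule prob_space_torus_measure)
  show ?thesis
    by (subst AE_in_set_eq_1) (use closed_torus emeasure_torus in \<open>auto simp: measure_def intro: borel_closed\<close>)
qed

lemma nn_integral_torus_cong:
  assumes "\<And>x. x \<in> torus \<Longrightarrow> f x = g x"
  shows "(\<integral>\<^sup>+ x. f x \<partial>torus_measure) = (\<integral>\<^sup>+ x. g x \<partial>torus_measure)"
  by (rule nn_integral_cong_AE) (use AE_torus_measure assms in \<open>auto elim!: eventually_mono\<close>)

lemma nn_integral_torus_mono:
  assumes "\<And>x. x \<in> torus \<Longrightarrow> f x \<le> g x"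
  shows "(\<integral>\<^sup>+ x. f x \<partial>torus_measure) \<le> (\<integral>\<^sup>+ x. g x \<partial>torus_measure)"
  by (rule nn_integral_mono_AE) (use AE_torus_measure assms in \<open>auto elim!: eventually_mono\<close>)

lemma product_sigma_finite_circle: "product_sigma_finite (\<lambda>_. circle_measure)"
proof -
  interpret prob_space circle_measure by (rule prob_space_circle_measure)
  show ?thesis by unfold_locales
qed

lemma measurable_vec_lambda_merge:
  fixes y :: "complex ^ 'd::finite"
  shows "(\<lambda>x. \<chi> j. if j \<in> S then x j else y $ j) \<in> (\<Pi>\<^sub>M i\<in>S. circle_measure) \<rightarrow>\<^sub>M borel"
proof (rule borel_measurable_euclidean_space[THEN iffD2], rule ballI)
  fix b :: "complex ^ 'd" assume "b \<in> Basis"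
  then obtain i u where b: "b = axis i u" by (auto simp: Basis_vec_def)
  have "(\<lambda>x. if i \<in> S then x i else y $ i) \<in> (\<Pi>\<^sub>M i\<in>S. circle_measure) \<rightarrow>\<^sub>M borel"
    by (subst measurable_cong_sets[OF refl sets_circle_measure[symmetric]]) (cases "i \<in> S"; simp)
  then show "(\<lambda>x. (\<chi> j. if j \<in> S then x j else y $ j) \<bullet> b) \<in> borel_measurable (\<Pi>\<^sub>M i\<in>S. circle_measure)"
    by (simp add: b inner_axis)
qed

lemma nn_integral_torus:
  fixes F :: "complex ^ 'd::finite \<Rightarrow> ennreal"
  assumes "F \<in> borel_measurable borel"
  shows "(\<integral>\<^sup>+ x. F x \<partial>torus_measure) = (\<integral>\<^sup>+ x. F (vec_lambda x) \<partial>(\<Pi>\<^sub>M i\<in>UNIV. circle_measure))"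
  unfolding torus_measure_def by (rule nn_integral_distr) (use assms in auto)

lemma borel_measurable_on_closed_polydisc:
  fixes h :: "complex ^ 'd::finite \<Rightarrow> real"
  assumes "continuous_on closed_polydisc h"
  shows "(\<lambda>x. if x \<in> closed_polydisc then h x else 0) \<in> borel_measurable borel"
proof -
  have "(\<lambda>z. indicator closed_polydisc z *\<^sub>R h z) \<in> borel_measurable borel"
    by (rule borel_measurable_continuous_on_indicator) (use assms closed_closed_polydisc in \<open>auto intro: borel_closed\<close>)
  also have "(\<lambda>z. indicator closed_polydisc z *\<^sub>R h z) = (\<lambda>x. if x \<in> closed_polydisc then h x else 0)"
    by (auto simp: indicator_def)
  finally show ?thesis .
qed

definition vec_upd :: "'a ^ 'd \<Rightarrow> 'd \<Rightarrow> 'a \<Rightarrow> 'a ^ 'd" where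
  "vec_upd y i t = (\<chi> j. if j = i then t else y $ j)"

lemma vec_upd_nth: "vec_upd y i t $ j = (if j = i then t else y $ j)"
  by (simp add: vec_upd_def)

lemma vec_upd_same: "vec_upd y i (y $ i) = y"
  by (simp add: vec_upd_def vec_eq_iff)

lemma continuous_on_vec_upd: "continuous_on A (\<lambda>t::complex. vec_upd y i t)"
proof -
  have "continuous_on A (\<lambda>t::complex. if j = i then t else y $ j)" for j
    by (cases "j = i") auto
  then show ?thesis unfolding vec_upd_def by (intro continuous_intros) auto
qed

lemma torus_poisson_aux:
  fixes h :: "complex ^ 'd::finite \<Rightarrow> complex"
  assumes cont: "continuous_on closed_polydisc h"
    and hol: "\<And>y i. y \<in> closed_polydisc \<Longrightarrow> (\<lambda>t. h (vec_upd y i t)) holomorphic_on ball 0 1"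
    and a: "a \<in> polydisc" and S: "finite S"
  defines "G \<equiv> (\<lambda>x. if x \<in> closed_polydisc then norm (h x) else 0)"
  assumes y: "y \<in> closed_polydisc" "\<And>i. i \<in> S \<Longrightarrow> y $ i = a $ i"
  shows "ennreal (G y) \<le> (\<integral>\<^sup>+ x. ennreal (G (\<chi> i. if i \<in> S then x i else y $ i) *
            (\<Prod>i\<in>S. poisson (a $ i) (x i))) \<partial>(\<Pi>\<^sub>M i\<in>S. circle_measure))"
  using S y
proof (induction S arbitrary: y rule: finite_induct)
  case empty
  then show ?case by (simp add: PiM_empty nn_integral_count_space_finite)
next
  case (insert i S)
  interpret product_sigma_finite "\<lambda>_::'d. circle_measure" by (rule product_sigma_finite_circle)
  have ai: "norm (a $ i) < 1" using a by (simp add: polydisc_def)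
  have G [measurable]: "G \<in> borel_measurable borel"
    unfolding G_def by (intro borel_measurable_on_closed_polydisc continuous_intros cont)
  have meas: "(\<lambda>x. ennreal (G (\<chi> i. if i \<in> T then x i else z $ i) *
            (\<Prod>i\<in>T. poisson (a $ i) (x i)))) \<in> borel_measurable (\<Pi>\<^sub>M i\<in>T. circle_measure)" for T z
  proof -
    note [measurable] = measurable_compose[OF measurable_vec_lambda_merge[of T z] G]
    have [measurable]: "(\<lambda>x. poisson (a $ i) (x i)) \<in> borel_measurable (\<Pi>\<^sub>M i\<in>T. circle_measure)" if "i \<in> T" for i
      using that by measurable
    show ?thesis by measurable
  qed
  have yi: "y $ i = a $ i" using insert.prems by simp
  define y' where "y' = vec_upd y i"
  have y': "y' t \<in> closed_polydisc" if "norm t \<le> 1" for t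
    using insert.prems that by (auto simp: y'_def closed_polydisc_def vec_upd_nth)
  have "ennreal (G y) = ennreal (norm (h (y' (a $ i))))"
    unfolding y'_def yi[symmetric] vec_upd_same using insert.prems(1) by (simp add: G_def)
  \<comment> \<open>Average over coordinate \<open>i\<close> only; the induction hypothesis is then
    applied at \<open>y' z\<close>, where that coordinate is frozen at the boundary value
    \<open>z\<close>.\<close>
  also have "\<dots> \<le> (\<integral>\<^sup>+ z. ennreal (norm (h (y' z)) * poisson (a $ i) z) \<partial>circle_measure)"
  proof (rule poisson_submean[OF _ _ ai])
    show "continuous_on (cball 0 1) (\<lambda>t. h (y' t))"
      using y' unfolding y'_def
      by (intro continuous_on_compose2[OF cont continuous_on_vec_upd]) auto
    show "(\<lambda>t. h (y' t)) holomorphic_on ball 0 1"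
      unfolding y'_def using insert.prems by (intro hol) auto
  qed
  also have "\<dots> \<le> (\<integral>\<^sup>+ z. (\<integral>\<^sup>+ x. ennreal (G (\<chi> j. if j \<in> insert i S then (x(i := z)) j else y $ j) *
            (\<Prod>j\<in>insert i S. poisson (a $ j) ((x(i := z)) j))) \<partial>(\<Pi>\<^sub>M i\<in>S. circle_measure)) \<partial>circle_measure)"
  proof (rule nn_integral_circle_mono)
    fix z :: complex assume z: "norm z = 1"
    have "ennreal (norm (h (y' z)) * poisson (a $ i) z) = ennreal (G (y' z)) * ennreal (poisson (a $ i) z)"
      using z y'[of z] by (subst ennreal_mult'[symmetric]) (auto simp: G_def poisson_nonneg[OF ai])
    also have "\<dots> \<le> (\<integral>\<^sup>+ x. ennreal (G (\<chi> j. if j \<in> S then x j else y' z $ j) *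
            (\<Prod>j\<in>S. poisson (a $ j) (x j))) \<partial>(\<Pi>\<^sub>M i\<in>S. circle_measure)) * ennreal (poisson (a $ i) z)"
    proof (rule mult_right_mono[OF insert.IH])
      show "y' z \<in> closed_polydisc" using y' z by simp
      show "y' z $ j = a $ j" if "j \<in> S" for j
        using that insert.hyps insert.prems(2)[of j] by (auto simp: y'_def vec_upd_nth)
    qed simp
    also have "\<dots> = (\<integral>\<^sup>+ x. ennreal (G (\<chi> j. if j \<in> S then x j else y' z $ j) *
            (\<Prod>j\<in>S. poisson (a $ j) (x j))) * ennreal (poisson (a $ i) z) \<partial>(\<Pi>\<^sub>M i\<in>S. circle_measure))"
      by (rule nn_integral_multc[symmetric]) (rule meas)
    also have "\<dots> = (\<integral>\<^sup>+ x. ennreal (G (\<chi> j. if j \<in> insert i S then (x(i := z)) j else y $ j) *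
            (\<Prod>j\<in>insert i S. poisson (a $ j) ((x(i := z)) j))) \<partial>(\<Pi>\<^sub>M i\<in>S. circle_measure))"
    proof (rule nn_integral_cong)
      fix x :: "'d \<Rightarrow> complex"
      have 1: "(\<chi> j. if j \<in> S then x j else y' z $ j) = (\<chi> j. if j \<in> insert i S then (x(i := z)) j else y $ j)"
        using insert.hyps by (auto simp: vec_eq_iff y'_def vec_upd_nth)
      have 2: "(\<Prod>j\<in>insert i S. poisson (a $ j) ((x(i := z)) j)) = poisson (a $ i) z * (\<Prod>j\<in>S. poisson (a $ j) (x j))"
        using insert.hyps by (subst prod.insert) (auto intro!: prod.cong arg_cong2[where f=times])
      show "ennreal (G (\<chi> j. if j \<in> S then x j else y' z $ j) *
            (\<Prod>j\<in>S. poisson (a $ j) (x j))) * ennreal (poisson (a $ i) z) =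
          ennreal (G (\<chi> j. if j \<in> insert i S then (x(i := z)) j else y $ j) *
            (\<Prod>j\<in>insert i S. poisson (a $ j) ((x(i := z)) j)))"
        unfolding 1 2 by (subst ennreal_mult''[symmetric]) (auto simp: poisson_nonneg[OF ai] mult_ac)
    qed
    finally show "ennreal (norm (h (y' z)) * poisson (a $ i) z) \<le> \<dots>" .
  qed
  also have "\<dots> = (\<integral>\<^sup>+ x. ennreal (G (\<chi> j. if j \<in> insert i S then x j else y $ j) *
            (\<Prod>j\<in>insert i S. poisson (a $ j) (x j))) \<partial>(\<Pi>\<^sub>M i\<in>insert i S. circle_measure))"
    by (rule product_nn_integral_insert_rev[symmetric, OF insert.hyps(1,2) meas])
  finally show ?case .
qed

definition torus_poisson :: "complex ^ 'd::finite \<Rightarrow> complex ^ 'd \<Rightarrow> real" where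
  "torus_poisson a x = (\<Prod>i\<in>UNIV. poisson (a $ i) (x $ i))"

definition szego_weight :: "complex ^ 'd::finite \<Rightarrow> real" where
  "szego_weight a = (\<Prod>i\<in>UNIV. 1 - (norm (a $ i))\<^sup>2)"

lemma measurable_vec_nth [measurable]: "(\<lambda>x :: complex ^ 'd::finite. x $ i) \<in> borel_measurable borel"
  by (intro borel_measurable_continuous_onI continuous_intros)

lemma measurable_torus_poisson [measurable]: "torus_poisson a \<in> borel_measurable borel"
  unfolding torus_poisson_def by measurable

lemma torus_poisson_nonneg: "a \<in> polydisc \<Longrightarrow> 0 \<le> torus_poisson a x"
  unfolding torus_poisson_def polydisc_def by (intro prod_nonneg ballI poisson_nonneg) auto

lemma szego_weight_pos: "a \<in> polydisc \<Longrightarrow> 0 < szego_weight a"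
  unfolding szego_weight_def polydisc_def by (intro prod_pos ballI) (auto simp: abs_square_less_1)

lemma szego_weight_torus_poisson_le:
  assumes "a \<in> polydisc" "x \<in> closed_polydisc"
  shows "szego_weight a * torus_poisson (a :: complex ^ 'd::finite) x \<le> 4 ^ CARD('d)"
proof -
  have "szego_weight a * torus_poisson a x = (\<Prod>i\<in>UNIV. (1 - (norm (a $ i))\<^sup>2) * poisson (a $ i) (x $ i))"
    by (simp add: szego_weight_def torus_poisson_def prod.distrib)
  also have "\<dots> \<le> (\<Prod>i\<in>(UNIV :: 'd set). 4)"
    using assms by (intro prod_mono conjI mult_nonneg_nonneg poisson_nonneg poisson_le)
      (auto simp: polydisc_def closed_polydisc_def abs_square_le_1 less_imp_le)
  finally show ?thesis by simp
qed

lemma nn_integral_torus_poisson: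
  assumes "a \<in> polydisc"
  shows "(\<integral>\<^sup>+ x. ennreal (torus_poisson (a :: complex ^ 'd::finite) x) \<partial>torus_measure) = 1"
proof -
  interpret product_sigma_finite "\<lambda>_::'d. circle_measure" by (rule product_sigma_finite_circle)
  have a: "norm (a $ i) < 1" for i using assms by (simp add: polydisc_def)
  have "(\<integral>\<^sup>+ x. ennreal (torus_poisson a x) \<partial>torus_measure) =
      (\<integral>\<^sup>+ x. (\<Prod>i\<in>UNIV. ennreal (poisson (a $ i) (x i))) \<partial>(\<Pi>\<^sub>M i\<in>UNIV. circle_measure))"
    by (subst nn_integral_torus) (measurable, auto simp: torus_poisson_def prod_ennreal poisson_nonneg[OF a])
  also have "\<dots> = 1"
    by (subst product_nn_integral_prod) (use nn_integral_poisson a in auto)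
  finally show ?thesis .
qed

lemma torus_submean:
  fixes h :: "complex ^ 'd::finite \<Rightarrow> complex"
  assumes cont: "continuous_on closed_polydisc h"
    and hol: "\<And>y i. y \<in> closed_polydisc \<Longrightarrow> (\<lambda>t. h (vec_upd y i t)) holomorphic_on ball 0 1"
    and a: "a \<in> polydisc"
  shows "ennreal (norm (h a)) \<le> (\<integral>\<^sup>+ x. ennreal (norm (h x) * torus_poisson a x) \<partial>torus_measure)"
proof -
  let ?G = "\<lambda>x. if x \<in> closed_polydisc then norm (h x) else 0"
  have aK: "a \<in> closed_polydisc" using a by (auto simp: polydisc_def closed_polydisc_def less_imp_le)
  have [measurable]: "?G \<in> borel_measurable borel"
    by (intro borel_measurable_on_closed_polydisc continuous_intros cont)
  have "ennreal (?G a) \<le> (\<integral>\<^sup>+ x. ennreal (?G (\<chi> i. if i \<in> UNIV then x i else a $ i) *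
            (\<Prod>i\<in>UNIV. poisson (a $ i) (x i))) \<partial>(\<Pi>\<^sub>M i\<in>UNIV. circle_measure))"
    by (rule torus_poisson_aux[OF cont hol a _ aK]) auto
  also have "\<dots> = (\<integral>\<^sup>+ x. ennreal (?G x * torus_poisson a x) \<partial>torus_measure)"
    by (subst nn_integral_torus) (measurable, simp add: torus_poisson_def cong: if_cong)
  also have "\<dots> = (\<integral>\<^sup>+ x. ennreal (norm (h x) * torus_poisson a x) \<partial>torus_measure)"
    by (rule nn_integral_torus_cong) (use torus_subset_closed_polydisc in auto)
  finally show ?thesis using aK by simp
qed

subsection \<open>Holomorphic functions on the polydisc\<close>

lemma norm_vector_smult: "norm (c *s v) = norm (c :: complex) * norm (v :: complex ^ 'd::finite)"
  unfolding norm_vec_def by (simp add: norm_mult L2_set_right_distrib)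

lemma bounded_linear_smult_vec: "bounded_linear (\<lambda>c. c *s (v :: complex ^ 'd::finite))"
proof (rule bounded_linear_intro[where K="norm v"])
qed (simp_all add: norm_vector_smult vec_eq_iff algebra_simps)

lemma sv_holomorphic_on_line:
  fixes f :: "complex ^ 'd::finite \<Rightarrow> complex"
  assumes D: "(f has_derivative D) (at (x + t *s v))" "\<And>c v. D (c *s v) = c * D v"
  shows "((\<lambda>t. f (x + t *s v)) has_field_derivative D v) (at t)"
proof -
  have "((\<lambda>t. x + t *s v) has_derivative (\<lambda>c. c *s v)) (at t)"
    using has_derivative_add[OF has_derivative_const[of x]
        bounded_linear_imp_has_derivative[OF bounded_linear_smult_vec, of v "at t"]] by simp
  from has_derivative_compose[OF this D(1)] show ?thesis
    by (simp add: has_field_derivative_def D(2) mult_commute_abs)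
qed

lemma sv_holomorphic_on_continuous: "sv_holomorphic_on f S \<Longrightarrow> continuous_on S f"
  unfolding sv_holomorphic_on_def
  by (meson continuous_at_imp_continuous_on has_derivative_continuous)

lemma vec_upd_eq_line: "vec_upd y i t = vec_upd y i 0 + t *s axis i (1 :: complex)"
  by (auto simp: vec_eq_iff vec_upd_nth axis_def)

lemma sv_holomorphic_on_vec_upd:
  assumes f: "sv_holomorphic_on f S" and A: "\<And>t. t \<in> A \<Longrightarrow> vec_upd y i t \<in> S"
  shows "(\<lambda>t. f (vec_upd y i t)) holomorphic_on A"
  unfolding holomorphic_on_def
proof
  fix t assume "t \<in> A"
  then obtain D where "(f has_derivative D) (at (vec_upd y i 0 + t *s axis i 1))" "\<And>c v. D (c *s v) = c * D v"
    using f A[of t] unfolding sv_holomorphic_on_def vec_upd_eq_line[symmetric] by blast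
  from sv_holomorphic_on_line[OF this]
  have "((\<lambda>t. f (vec_upd y i t)) has_field_derivative D (axis i 1)) (at t)"
    unfolding vec_upd_eq_line[symmetric] by simp
  then show "(\<lambda>t. f (vec_upd y i t)) field_differentiable at t within A"
    using field_differentiable_at_within field_differentiable_def by blast
qed

lemma sv_holomorphic_on_const: "sv_holomorphic_on (\<lambda>x. c) S"
  unfolding sv_holomorphic_on_def by (auto intro!: exI[of _ "\<lambda>_. 0"])

lemma sv_holomorphic_on_add:
  assumes "sv_holomorphic_on f S" "sv_holomorphic_on g S"
  shows "sv_holomorphic_on (\<lambda>x. f x + g x) S"
  unfolding sv_holomorphic_on_def
proof
  fix z assume "z \<in> S"
  with assms obtain D E where "(f has_derivative D) (at z)" "\<forall>c v. D (c *s v) = c * D v"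
    "(g has_derivative E) (at z)" "\<forall>c v. E (c *s v) = c * E v"
    unfolding sv_holomorphic_on_def by blast
  then show "\<exists>D. ((\<lambda>x. f x + g x) has_derivative D) (at z) \<and> (\<forall>c v. D (c *s v) = c * D v)"
    by (intro exI[of _ "\<lambda>v. D v + E v"]) (auto intro!: has_derivative_add simp: algebra_simps)
qed

lemma sv_holomorphic_on_mult:
  assumes "sv_holomorphic_on f S" "sv_holomorphic_on g S"
  shows "sv_holomorphic_on (\<lambda>x. f x * g x) S"
  unfolding sv_holomorphic_on_def
proof
  fix z assume "z \<in> S"
  with assms obtain D E where "(f has_derivative D) (at z)" "\<forall>c v. D (c *s v) = c * D v"
    "(g has_derivative E) (at z)" "\<forall>c v. E (c *s v) = c * E v"
    unfolding sv_holomorphic_on_def by blast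
  then show "\<exists>D. ((\<lambda>x. f x * g x) has_derivative D) (at z) \<and> (\<forall>c v. D (c *s v) = c * D v)"
    by (intro exI[of _ "\<lambda>v. f z * E v + D v * g z"] conjI has_derivative_mult) (auto simp: algebra_simps)
qed

lemma sv_holomorphic_on_cmult:
  "sv_holomorphic_on f S \<Longrightarrow> sv_holomorphic_on (\<lambda>x. c * f x) S"
  by (intro sv_holomorphic_on_mult sv_holomorphic_on_const)

lemma sv_holomorphic_on_sum:
  assumes "\<And>i. i \<in> I \<Longrightarrow> sv_holomorphic_on (f i) S"
  shows "sv_holomorphic_on (\<lambda>x. \<Sum>i\<in>I. f i x) S"
  using assms by (induction I rule: infinite_finite_induct)
    (auto intro!: sv_holomorphic_on_add sv_holomorphic_on_const)

lemma sv_holomorphic_on_coordinate: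
  assumes \<phi>: "\<phi> holomorphic_on A" "open A" and S: "\<And>x. x \<in> S \<Longrightarrow> x $ i \<in> A"
  shows "sv_holomorphic_on (\<lambda>x :: complex ^ 'd::finite. \<phi> (x $ i)) S"
  unfolding sv_holomorphic_on_def
proof
  fix z :: "complex ^ 'd" assume "z \<in> S"
  then have "(\<phi> has_field_derivative deriv \<phi> (z $ i)) (at (z $ i))"
    using holomorphic_derivI[OF \<phi>] S by blast
  then have "(\<phi> has_derivative (\<lambda>h. deriv \<phi> (z $ i) * h)) (at (z $ i))"
    by (simp add: has_field_derivative_def)
  moreover have "((\<lambda>x. x $ i) has_derivative (\<lambda>x. x $ i)) (at z)"
    by (intro bounded_linear_imp_has_derivative bounded_linear_vec_nth)
  ultimately have "((\<lambda>x. \<phi> (x $ i)) has_derivative (\<lambda>x. deriv \<phi> (z $ i) * x $ i)) (at z)"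
    using has_derivative_compose by blast
  then show "\<exists>D. ((\<lambda>x. \<phi> (x $ i)) has_derivative D) (at z) \<and> (\<forall>c v. D (c *s v) = c * D v)"
    by (intro exI[of _ "\<lambda>x. deriv \<phi> (z $ i) * x $ i"]) auto
qed

lemma scaleR_in_polydisc:
  assumes "0 < r" "r < 1" "x \<in> closed_polydisc"
  shows "r *\<^sub>R x \<in> polydisc"
  unfolding polydisc_def
proof (intro CollectI allI)
  fix i
  have "r * norm (x $ i) \<le> r * 1" using assms by (intro mult_left_mono) (auto simp: closed_polydisc_def)
  also have "\<dots> < 1" using assms by simp
  finally show "norm ((r *\<^sub>R x) $ i) < 1" using assms by simp
qed

lemma continuous_on_scaled:
  assumes f: "sv_holomorphic_on f polydisc" and r: "0 < r" "r < 1"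
  shows "continuous_on closed_polydisc (\<lambda>x. f (r *\<^sub>R x))"
  by (rule continuous_on_compose2[OF sv_holomorphic_on_continuous[OF f]])
    (use scaleR_in_polydisc[OF r] in \<open>auto intro!: continuous_intros\<close>)

lemma sv_holomorphic_scaled_line:
  assumes f: "sv_holomorphic_on f polydisc" and r: "0 < r" "r < 1" and y: "y \<in> closed_polydisc"
  shows "(\<lambda>t. f (r *\<^sub>R vec_upd y i t)) holomorphic_on ball 0 1"
proof -
  have eq: "r *\<^sub>R vec_upd y i t = vec_upd (r *\<^sub>R y) i (of_real r * t)" for t
    by (auto simp: vec_eq_iff vec_upd_nth scaleR_conv_of_real[where 'a=complex])
  have "(\<lambda>t. f (vec_upd (r *\<^sub>R y) i t)) holomorphic_on ball 0 1"
    using scaleR_in_polydisc[OF r y]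
    by (intro sv_holomorphic_on_vec_upd[OF f]) (auto simp: polydisc_def vec_upd_nth)
  note * = holomorphic_on_compose_gen[OF _ this, of "\<lambda>t. of_real r * t" "ball 0 1"]
  have "(\<lambda>t. f (vec_upd (r *\<^sub>R y) i t)) \<circ> (\<lambda>t. of_real r * t) holomorphic_on ball 0 1"
  proof -
    have "r * norm t < 1" if "norm t < 1" for t :: complex
      using mult_left_le_one_le[of "norm t" r] r that by simp
    then show ?thesis using r by (intro *) (auto intro!: holomorphic_intros simp: norm_mult)
  qed
  then show ?thesis unfolding eq o_def .
qed

lemma sv_submean:
  fixes f :: "complex ^ 'd::finite \<Rightarrow> complex"
  assumes f: "sv_holomorphic_on f polydisc" and r: "0 < r" "r < 1" and a: "a \<in> polydisc"
  shows "ennreal (norm (f (r *\<^sub>R a))) \<le> (\<integral>\<^sup>+ x. ennreal (norm (f (r *\<^sub>R x)) * torus_poisson a x) \<partial>torus_measure)"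
  by (rule torus_submean[OF continuous_on_scaled[OF f r] sv_holomorphic_scaled_line[OF f r] a])

text \<open>Weierstrass' theorem in several variables. Cauchy's inequality on complex lines shows
  that the derivatives converge uniformly, and complex linearity passes to the limit.\<close>

lemma sv_holomorphic_uniform_limit:
  fixes F :: "nat \<Rightarrow> complex ^ 'd::finite \<Rightarrow> complex"
  assumes F: "\<And>n. sv_holomorphic_on (F n) S" and S: "open S"
    and lim: "\<And>x. x \<in> S \<Longrightarrow> \<exists>e>0. cball x e \<subseteq> S \<and> uniform_limit (cball x e) F f sequentially"
  shows "sv_holomorphic_on f S"
  unfolding sv_holomorphic_on_def
proof
  fix z assume z: "z \<in> S"
  obtain e0 where e0: "e0 > 0" "cball z e0 \<subseteq> S" "uniform_limit (cball z e0) F f sequentially"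
    using lim[OF z] by auto
  \<comment> \<open>Half of the radius is kept in reserve: a line through a point of
    \<open>ball z e\<close> can run a distance \<open>e\<close> without leaving
    \<open>cball z e0\<close>.\<close>
  define e where "e = e0 / 2"
  have e: "e > 0" using e0 by (simp add: e_def)
  have "\<forall>n. \<forall>x\<in>S. \<exists>D. (F n has_derivative D) (at x) \<and> (\<forall>c v. D (c *s v) = c * D v)"
    using F unfolding sv_holomorphic_on_def by blast
  then obtain D where D: "\<And>n x. x \<in> S \<Longrightarrow> (F n has_derivative D n x) (at x)"
    "\<And>n x c v. x \<in> S \<Longrightarrow> D n x (c *s v) = c * D n x v" by metis
  have est: "norm (D n x v - D m x v) \<le> b / e * norm v"
    if x: "x \<in> ball z e" and b: "\<And>y. y \<in> cball z e0 \<Longrightarrow> norm (F n y - F m y) \<le> b" for n m x v b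
  proof (cases "v = 0")
    case True
    have "x \<in> S" using x e0 e by (auto simp: e_def)
    then have "D k x 0 = 0" for k using D(2)[of x k 0 0] by simp
    then show ?thesis using True by simp
  next
    case False
    \<comment> \<open>The parameter radius at which t v has length \<open>e\<close>. Cauchy's
      inequality then yields a bound proportional to the norm of \<open>v\<close>, that is, an
      operator norm estimate.\<close>
    define \<rho> where "\<rho> = e / norm v"
    have \<rho>: "\<rho> > 0" using e False by (simp add: \<rho>_def)
    have in_ball: "x + t *s v \<in> cball z e0" if "norm t \<le> \<rho>" for t
    proof -
      have "norm (t *s v) \<le> e"
        using that False by (simp add: norm_vector_smult \<rho>_def field_simps)
      moreover have "dist z (x + t *s v) \<le> dist z x + norm (t *s v)"
        using norm_triangle_ineq4[of "z - x" "t *s v"] by (simp add: dist_norm algebra_simps)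
      ultimately show ?thesis using x by (simp add: e_def)
    qed
    let ?g = "\<lambda>t. F n (x + t *s v) - F m (x + t *s v)"
    have der: "(?g has_field_derivative D n (x + t *s v) v - D m (x + t *s v) v) (at t)" if "norm t \<le> \<rho>" for t
    proof -
      have "x + t *s v \<in> S" using in_ball[OF that] e0(2) by blast
      note this [THEN D(1)] this [THEN D(2)]
      from sv_holomorphic_on_line[OF this] show ?thesis by (intro DERIV_diff)
    qed
    have hol: "?g holomorphic_on cball 0 \<rho>"
      unfolding holomorphic_on_def
    proof
      fix t :: complex assume "t \<in> cball 0 \<rho>"
      then have "norm t \<le> \<rho>" by simp
      from der[OF this] have "?g field_differentiable at t"
        unfolding field_differentiable_def by (rule exI)
      then show "?g field_differentiable at t within cball 0 \<rho>"
        by (rule field_differentiable_at_within)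
    qed
    have "norm ((deriv ^^ 1) ?g 0) \<le> fact 1 * b / \<rho> ^ 1"
    proof (rule Cauchy_inequality)
      show "?g holomorphic_on ball 0 \<rho>" using hol by (rule holomorphic_on_subset) auto
      show "continuous_on (cball 0 \<rho>) ?g" using hol by (rule holomorphic_on_imp_continuous_on)
      show "norm (?g t) \<le> b" if "norm (0 - t) = \<rho>" for t
        using that by (intro b in_ball) auto
    qed (use \<rho> in auto)
    moreover have "deriv ?g 0 = D n x v - D m x v"
      using DERIV_imp_deriv[OF der[of 0]] \<rho> by simp
    ultimately show ?thesis using False e by (simp add: \<rho>_def field_simps)
  qed
  have unif: "\<exists>N. \<forall>n\<ge>N. \<forall>m\<ge>N. \<forall>x\<in>ball z e. \<forall>v. norm (D n x v - D m x v) \<le> \<epsilon> * norm v" if "\<epsilon> > 0" for \<epsilon>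
  proof -
    have "\<forall>\<^sub>F n in sequentially. \<forall>y\<in>cball z e0. dist (F n y) (f y) < \<epsilon> * e / 2"
      using e0(3) that e by (intro uniform_limitD) auto
    then obtain N where N: "\<And>n y. n \<ge> N \<Longrightarrow> y \<in> cball z e0 \<Longrightarrow> dist (F n y) (f y) < \<epsilon> * e / 2"
      unfolding eventually_sequentially by blast
    have "norm (D n x v - D m x v) \<le> \<epsilon> * norm v" if "n \<ge> N" "m \<ge> N" "x \<in> ball z e" for n m x v
    proof -
      have "norm (F n y - F m y) \<le> \<epsilon> * e" if "y \<in> cball z e0" for y
        using N[OF \<open>n \<ge> N\<close> that] N[OF \<open>m \<ge> N\<close> that] dist_triangle2[of "F n y" "F m y" "f y"]
        by (simp add: dist_norm)
      from est[OF that(3) this, where v=v] show ?thesis using e by simp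
    qed
    then show ?thesis by blast
  qed
  define g where "g x v = lim (\<lambda>n. D n x v)" for x v
  have conv: "(\<lambda>n. D n x v) \<longlonglongrightarrow> g x v" if "x \<in> ball z e" for x v
  proof -
    have "Cauchy (\<lambda>n. D n x v)"
    proof (rule CauchyI)
      fix \<epsilon> :: real assume \<epsilon>: "\<epsilon> > 0"
      define \<epsilon>' where "\<epsilon>' = \<epsilon> / (norm v + 1)"
      have "\<epsilon>' > 0" using \<epsilon> by (simp add: \<epsilon>'_def add_nonneg_pos)
      then obtain N where N: "\<forall>n\<ge>N. \<forall>m\<ge>N. \<forall>x\<in>ball z e. \<forall>v. norm (D n x v - D m x v) \<le> \<epsilon>' * norm v"
        using unif by blast
      have p: "norm v + 1 > 0" by (simp add: add_nonneg_pos)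
      have "\<epsilon>' * norm v < \<epsilon>"
        unfolding \<epsilon>'_def times_divide_eq_left pos_divide_less_eq[OF p] using \<epsilon> by (simp add: algebra_simps)
      then show "\<exists>M. \<forall>m\<ge>M. \<forall>n\<ge>M. norm (D m x v - D n x v) < \<epsilon>"
        using N that by (intro exI[of _ N]) (meson le_less_trans)
    qed
    then show ?thesis unfolding g_def by (simp add: Cauchy_convergent_iff convergent_LIMSEQ_iff)
  qed
  have d1: "(F n has_derivative D n x) (at x within ball z e)" if "x \<in> ball z e" for n x
  proof -
    have "x \<in> S" using that e0(1,2) e by (auto simp: e_def)
    then show ?thesis by (rule has_derivative_at_withinI[OF D(1)])
  qed
  have d2: "\<forall>\<^sub>F n in sequentially. \<forall>x\<in>ball z e. \<forall>h. norm (D n x h - g x h) \<le> \<epsilon> * norm h"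
    if \<epsilon>: "\<epsilon> > 0" for \<epsilon>
  proof -
    obtain N where N: "\<forall>n\<ge>N. \<forall>m\<ge>N. \<forall>x\<in>ball z e. \<forall>v. norm (D n x v - D m x v) \<le> \<epsilon> * norm v"
      using unif[OF \<epsilon>] by blast
    have "norm (D n x v - g x v) \<le> \<epsilon> * norm v" if "n \<ge> N" "x \<in> ball z e" for n x v
    proof (rule tendsto_upperbound)
      show "(\<lambda>m. norm (D n x v - D m x v)) \<longlonglongrightarrow> norm (D n x v - g x v)"
        by (intro tendsto_intros conv that)
      show "\<forall>\<^sub>F m in sequentially. norm (D n x v - D m x v) \<le> \<epsilon> * norm v"
        using N that unfolding eventually_sequentially by blast
    qed auto
    then show ?thesis unfolding eventually_sequentially by blast
  qed
  have d3: "(\<lambda>n. F n z) \<longlonglongrightarrow> f z" using tendsto_uniform_limitI[OF e0(3)] e0 by simp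
  have d4: "z \<in> ball z e" using e by simp
  note has_derivative_sequence[OF convex_ball d1 d2 d4 d3]
  then obtain h where h: "\<And>x. x \<in> ball z e \<Longrightarrow> (\<lambda>n. F n x) \<longlonglongrightarrow> h x"
    "\<And>x. x \<in> ball z e \<Longrightarrow> (h has_derivative g x) (at x within ball z e)" by blast
  have hf: "h x = f x" if "x \<in> ball z e" for x
    using LIMSEQ_unique[OF h(1)[OF that] tendsto_uniform_limitI[OF e0(3)]] that e by (simp add: e_def)
  have "(h has_derivative g z) (at z)"
    using h(2)[of z] e by (simp add: at_within_open[of z "ball z e"])
  then have "(f has_derivative g z) (at z)"
    by (rule has_derivative_transform_within_open[of _ _ _ _ "ball z e"]) (use e hf in auto)
  moreover have "g z (c *s v) = c * g z v" for c v
  proof -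
    have "(\<lambda>n. D n z (c *s v)) \<longlonglongrightarrow> c * g z v"
      unfolding D(2)[OF z] by (intro tendsto_intros conv) (use e in auto)
    then show ?thesis using LIMSEQ_unique conv e by (metis centre_in_ball)
  qed
  ultimately show "\<exists>D. (f has_derivative D) (at z) \<and> (\<forall>c v. D (c *s v) = c * D v)" by blast
qed

subsection \<open>Uniform interpolation constants\<close>

lemma sum_cis_eq_0:
  fixes m :: int
  assumes "\<bar>m\<bar> < int N" "m \<noteq> 0"
  shows "(\<Sum>j<N. cis (2 * pi * real j * of_int m / real N)) = 0"
proof -
  have N: "N > 0" using assms by auto
  define w where "w = cis (2 * pi * of_int m / real N)"
  have w: "cis (2 * pi * real j * of_int m / real N) = w ^ j" for j
    using Complex.DeMoivre[of "2 * pi * of_int m / real N" j] by (simp add: w_def mult_ac)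
  have "w ^ N = cis (2 * pi * of_int m)" using N by (simp add: w_def Complex.DeMoivre)
  then have wN: "w ^ N = 1" by (simp add: cis_multiple_2pi)
  have "w \<noteq> 1"
  proof
    assume "w = 1"
    then have "cos (2 * pi * of_int m / real N) = 1" by (simp add: w_def complex_eq_iff)
    then obtain k :: int where "2 * pi * of_int m / real N = of_int k * 2 * pi"
      by (auto simp: cos_one_2pi_int)
    then have "of_int m = of_int k * real N" using N by (simp add: field_simps)
    then have "m = k * int N" by (metis of_int_eq_iff of_int_mult of_int_of_nat_eq)
    then show False using assms by (auto simp: abs_mult)
  qed
  then show ?thesis unfolding w by (simp add: sum_gp_strict wN)
qed

text \<open>Used at both ends of the development: for the functions F_j in (i), and for sums of
  Lagrange polynomials over the grids in (ii).\<close>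

lemma dft_parseval:
  fixes x :: "nat \<Rightarrow> complex"
  shows "(\<Sum>j<N. (norm (\<Sum>k<N. cis (- (2 * pi * real j * real k / real N)) * x k))\<^sup>2) = N * (\<Sum>k<N. (norm (x k))\<^sup>2)"
proof -
  let ?e = "\<lambda>j k. cis (- (2 * pi * real j * real k / real N))"
  have inner: "(\<Sum>j<N. ?e j k * cnj (?e j l)) = (if k = l then of_nat N else 0)" if "k < N" "l < N" for k l
  proof -
    have "?e j k * cnj (?e j l) = cis (2 * pi * real j * of_int (int l - int k) / real N)" for j
      by (simp add: cis_cnj cis_mult diff_divide_distrib algebra_simps)
    then show ?thesis using sum_cis_eq_0[of "int l - int k" N] that by auto
  qed
  have "complex_of_real (\<Sum>j<N. (norm (\<Sum>k<N. ?e j k * x k))\<^sup>2)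
      = (\<Sum>j<N. \<Sum>k<N. \<Sum>l<N. (?e j k * cnj (?e j l)) * (x k * cnj (x l)))"
  proof -
    have "complex_of_real ((norm (\<Sum>k<N. ?e j k * x k))\<^sup>2)
        = (\<Sum>k<N. \<Sum>l<N. (?e j k * cnj (?e j l)) * (x k * cnj (x l)))" for j
      unfolding complex_norm_square cnj_sum sum_product by (simp only: complex_cnj_mult mult_ac)
    then show ?thesis by (simp only: of_real_sum)
  qed
  also have "\<dots> = (\<Sum>k<N. \<Sum>l<N. (\<Sum>j<N. ?e j k * cnj (?e j l)) * (x k * cnj (x l)))"
    unfolding sum_distrib_right by (subst sum.swap, rule sum.cong[OF refl], rule sum.swap)
  also have "\<dots> = (\<Sum>k<N. \<Sum>l<N. if l = k then of_nat N * (x k * cnj (x l)) else 0)"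
    by (intro sum.cong refl) (auto simp: inner)
  also have "\<dots> = complex_of_real (N * (\<Sum>k<N. (norm (x k))\<^sup>2))"
    by (simp add: complex_norm_square sum_distrib_left del: of_real_power)
  finally show ?thesis by (simp only: of_real_eq_iff)
qed

section \<open>The gliding hump\<close>

lemma powr_sum_disjoint:
  fixes f :: "'a \<Rightarrow> complex"
  assumes "finite A" "\<And>i j. i \<in> A \<Longrightarrow> j \<in> A \<Longrightarrow> f i \<noteq> 0 \<Longrightarrow> f j \<noteq> 0 \<Longrightarrow> i = j"
  shows "norm (\<Sum>i\<in>A. f i) powr p = (\<Sum>i\<in>A. norm (f i) powr p)"
proof (cases "\<exists>i\<in>A. f i \<noteq> 0")
  case True
  then obtain i where i: "i \<in> A" "f i \<noteq> 0" by blast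
  have 0: "f j = 0" if "j \<in> A - {i}" for j using assms(2)[of i j] i that by auto
  have "(\<Sum>i\<in>A. f i) = f i" using assms(1) i 0 by (simp add: sum.remove[of A i])
  moreover have "(\<Sum>i\<in>A. norm (f i) powr p) = norm (f i) powr p"
    using assms(1) i 0 by (simp add: sum.remove[of A i])
  ultimately show ?thesis by simp
qed auto

text \<open>Read \<open>good K N b\<close> as: the first \<open>N\<close> values of \<open>b\<close>
  have an interpolant of cost at most \<open>K\<close>. Without a uniform constant there are
  disjointly supported blocks u_k of norm at most 1 and rapidly growing cost. Their sum with
  coefficients 1 / 2^k has finite norm, and an interpolant of finite cost for it would give one of
  too small cost for some u_k.\<close>

lemma uniform_bound_of_pointwise:
  fixes good :: "real \<Rightarrow> nat \<Rightarrow> (nat \<Rightarrow> complex) \<Rightarrow> bool" and W :: "nat \<Rightarrow> real"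
  assumes p: "p \<ge> 1" and W: "\<And>n. W n > 0"
    and mono: "\<And>K L N b. good K N b \<Longrightarrow> K \<le> L \<Longrightarrow> good L N b"
    and cong: "\<And>K N b c. good K N b \<Longrightarrow> (\<And>n. n < N \<Longrightarrow> b n = c n) \<Longrightarrow> good K N c"
    and add: "\<And>K L N b c. good K N b \<Longrightarrow> good L N c \<Longrightarrow> 0 \<le> K \<Longrightarrow> 0 \<le> L \<Longrightarrow>
                good (2 powr p * (K + L)) N (\<lambda>n. b n + c n)"
    and cmult: "\<And>K N b c. good K N b \<Longrightarrow> 0 \<le> K \<Longrightarrow> good (norm c powr p * K) N (\<lambda>n. c * b n)"
    and ex: "\<And>b. summable (\<lambda>n. W n * norm (b n) powr p) \<Longrightarrow> \<exists>R\<ge>0. \<forall>N. good R N b"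
  shows "\<exists>C\<ge>0. \<forall>N b. good (C * (\<Sum>n<N. W n * norm (b n) powr p)) N b"
proof (rule ccontr)
  assume contra: "\<not> ?thesis"
  have zero: "good 0 N (\<lambda>_. 0)" for N
  proof -
    obtain R where "R \<ge> 0" "good R N (\<lambda>_. 0)" using ex[of "\<lambda>_. 0"] by auto
    from cmult[OF this(2,1), of 0] show ?thesis by simp
  qed
  \<comment> \<open>Data supported below \<open>M\<close> with bounded entries cost at most a
    constant depending only on \<open>M\<close>: coordinates are added one at a time, and each unit
    vector has finite cost.\<close>
  have fin: "\<exists>D\<ge>0. \<forall>b N. (\<forall>n\<ge>M. b n = 0) \<longrightarrow> (\<forall>n<M. W n * norm (b n) powr p \<le> 1) \<longrightarrow> good D N b" for M
  proof (induction M)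
    case 0
    show ?case using zero by (intro exI[of _ 0]) (auto intro: cong)
  next
    case (Suc M)
    then obtain D where D: "D \<ge> 0"
      "\<And>b N. (\<forall>n\<ge>M. b n = 0) \<Longrightarrow> (\<forall>n<M. W n * norm (b n) powr p \<le> 1) \<Longrightarrow> good D N b" by blast
    have "summable (\<lambda>n. W n * norm (if n = M then 1 else 0 :: complex) powr p)"
      by (rule summable_finite[of "{M}"]) auto
    from ex[OF this] obtain R where R: "R \<ge> 0" "\<And>N. good R N (\<lambda>n. if n = M then 1 else 0)" by blast
    have "good (2 powr p * (D + 1 / W M * R)) N b"
      if b: "\<forall>n\<ge>Suc M. b n = 0" "\<forall>n<Suc M. W n * norm (b n) powr p \<le> 1" for b N
    proof -
      let ?b1 = "\<lambda>n. if n < M then b n else 0"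
      have 1: "good D N ?b1" by (rule D(2)) (use b in auto)
      have "norm (b M) powr p \<le> 1 / W M" using b(2) W[of M] by (simp add: field_simps)
      then have "norm (b M) powr p * R \<le> 1 / W M * R" using R(1) by (rule mult_right_mono)
      from mono[OF cmult[OF R(2,1), of "b M"] this]
      have 2: "good (1 / W M * R) N (\<lambda>n. b M * (if n = M then 1 else 0))" .
      have "0 \<le> 1 / W M * R" using R(1) W[of M] by simp
      from add[OF 1 2 D(1) this] show ?thesis
        by (rule cong) (use b(1) in \<open>auto simp: not_less dest: le_neq_implies_less\<close>)
    qed
    moreover have "0 \<le> 2 powr p * (D + 1 / W M * R)" using D(1) R(1) W[of M] by simp
    ultimately show ?case by blast
  qed
  then obtain D where D: "\<And>M. D M \<ge> 0"
    "\<And>M b N. (\<forall>n\<ge>M. b n = 0) \<Longrightarrow> (\<forall>n<M. W n * norm (b n) powr p \<le> 1) \<Longrightarrow> good (D M) N b"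
    by metis
  \<comment> \<open>Expensive data exist beyond any \<open>M\<close>: a normalized counterexample
    has a head below \<open>M\<close> of cost at most \<open>D M\<close>, so its tail must be
    expensive.\<close>
  have step: "\<exists>N b. (\<forall>n. b n \<noteq> 0 \<longrightarrow> M \<le> n \<and> n < N) \<and> (\<Sum>n<N. W n * norm (b n) powr p) \<le> 1 \<and> \<not> good K N b \<and> M < N"
    if K: "K \<ge> 0" for M K
  proof -
    \<comment> \<open>What \<open>add\<close> returns for a head of cost \<open>D M\<close> and a
      tail of cost \<open>K\<close>. Failure at level \<open>C\<close> thus forces the tail to fail
      at level \<open>K\<close>.\<close>
    define C where "C = 2 powr p * (D M + K)"
    have C: "C \<ge> 0" using K D(1) by (simp add: C_def)
    obtain N b where b: "\<not> good (C * (\<Sum>n<N. W n * norm (b n) powr p)) N b" using contra C by blast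
    define S where "S = (\<Sum>n<N. W n * norm (b n) powr p)"
    have S0: "S \<ge> 0" unfolding S_def using W by (intro sum_nonneg mult_nonneg_nonneg) (auto simp: less_imp_le)
    have "S \<noteq> 0"
    proof
      assume "S = 0"
      then have "\<forall>n<N. W n * norm (b n) powr p = 0"
        unfolding S_def using W by (subst (asm) sum_nonneg_eq_0_iff) (auto simp: less_imp_le)
      then have "\<forall>n<N. b n = 0" using W by (metis less_irrefl mult_eq_0_iff norm_eq_zero powr_eq_0_iff)
      then have "good 0 N b" using zero by (rule_tac cong) auto
      then show False using b \<open>S = 0\<close> by (simp add: S_def)
    qed
    with S0 have S: "S > 0" by simp
    define c where "c = S powr (- 1 / p)"
    have "c powr p = S powr - 1" using p by (simp add: c_def powr_powr)
    then have c: "c > 0" "c powr p = 1 / S" using S by (auto simp: c_def powr_minus_divide)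
    define b' where "b' = (\<lambda>n. if n < N then of_real c * b n else 0)"
    have normb': "norm (b' n) powr p = norm (b n) powr p / S" if "n < N" for n
      using that c by (simp add: b'_def norm_mult powr_mult)
    have Sb': "(\<Sum>n<N. W n * norm (b' n) powr p) = 1"
    proof -
      have "(\<Sum>n<N. W n * norm (b' n) powr p) = S / S"
        unfolding S_def sum_divide_distrib by (intro sum.cong refl) (use normb' in \<open>auto simp: S_def\<close>)
      then show ?thesis using S by simp
    qed
    have ng: "\<not> good C N b'"
    proof
      assume "good C N b'"
      from cmult[OF this C, of "of_real (1 / c)"]
      have "good (norm (of_real (1/c) :: complex) powr p * C) N b"
        by (rule cong) (use c in \<open>auto simp: b'_def\<close>)
      moreover have "norm (of_real (1/c) :: complex) powr p = S"
        using c S by (simp add: norm_divide powr_divide)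
      ultimately show False using b by (simp add: S_def mult.commute)
    qed
    define b2 where "b2 = (\<lambda>n. if M \<le> n then b' n else 0)"
    have 1: "good (D M) N (\<lambda>n. if n < M then b' n else 0)"
    proof (rule D(2))
      have "W n * norm (b' n) powr p \<le> 1" if "n < N" for n
        unfolding Sb'[symmetric] by (rule member_le_sum) (use that W in \<open>auto simp: less_imp_le\<close>)
      moreover have "b' n = 0" if "\<not> n < N" for n using that by (simp add: b'_def)
      ultimately show "\<forall>n<M. W n * norm (if n < M then b' n else 0) powr p \<le> 1"
        by (metis mult_zero_right norm_zero powr_0 zero_le_one)
    qed auto
    have ng2: "\<not> good K N b2"
    proof
      assume "good K N b2"
      from add[OF 1 this D(1) K] have "good C N b'"
        unfolding C_def by (rule cong) (auto simp: b2_def)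
      then show False using ng by simp
    qed
    have "M < N"
    proof (rule ccontr)
      assume "\<not> M < N"
      then have "good 0 N b2" by (intro cong[OF zero]) (auto simp: b2_def)
      then show False using ng2 mono K by blast
    qed
    moreover have "(\<Sum>n<N. W n * norm (b2 n) powr p) \<le> 1"
      unfolding Sb'[symmetric] using W by (intro sum_mono) (auto simp: b2_def less_imp_le)
    ultimately show ?thesis using ng2 by (intro exI[of _ N] exI[of _ b2]) (auto simp: b2_def b'_def split: if_splits)
  qed
  \<comment> \<open>The cost that the final argument achieves for block \<open>k\<close>: remove the
    earlier blocks from the full sum, whose cost is at most \<open>k\<close> for large
    \<open>k\<close>, then undo the division by 2^k.\<close>
  define \<kappa> where "\<kappa> k M = (2 ^ k) powr p * (2 powr p * (real k + D M))" for k :: nat and M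
  have \<kappa>: "\<kappa> k M \<ge> 0" for k M using D(1) by (simp add: \<kappa>_def)
  define Q where "Q k M N b \<longleftrightarrow> (\<forall>n. b n \<noteq> 0 \<longrightarrow> M \<le> n \<and> n < N) \<and>
      (\<Sum>n<N. W n * norm (b n) powr p) \<le> 1 \<and> \<not> good (\<kappa> k M) N b \<and> M < N" for k M N and b :: "nat \<Rightarrow> complex"
  have "\<forall>k M. \<exists>N b. Q k M N b"
    unfolding Q_def using step \<kappa> by simp
  then obtain nxt B where "\<And>k M. Q k M (nxt k M) (B k M)"
    by metis
  then have nxt: "\<And>k M n. B k M n \<noteq> 0 \<Longrightarrow> M \<le> n \<and> n < nxt k M"
      "\<And>k M. (\<Sum>n<nxt k M. W n * norm (B k M n) powr p) \<le> 1"
      "\<And>k M. \<not> good (\<kappa> k M) (nxt k M) (B k M)" "\<And>k M. M < nxt k M"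
    unfolding Q_def by auto
  define m where "m = rec_nat 0 nxt"
  have m: "m 0 = 0" "m (Suc k) = nxt k (m k)" for k by (auto simp: m_def)
  define u where "u k = B k (m k)" for k
  have sm: "strict_mono m" using nxt(4) m by (simp add: strict_mono_Suc_iff)
  have u1: "m k \<le> n \<and> n < m (Suc k)" if "u k n \<noteq> 0" for k n using nxt(1)[of k "m k" n] that m by (simp add: u_def)
  have disj: "k = l" if "u k n \<noteq> 0" "u l n \<noteq> 0" for k l n
  proof -
    have "\<not> k < l" "\<not> l < k"
      using u1[OF that(1)] u1[OF that(2)] strict_mono_less_eq[OF sm, of "Suc k" l] strict_mono_less_eq[OF sm, of "Suc l" k]
      by auto
    then show ?thesis by simp
  qed
  have late: "u k n = 0" if "n < k" for k n
    using u1[of k n] strict_mono_imp_increasing[OF sm, of k] that by fastforce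
  \<comment> \<open>At most one summand is nonzero, and block \<open>k\<close> starts at an index at
    least \<open>k\<close>, so summing over k \<le> n already captures all blocks at
    \<open>n\<close>.\<close>
  define b where "b n = (\<Sum>k\<le>n. u k n / 2 ^ k)" for n
  have bpow: "norm (\<Sum>k\<in>A. u k n / 2 ^ k) powr p = (\<Sum>k\<in>A. norm (u k n / 2 ^ k) powr p)" if "finite A" for A n
    by (rule powr_sum_disjoint[OF that]) (use disj in auto)
  have usum: "(\<Sum>n<L. W n * norm (u k n / 2 ^ k) powr p) \<le> (1/2) ^ k" for L k
  proof -
    have "(2::real) ^ k = (2 ^ k) powr 1" by simp
    also have "\<dots> \<le> (2 ^ k) powr p" using p by (intro powr_mono) auto
    finally have 2: "1 / (2 ^ k) powr p \<le> (1/2) ^ k" by (simp add: divide_simps)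
    have "(\<Sum>n<L. W n * norm (u k n) powr p) \<le> (\<Sum>n<m (Suc k). W n * norm (u k n) powr p)"
    proof -
      have "(\<Sum>n<L. W n * norm (u k n) powr p) = (\<Sum>n\<in>{..<L} \<inter> {..<m (Suc k)}. W n * norm (u k n) powr p)"
      proof (rule sum.mono_neutral_right)
        have "u k n = 0" if "\<not> n < m (Suc k)" for n using u1[of k n] that by blast
        then show "\<forall>i\<in>{..<L} - {..<L} \<inter> {..<m (Suc k)}. W i * norm (u k i) powr p = 0" by simp
      qed auto
      also have "\<dots> \<le> (\<Sum>n<m (Suc k). W n * norm (u k n) powr p)"
        using W by (intro sum_mono2) (auto simp: less_imp_le)
      finally show ?thesis .
    qed
    also have "\<dots> \<le> 1" using nxt(2)[of k "m k"] by (simp add: u_def m)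
    finally have 1: "(\<Sum>n<L. W n * norm (u k n) powr p) \<le> 1" .
    have "(\<Sum>n<L. W n * norm (u k n / 2 ^ k) powr p) = (\<Sum>n<L. W n * norm (u k n) powr p) * (1 / (2 ^ k) powr p)"
      by (simp add: norm_divide norm_power powr_divide sum_divide_distrib)
    also have "\<dots> \<le> 1 * (1/2) ^ k" using 1 2 by (intro mult_mono) auto
    finally show ?thesis by simp
  qed
  have "summable (\<lambda>n. W n * norm (b n) powr p)"
  proof (rule bounded_imp_summable)
    show "0 \<le> W n * norm (b n) powr p" for n using W[of n] by simp
    show "(\<Sum>n\<le>L. W n * norm (b n) powr p) \<le> 2" for L
    proof -
      have "(\<Sum>n\<le>L. W n * norm (b n) powr p) = (\<Sum>n\<le>L. \<Sum>k\<le>n. W n * norm (u k n / 2 ^ k) powr p)"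
        by (simp add: b_def bpow sum_distrib_left)
      also have "\<dots> \<le> (\<Sum>n\<le>L. \<Sum>k\<le>L. W n * norm (u k n / 2 ^ k) powr p)"
        using W by (intro sum_mono sum_mono2) (auto simp: less_imp_le)
      also have "\<dots> = (\<Sum>k\<le>L. \<Sum>n<Suc L. W n * norm (u k n / 2 ^ k) powr p)"
        by (subst sum.swap) (simp add: lessThan_Suc_atMost)
      also have "\<dots> \<le> (\<Sum>k\<le>L. (1/2) ^ k)" by (intro sum_mono usum)
      also have "\<dots> \<le> 2" by (subst sum_gp0) (auto simp: field_simps)
      finally show ?thesis .
    qed
  qed
  from ex[OF this] obtain R where R: "R \<ge> 0" "\<And>N. good R N b" by blast
  define k where "k = nat \<lceil>R\<rceil>"
  have k: "R \<le> real k" using R(1) by (simp add: k_def)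
  \<comment> \<open>Cancels the earlier blocks. By disjointness each of its entries comes from a
    single block and has weighted power at most 1, so its cost is at most
    \<open>D (m k)\<close>.\<close>
  let ?e = "\<lambda>n. - (\<Sum>l<k. u l n / 2 ^ l)"
  have "good (D (m k)) (m (Suc k)) ?e"
  proof (rule D(2))
    show "\<forall>n\<ge>m k. ?e n = 0"
    proof (intro allI impI)
      fix n assume n: "m k \<le> n"
      have "u l n = 0" if "l < k" for l
        using u1[of l n] n strict_mono_less_eq[OF sm, of "Suc l" k] that by fastforce
      then show "?e n = 0" by simp
    qed
    show "\<forall>n<m k. W n * norm (?e n) powr p \<le> 1"
    proof (intro allI impI)
      fix n
      show "W n * norm (?e n) powr p \<le> 1"
      proof (cases "\<exists>l<k. u l n \<noteq> 0")
        case True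
        then obtain l where l: "l < k" "u l n \<noteq> 0" by blast
        have "norm (?e n) powr p = (\<Sum>i<k. norm (u i n / 2 ^ i) powr p)" by (simp add: bpow)
        also have "\<dots> = norm (u l n / 2 ^ l) powr p"
        proof -
          have "u i n = 0" if "i \<noteq> l" for i using disj[of i n l] l that by blast
          then show ?thesis using l by (simp add: sum.remove[of _ l])
        qed
        finally have eq: "norm (?e n) powr p = norm (u l n / 2 ^ l) powr p" .
        have "W n * norm (u l n / 2 ^ l) powr p \<le> (\<Sum>n<Suc n. W n * norm (u l n / 2 ^ l) powr p)"
          by (rule member_le_sum) (use W in \<open>auto simp: less_imp_le\<close>)
        also have "\<dots> \<le> (1/2) ^ l" by (rule usum)
        also have "\<dots> \<le> 1" by (simp add: power_le_one)
        finally show ?thesis unfolding eq .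
      qed auto
    qed
  qed
  from add[OF R(2) this R(1) D(1)]
  have "good (2 powr p * (R + D (m k))) (m (Suc k)) (\<lambda>n. u k n / 2 ^ k)"
  proof (rule cong)
    fix n assume n: "n < m (Suc k)"
    \<comment> \<open>Later blocks begin at \<open>m (Suc k)\<close> or beyond, so truncation to the
      first \<open>m (Suc k)\<close> values makes them invisible.\<close>
    have 0: "u l n = 0" if "k < l" for l
      using u1[of l n] n strict_mono_less_eq[OF sm, of "Suc k" l] that by fastforce
    have "b n = (\<Sum>l\<le>max n k. u l n / 2 ^ l)"
      unfolding b_def by (rule sum.mono_neutral_left) (use late in auto)
    also have "\<dots> = (\<Sum>l\<le>k. u l n / 2 ^ l)"
      by (rule sum.mono_neutral_right) (use 0 in auto)
    also have "\<dots> = u k n / 2 ^ k + (\<Sum>l<k. u l n / 2 ^ l)"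
      by (simp add: lessThan_Suc_atMost[symmetric])
    finally show "b n + ?e n = u k n / 2 ^ k" by simp
  qed
  from cmult[OF this, of "2 ^ k"]
  have "good ((2 ^ k) powr p * (2 powr p * (R + D (m k)))) (m (Suc k)) (\<lambda>n. 2 ^ k * (u k n / 2 ^ k))"
    using R(1) D(1) by (simp add: norm_power)
  then have "good ((2 ^ k) powr p * (2 powr p * (R + D (m k)))) (m (Suc k)) (u k)"
    by (rule cong) simp
  then have "good (\<kappa> k (m k)) (m (Suc k)) (u k)"
    by (rule mono) (use k in \<open>auto simp: \<kappa>_def intro!: mult_left_mono\<close>)
  then show False using nxt(3)[of k "m k"] by (simp add: u_def m)
qed

section \<open>Hardy norms of dilated functions\<close>

lemma szego_weight_powr:
  assumes "a \<in> polydisc"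
  shows "(\<Prod>i\<in>UNIV. (1 - (norm (a $ i))\<^sup>2) powr q) = szego_weight a powr q"
  unfolding szego_weight_def using assms
  by (intro prod_powr_distrib[symmetric])

lemma norm_interp_map_powr:
  assumes "\<Lambda> n \<in> polydisc" "p > 0"
  shows "norm (interp_map p \<Lambda> f n) powr p = szego_weight (\<Lambda> n) * norm (f (\<Lambda> n)) powr p"
  using assms szego_weight_pos[OF assms(1)]
  by (simp add: interp_map_def szego_weight_powr norm_mult powr_mult powr_powr del: of_real_prod)

text \<open>Members of \<open>hardy_space\<close> are arbitrary off the polydisc. Cutting the dilate
  off outside the closed polydisc gives a Borel function on the whole space.\<close>

definition scaled :: "real \<Rightarrow> (complex ^ 'd::finite \<Rightarrow> complex) \<Rightarrow> complex ^ 'd \<Rightarrow> complex" where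
  "scaled r f x = (if x \<in> closed_polydisc then f (r *\<^sub>R x) else 0)"

lemma scaled_torus: "x \<in> torus \<Longrightarrow> scaled r f x = f (r *\<^sub>R x)"
  using torus_subset_closed_polydisc by (auto simp: scaled_def)

lemma measurable_scaled:
  assumes "sv_holomorphic_on f polydisc" "0 < r" "r < 1"
  shows "scaled r f \<in> borel_measurable borel"
proof -
  have "(\<lambda>x. indicator closed_polydisc x *\<^sub>R f (r *\<^sub>R x)) \<in> borel_measurable borel"
    by (rule borel_measurable_continuous_on_indicator)
      (use continuous_on_scaled[OF assms] closed_closed_polydisc in \<open>auto intro: borel_closed\<close>)
  also have "(\<lambda>x. indicator closed_polydisc x *\<^sub>R f (r *\<^sub>R x)) = scaled r f"
    by (auto simp: indicator_def scaled_def fun_eq_iff)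
  finally show ?thesis .
qed

lemma hardy_norm_powr_eq:
  "hardy_norm_powr p f = (SUP r\<in>{0<..<1}. \<integral>\<^sup>+ x. ennreal (norm (scaled r f x) powr p) \<partial>torus_measure)"
  unfolding hardy_norm_powr_def
  by (intro SUP_cong refl nn_integral_torus_cong) (auto simp: scaled_torus)

lemma hardy_mean_le:
  assumes "0 < r" "r < 1"
  shows "(\<integral>\<^sup>+ x. ennreal (norm (scaled r f x) powr p) \<partial>torus_measure) \<le> hardy_norm_powr p f"
  unfolding hardy_norm_powr_eq by (rule SUP_upper) (use assms in auto)

lemma powr_add_le:
  assumes "x \<ge> 0" "y \<ge> 0" "p > 0"
  shows "(x + y) powr p \<le> 2 powr p * (x powr p + y powr (p::real))"
proof -
  have "(x + y) powr p \<le> (2 * max x y) powr p" using assms by (intro powr_mono2) auto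
  also have "\<dots> = 2 powr p * max x y powr p" using assms by (simp add: powr_mult)
  also have "max x y powr p \<le> x powr p + y powr p" by (auto simp: max_def)
  finally show ?thesis by simp
qed

lemma hardy_norm_powr_add_le:
  assumes f: "sv_holomorphic_on f polydisc" and g: "sv_holomorphic_on g polydisc" and p: "p > 0"
  shows "hardy_norm_powr p (\<lambda>x. f x + g x) \<le> ennreal (2 powr p) * (hardy_norm_powr p f + hardy_norm_powr p g)"
  unfolding hardy_norm_powr_eq[of p "\<lambda>x. f x + g x"]
proof (rule SUP_least)
  fix r :: real assume "r \<in> {0<..<1}"
  then have r: "0 < r" "r < 1" by auto
  note [measurable] = measurable_scaled[OF f r] measurable_scaled[OF g r]
  have "(\<integral>\<^sup>+ x. ennreal (norm (scaled r (\<lambda>x. f x + g x) x) powr p) \<partial>torus_measure) \<le>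
    (\<integral>\<^sup>+ x. ennreal (2 powr p) * (ennreal (norm (scaled r f x) powr p) + ennreal (norm (scaled r g x) powr p)) \<partial>torus_measure)"
  proof (rule nn_integral_mono)
    fix x
    have "norm (scaled r (\<lambda>x. f x + g x) x) powr p \<le> (norm (scaled r f x) + norm (scaled r g x)) powr p"
      using p by (intro powr_mono2) (auto simp: scaled_def norm_triangle_ineq)
    also have "\<dots> \<le> 2 powr p * (norm (scaled r f x) powr p + norm (scaled r g x) powr p)"
      using p by (intro powr_add_le) auto
    finally show "ennreal (norm (scaled r (\<lambda>x. f x + g x) x) powr p) \<le>
       ennreal (2 powr p) * (ennreal (norm (scaled r f x) powr p) + ennreal (norm (scaled r g x) powr p))"
      by (simp add: ennreal_mult[symmetric] ennreal_plus[symmetric] ennreal_leI del: ennreal_plus)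
  qed
  also have "\<dots> = ennreal (2 powr p) * ((\<integral>\<^sup>+ x. ennreal (norm (scaled r f x) powr p) \<partial>torus_measure) +
      (\<integral>\<^sup>+ x. ennreal (norm (scaled r g x) powr p) \<partial>torus_measure))"
    by (simp add: nn_integral_cmult nn_integral_add)
  also have "\<dots> \<le> ennreal (2 powr p) * (hardy_norm_powr p f + hardy_norm_powr p g)"
    by (intro mult_left_mono add_mono hardy_mean_le r) auto
  finally show "(\<integral>\<^sup>+ x. ennreal (norm (scaled r (\<lambda>x. f x + g x) x) powr p) \<partial>torus_measure) \<le> \<dots>" .
qed

lemma hardy_norm_powr_cmult:
  assumes "sv_holomorphic_on f polydisc"
  shows "hardy_norm_powr p (\<lambda>x. c * f x) \<le> ennreal (norm c powr p) * hardy_norm_powr p f"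
  unfolding hardy_norm_powr_eq[of p "\<lambda>x. c * f x"]
proof (rule SUP_least)
  fix r :: real assume "r \<in> {0<..<1}"
  then have r: "0 < r" "r < 1" by auto
  note [measurable] = measurable_scaled[OF assms r]
  have "(\<integral>\<^sup>+ x. ennreal (norm (scaled r (\<lambda>x. c * f x) x) powr p) \<partial>torus_measure) =
    (\<integral>\<^sup>+ x. ennreal (norm c powr p) * ennreal (norm (scaled r f x) powr p) \<partial>torus_measure)"
    by (intro nn_integral_cong) (auto simp: scaled_def norm_mult powr_mult ennreal_mult)
  also have "\<dots> \<le> ennreal (norm c powr p) * hardy_norm_powr p f"
    by (subst nn_integral_cmult) (auto intro!: mult_left_mono hardy_mean_le r)
  finally show "(\<integral>\<^sup>+ x. ennreal (norm (scaled r (\<lambda>x. c * f x) x) powr p) \<partial>torus_measure) \<le> \<dots>" .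
qed

text \<open>To avoid proving \<open>H\<^sup>p\<close> complete, only interpolation at finitely many points is controlled;
  the bound is uniform in their number.\<close>

lemma simply_interpolating_uniform:
  fixes \<Lambda> :: "nat \<Rightarrow> complex ^ 'd::finite"
  assumes p: "p \<ge> 1" and \<Lambda>: "\<And>n. \<Lambda> n \<in> polydisc" and si: "simply_interpolating p \<Lambda>"
  obtains C where "C \<ge> 0" "\<And>N b. \<exists>G\<in>hardy_space p. (\<forall>n<N. G (\<Lambda> n) = b n) \<and>
      hardy_norm_powr p G \<le> ennreal (C * (\<Sum>n<N. szego_weight (\<Lambda> n) * norm (b n) powr p))"
proof -
  define good where "good K N b \<longleftrightarrow> (\<exists>G\<in>hardy_space p. (\<forall>n<N. G (\<Lambda> n) = b n) \<and> hardy_norm_powr p G \<le> ennreal K)"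
    for K N and b :: "nat \<Rightarrow> complex"
  have "\<exists>C\<ge>0. \<forall>N b. good (C * (\<Sum>n<N. szego_weight (\<Lambda> n) * norm (b n) powr p)) N b"
  proof (rule uniform_bound_of_pointwise[OF p])
    show "szego_weight (\<Lambda> n) > 0" for n by (rule szego_weight_pos[OF \<Lambda>])
    show "good L N b" if "good K N b" "K \<le> L" for K L N b
      using that unfolding good_def by (meson ennreal_leI order_trans)
    show "good K N c" if "good K N b" "\<And>n. n < N \<Longrightarrow> b n = c n" for K N b c
      using that unfolding good_def by auto
    show "good (2 powr p * (K + L)) N (\<lambda>n. b n + c n)" if "good K N b" "good L N c" "0 \<le> K" "0 \<le> L" for K L N b c
    proof -
      obtain G H where GH: "G \<in> hardy_space p" "H \<in> hardy_space p" "\<forall>n<N. G (\<Lambda> n) = b n" "\<forall>n<N. H (\<Lambda> n) = c n"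
        "hardy_norm_powr p G \<le> ennreal K" "hardy_norm_powr p H \<le> ennreal L"
        using \<open>good K N b\<close> \<open>good L N c\<close> unfolding good_def by blast
      have sv: "sv_holomorphic_on G polydisc" "sv_holomorphic_on H polydisc" using GH by (auto simp: hardy_space_def)
      have "hardy_norm_powr p (\<lambda>x. G x + H x) \<le> ennreal (2 powr p) * (hardy_norm_powr p G + hardy_norm_powr p H)"
        by (rule hardy_norm_powr_add_le[OF sv]) (use p in auto)
      also have "\<dots> \<le> ennreal (2 powr p) * (ennreal K + ennreal L)"
        by (intro mult_left_mono add_mono GH) auto
      also have "\<dots> = ennreal (2 powr p * (K + L))"
        using that by (simp add: ennreal_mult)
      finally have *: "hardy_norm_powr p (\<lambda>x. G x + H x) \<le> ennreal (2 powr p * (K + L))" .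
      then have "hardy_norm_powr p (\<lambda>x. G x + H x) < \<infinity>" by (auto simp: le_less_trans)
      then show ?thesis unfolding good_def
        using * GH sv_holomorphic_on_add[OF sv] by (intro bexI[of _ "\<lambda>x. G x + H x"]) (auto simp: hardy_space_def)
    qed
    show "good (norm c powr p * K) N (\<lambda>n. c * b n)" if "good K N b" "0 \<le> K" for K N b c
    proof -
      obtain G where G: "G \<in> hardy_space p" "\<forall>n<N. G (\<Lambda> n) = b n" "hardy_norm_powr p G \<le> ennreal K"
        using \<open>good K N b\<close> unfolding good_def by blast
      have sv: "sv_holomorphic_on G polydisc" using G by (auto simp: hardy_space_def)
      have "hardy_norm_powr p (\<lambda>x. c * G x) \<le> ennreal (norm c powr p) * hardy_norm_powr p G"
        by (rule hardy_norm_powr_cmult[OF sv])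
      also have "\<dots> \<le> ennreal (norm c powr p) * ennreal K"
        by (intro mult_left_mono G) auto
      also have "\<dots> = ennreal (norm c powr p * K)" using that by (simp add: ennreal_mult)
      finally have *: "hardy_norm_powr p (\<lambda>x. c * G x) \<le> ennreal (norm c powr p * K)" .
      then have "hardy_norm_powr p (\<lambda>x. c * G x) < \<infinity>" by (auto simp: le_less_trans)
      then show ?thesis unfolding good_def
        using * G sv_holomorphic_on_cmult[OF sv] by (intro bexI[of _ "\<lambda>x. c * G x"]) (auto simp: hardy_space_def)
    qed
    show "\<exists>R\<ge>0. \<forall>N. good R N b" if sum: "summable (\<lambda>n. szego_weight (\<Lambda> n) * norm (b n) powr p)" for b
    proof -
      define a where "a n = b n * of_real (szego_weight (\<Lambda> n) powr (1 / p))" for n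
      have "norm (a n) powr p = szego_weight (\<Lambda> n) * norm (b n) powr p" for n
        using p szego_weight_pos[OF \<Lambda>, of n] by (simp add: a_def norm_mult powr_mult powr_powr)
      then have "a \<in> ell_p p" using sum by (simp add: ell_p_def)
      then obtain f where f: "f \<in> hardy_space p" "a = interp_map p \<Lambda> f"
        using si unfolding simply_interpolating_def by blast
      have "f (\<Lambda> n) = b n" for n
        using fun_cong[OF f(2), of n] szego_weight_pos[OF \<Lambda>, of n]
        by (simp add: a_def interp_map_def szego_weight_powr[OF \<Lambda>])
      moreover have "hardy_norm_powr p f \<le> ennreal (enn2real (hardy_norm_powr p f))"
        using f(1) by (simp add: hardy_space_def)
      ultimately show ?thesis unfolding good_def using f(1)
        by (intro exI[of _ "enn2real (hardy_norm_powr p f)"]) auto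
    qed
  qed
  then show ?thesis using that unfolding good_def by blast
qed

text \<open>The Poisson inequality is available for the dilates f(r x), so f(\<lambda>) is read off
  at \<lambda> / r. For finitely many points, \<open>r\<close> close to 1 keeps \<lambda> / r in the
  polydisc with a comparable weight.\<close>

lemma exists_dilation:
  fixes \<Lambda> :: "nat \<Rightarrow> complex ^ 'd::finite"
  assumes \<Lambda>: "\<And>n. \<Lambda> n \<in> polydisc"
  obtains r where "0 < r" "r < 1" "\<And>n. n < N \<Longrightarrow> (1 / r) *\<^sub>R \<Lambda> n \<in> polydisc"
    "\<And>n. n < N \<Longrightarrow> szego_weight (\<Lambda> n) \<le> 2 * szego_weight ((1 / r) *\<^sub>R \<Lambda> n)"
proof -
  have "\<forall>\<^sub>F r in at_left (1::real). (1 / r) *\<^sub>R \<Lambda> n \<in> polydisc \<and> szego_weight (\<Lambda> n) / 2 < szego_weight ((1 / r) *\<^sub>R \<Lambda> n)" for n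
  proof (rule eventually_conj)
    have lim: "((\<lambda>r. (1 / r) *\<^sub>R \<Lambda> n) \<longlongrightarrow> (1 / 1) *\<^sub>R \<Lambda> n) (at_left (1::real))"
      by (intro tendsto_intros) auto
    show "\<forall>\<^sub>F r in at_left 1. (1 / r) *\<^sub>R \<Lambda> n \<in> polydisc"
      by (rule topological_tendstoD[OF lim]) (use \<Lambda> open_polydisc in auto)
    have "((\<lambda>r. szego_weight ((1 / r) *\<^sub>R \<Lambda> n)) \<longlongrightarrow> szego_weight ((1 / 1) *\<^sub>R \<Lambda> n)) (at_left (1::real))"
      unfolding szego_weight_def by (intro tendsto_intros tendsto_vec_nth lim) auto
    then show "\<forall>\<^sub>F r in at_left 1. szego_weight (\<Lambda> n) / 2 < szego_weight ((1 / r) *\<^sub>R \<Lambda> n)"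
      by (rule order_tendstoD) (use szego_weight_pos[OF \<Lambda>, of n] in simp)
  qed
  then have "\<forall>\<^sub>F r in at_left (1::real). \<forall>n\<in>{..<N}. (1 / r) *\<^sub>R \<Lambda> n \<in> polydisc \<and> szego_weight (\<Lambda> n) / 2 < szego_weight ((1 / r) *\<^sub>R \<Lambda> n)"
    by (intro eventually_ball_finite) auto
  moreover have "\<forall>\<^sub>F r in at_left (1::real). 0 < r \<and> r < 1"
    by (rule eventually_at_leftI[of 0]) auto
  ultimately have "\<forall>\<^sub>F r in at_left (1::real). (0 < r \<and> r < 1) \<and> (\<forall>n\<in>{..<N}. (1 / r) *\<^sub>R \<Lambda> n \<in> polydisc \<and> szego_weight (\<Lambda> n) / 2 < szego_weight ((1 / r) *\<^sub>R \<Lambda> n))"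
    by (rule eventually_conj[rotated])
  then obtain r where "0 < r" "r < 1" "\<forall>n\<in>{..<N}. (1 / r) *\<^sub>R \<Lambda> n \<in> polydisc \<and> szego_weight (\<Lambda> n) / 2 < szego_weight ((1 / r) *\<^sub>R \<Lambda> n)"
    using eventually_happens'[of "at_left (1::real)"] by (metis (no_types, lifting) trivial_limit_at_left_real)
  then show ?thesis by (intro that[of r]) (auto simp: less_imp_le field_simps)
qed

lemma szego_weight_dilate_le:
  assumes "0 < r" "r < 1" "(1 / r) *\<^sub>R a \<in> polydisc"
  shows "szego_weight ((1 / r) *\<^sub>R a) \<le> szego_weight (a :: complex ^ 'd::finite)"
  unfolding szego_weight_def
proof (intro prod_mono conjI)
  fix i
  have "norm ((1 / r) *\<^sub>R a $ i) < 1" using assms(3) by (simp add: polydisc_def)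
  then show "0 \<le> 1 - (norm (((1 / r) *\<^sub>R a) $ i))\<^sup>2" by (simp add: abs_square_le_1 less_imp_le)
  have "norm (a $ i) \<le> norm (((1 / r) *\<^sub>R a) $ i)"
    using assms mult_right_mono[of 1 "1 / r" "norm (a $ i)"] by simp
  then have "(norm (a $ i))\<^sup>2 \<le> (norm (((1 / r) *\<^sub>R a) $ i))\<^sup>2" by (intro power_mono) auto
  then show "1 - (norm (((1 / r) *\<^sub>R a) $ i))\<^sup>2 \<le> 1 - (norm (a $ i))\<^sup>2" by simp
qed

section \<open>Pointwise inequalities with adjustable constants\<close>

text \<open>If y < \<eta> c, replace y by \<eta> c and bound what remains by the p-th power of the
  maximum of x and c; otherwise c \<le> y / \<eta>. The terms that must be absorbed get the small
  constant, and the large one falls on x^2 y^(p-2).\<close>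

lemma young_three:
  assumes "x \<ge> 0" "y \<ge> 0" "c \<ge> 0" "\<eta> > 0" "p \<ge> (3::real)"
  shows "x\<^sup>2 * y * c powr (p - 3) \<le> \<eta> * (x powr p + c powr p) + \<eta> powr (3 - p) * (x\<^sup>2 * y powr (p - 2))"
proof (cases "y < \<eta> * c")
  case True
  have "x\<^sup>2 * y * c powr (p - 3) \<le> x\<^sup>2 * (\<eta> * c) * c powr (p - 3)"
    using True assms by (intro mult_right_mono mult_left_mono) auto
  also have "\<dots> = \<eta> * (x\<^sup>2 * (c * c powr (p - 3)))" by (simp add: mult_ac)
  also have "\<dots> \<le> \<eta> * (x powr p + c powr p)"
  proof (rule mult_left_mono)
    have "c > 0" using True assms by (smt (verit) mult_eq_0_iff)
    then have "c * c powr (p - 3) = c powr (p - 2)"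
      using powr_add[of c 1 "p - 3"] by simp
    then have "x\<^sup>2 * (c * c powr (p - 3)) \<le> (max x c)\<^sup>2 * max x c powr (p - 2)"
      using assms by (auto intro!: mult_mono power_mono powr_mono2)
    also have "\<dots> = max x c powr p"
      using \<open>c > 0\<close> powr_add[of "max x c" 2 "p - 2"] by (simp add: powr_numeral)
    also have "\<dots> \<le> x powr p + c powr p" by (auto simp: max_def)
    finally show "x\<^sup>2 * (c * c powr (p - 3)) \<le> x powr p + c powr p" .
  qed (use assms in auto)
  finally show ?thesis using assms by (smt (verit) mult_nonneg_nonneg powr_ge_zero zero_le_power2)
next
  case False
  then have "c \<le> y / \<eta>" using assms by (simp add: field_simps)
  then have "c powr (p - 3) \<le> (y / \<eta>) powr (p - 3)" using assms by (intro powr_mono2) auto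
  also have "\<dots> = \<eta> powr (3 - p) * y powr (p - 3)"
    using assms powr_minus_divide[of \<eta> "p - 3"] by (simp add: powr_divide)
  finally have "x\<^sup>2 * y * c powr (p - 3) \<le> x\<^sup>2 * y * (\<eta> powr (3 - p) * y powr (p - 3))"
    using assms by (intro mult_left_mono) auto
  also have "\<dots> = \<eta> powr (3 - p) * (x\<^sup>2 * (y * y powr (p - 3)))" by (simp add: mult_ac)
  also have "y * y powr (p - 3) = y powr (p - 2)"
    using assms powr_add[of y 1 "p - 3"] by (cases "y = 0") auto
  finally show ?thesis using assms by (smt (verit) mult_nonneg_nonneg powr_ge_zero)
qed

text \<open>Compare y with \<mu> z. Since p > 2, the coefficient of z^p becomes small with \<mu>,
  and the large constant falls on y^p.\<close>

lemma young_two: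
  assumes "z \<ge> 0" "y \<ge> 0" "\<mu> > 0" "p > (2::real)"
  shows "z\<^sup>2 * y powr (p - 2) \<le> \<mu> powr (p - 2) * z powr p + (1 / \<mu>)\<^sup>2 * y powr p"
proof (cases "y < \<mu> * z")
  case True
  then have z: "z > 0" using assms by (smt (verit) mult_eq_0_iff)
  have "z\<^sup>2 * y powr (p - 2) \<le> z\<^sup>2 * (\<mu> * z) powr (p - 2)"
    using True assms by (intro mult_left_mono powr_mono2) auto
  also have "\<dots> = \<mu> powr (p - 2) * z powr p"
    using z assms powr_add[of z 2 "p - 2"] by (simp add: powr_mult powr_numeral mult_ac)
  finally show ?thesis by (smt (verit) mult_nonneg_nonneg powr_ge_zero zero_le_power2)
next
  case False
  then have "z \<le> (1 / \<mu>) * y" using assms by (simp add: field_simps)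
  then have "z\<^sup>2 \<le> ((1 / \<mu>) * y)\<^sup>2" using assms by (intro power_mono) auto
  then have "z\<^sup>2 * y powr (p - 2) \<le> (1 / \<mu>)\<^sup>2 * (y\<^sup>2 * y powr (p - 2))"
    unfolding power_mult_distrib mult.assoc[symmetric] by (intro mult_right_mono) auto
  also have "y\<^sup>2 * y powr (p - 2) = y powr p"
    using assms powr_add[of y 2 "p - 2"] by (cases "y = 0") (auto simp: powr_numeral)
  finally show ?thesis by (smt (verit) mult_nonneg_nonneg powr_ge_zero)
qed

text \<open>Let \<open>m\<close> be the common value of the two square sums. Every X_j^2 is at most
  \<open>m\<close>, so the sum of p-th powers is at most m^(p/2). Conversely, those Z_k^2 below m /
  2 make up at most half of their mean \<open>m\<close>, and the others are dominated by p-th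
  powers.\<close>

lemma sum_powr_le_mean:
  fixes X Z :: "nat \<Rightarrow> real"
  assumes X: "\<And>j. X j \<ge> 0" and Z: "\<And>k. Z k \<ge> 0" and N: "N > 0" and p: "p \<ge> 2"
    and eq: "(\<Sum>j<N. (X j)\<^sup>2) = (\<Sum>k<N. (Z k)\<^sup>2) / N"
  shows "(\<Sum>j<N. X j powr p) \<le> 2 powr (p / 2) * ((\<Sum>k<N. Z k powr p) / N)"
proof -
  define m where "m = (\<Sum>k<N. (Z k)\<^sup>2) / N"
  have m0: "m \<ge> 0" unfolding m_def by (intro divide_nonneg_nonneg sum_nonneg) auto
  show ?thesis
  proof (cases "m = 0")
    case True
    then have "(\<Sum>j<N. (X j)\<^sup>2) = 0" using eq by (simp only: m_def)
    then have "\<forall>j<N. X j = 0" by (subst (asm) sum_nonneg_eq_0_iff) auto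
    then show ?thesis using Z by (auto intro!: mult_nonneg_nonneg divide_nonneg_nonneg sum_nonneg)
  next
    case False
    with m0 have m: "m > 0" by simp
    have X_le: "X j powr p \<le> (X j)\<^sup>2 * m powr (p / 2 - 1)" if j: "j < N" for j
    proof -
      have "(X j)\<^sup>2 \<le> (\<Sum>j<N. (X j)\<^sup>2)" by (rule member_le_sum) (use j in auto)
      then have le: "(X j)\<^sup>2 \<le> m" using eq by (simp add: m_def)
      have "X j powr p = (X j)\<^sup>2 * ((X j)\<^sup>2) powr (p / 2 - 1)"
      proof (cases "X j = 0")
        case False
        then have "X j > 0" using X[of j] by simp
        then have "(X j)\<^sup>2 * ((X j)\<^sup>2) powr (p / 2 - 1) = X j powr 2 * (X j powr 2) powr (p / 2 - 1)"
          by (simp add: powr_numeral)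
        also have "\<dots> = X j powr (2 + 2 * (p / 2 - 1))"
          unfolding powr_powr powr_add ..
        finally show ?thesis by simp
      qed auto
      also have "\<dots> \<le> (X j)\<^sup>2 * m powr (p / 2 - 1)"
        using le p by (intro mult_left_mono powr_mono2) auto
      finally show ?thesis .
    qed
    have "(\<Sum>j<N. X j powr p) \<le> (\<Sum>j<N. (X j)\<^sup>2 * m powr (p / 2 - 1))"
      by (intro sum_mono X_le) auto
    also have "\<dots> = m * m powr (p / 2 - 1)"
      unfolding sum_distrib_right[symmetric] eq m_def[symmetric] ..
    also have "\<dots> = m powr (p / 2)" using m powr_add[of m 1 "p / 2 - 1"] by simp
    finally have 1: "(\<Sum>j<N. X j powr p) \<le> m powr (p / 2)" .
    have Z_le: "(Z k)\<^sup>2 \<le> m / 2 + Z k powr p * (m / 2) powr (1 - p / 2)" for k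
    proof (cases "(Z k)\<^sup>2 \<le> m / 2")
      case True
      then show ?thesis by (smt (verit) mult_nonneg_nonneg powr_ge_zero)
    next
      case False
      then have zk: "Z k > 0" using m Z[of k] by (cases "Z k = 0") auto
      have "1 = (m / 2) powr (p / 2 - 1) * (m / 2) powr (1 - p / 2)"
        using m by (simp add: powr_add[symmetric])
      also have "\<dots> \<le> ((Z k)\<^sup>2) powr (p / 2 - 1) * (m / 2) powr (1 - p / 2)"
        using False m p by (intro mult_right_mono powr_mono2) auto
      finally have "(Z k)\<^sup>2 * 1 \<le> (Z k)\<^sup>2 * (((Z k)\<^sup>2) powr (p / 2 - 1) * (m / 2) powr (1 - p / 2))"
        by (intro mult_left_mono) auto
      also have "\<dots> = (Z k powr 2 * (Z k powr 2) powr (p / 2 - 1)) * (m / 2) powr (1 - p / 2)"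
        using zk by (simp add: powr_numeral)
      also have "Z k powr 2 * (Z k powr 2) powr (p / 2 - 1) = Z k powr (2 + 2 * (p / 2 - 1))"
        unfolding powr_powr powr_add ..
      finally show ?thesis using m by simp
    qed
    have "m = (\<Sum>k<N. (Z k)\<^sup>2) / N" by (simp add: m_def)
    also have "\<dots> \<le> (\<Sum>k<N. m / 2 + Z k powr p * (m / 2) powr (1 - p / 2)) / N"
      by (intro divide_right_mono sum_mono Z_le) auto
    also have "\<dots> = m / 2 + (\<Sum>k<N. Z k powr p) / N * (m / 2) powr (1 - p / 2)"
      using N by (simp add: sum.distrib sum_distrib_right[symmetric] add_divide_distrib)
    finally have "m / 2 \<le> (\<Sum>k<N. Z k powr p) / N * (m / 2) powr (1 - p / 2)" by linarith
    then have "m / 2 * (m / 2) powr (p / 2 - 1) \<le> (\<Sum>k<N. Z k powr p) / N * (m / 2) powr (1 - p / 2) * (m / 2) powr (p / 2 - 1)"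
      by (rule mult_right_mono) auto
    also have "\<dots> = (\<Sum>k<N. Z k powr p) / N" using m by (simp add: mult.assoc powr_add[symmetric])
    also have "m / 2 * (m / 2) powr (p / 2 - 1) = (m / 2) powr (p / 2)"
      using m powr_add[of "m / 2" 1 "p / 2 - 1"] by simp
    finally have "(m / 2) powr (p / 2) \<le> (\<Sum>k<N. Z k powr p) / N" .
    then have "2 powr (p / 2) * (m / 2) powr (p / 2) \<le> 2 powr (p / 2) * ((\<Sum>k<N. Z k powr p) / N)"
      by (intro mult_left_mono) auto
    also have "2 powr (p / 2) * (m / 2) powr (p / 2) = m powr (p / 2)"
      using m by (simp add: powr_divide)
    finally show ?thesis using 1 by simp
  qed
qed

subsection \<open>Simply interpolating sequences are universally interpolating for large exponents\<close>

text \<open>A bound on finite partial sums that does not depend on their length. The partial sum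
  \<open>S\<close> occurs on the right as well, since the interpolants G_k cost at most C S; the
  constants are chosen so that at most half of it does.\<close>

lemma carleson_of_uniform_interpolation:
  fixes \<Lambda> :: "nat \<Rightarrow> complex ^ 'd::finite"
  assumes p: "p \<ge> 3" and \<Lambda>: "\<And>n. \<Lambda> n \<in> polydisc" and C: "C \<ge> 0"
    and ub: "\<And>N b. \<exists>G\<in>hardy_space p. (\<forall>n<N. G (\<Lambda> n) = b n) \<and>
      hardy_norm_powr p G \<le> ennreal (C * (\<Sum>n<N. szego_weight (\<Lambda> n) * norm (b n) powr p))"
    and g: "g \<in> hardy_space p"
  shows "summable (\<lambda>n. szego_weight (\<Lambda> n) * norm (g (\<Lambda> n)) powr p)"
proof -
  define Q :: real where "Q = 4 ^ CARD('d)"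
  define T :: real where "T = 2 powr (p / 2)"
  define E where "E = enn2real (hardy_norm_powr p g)"
  have E: "E \<ge> 0" "hardy_norm_powr p g = ennreal E" and svg: "sv_holomorphic_on g polydisc"
    using g by (auto simp: E_def hardy_space_def)
  have QT: "Q > 0" "T > 0" by (auto simp: Q_def T_def)
  \<comment> \<open>Chosen so that the self term 2 \<eta> together with the contribution of the p-th
    powers of the F_j amounts to 1/4 of \<open>S\<close>.\<close>
  define \<eta> where "\<eta> = 1 / (8 * (1 + T * Q * C))"
  have den: "1 + T * Q * C > 0" using QT C by (simp add: add_pos_nonneg)
  then have \<eta>: "\<eta> > 0" "2 * \<eta> * (1 + T * Q * C) = 1 / 4" by (auto simp: \<eta>_def)
  define A where "A = 2 * Q * \<eta> powr (3 - p)"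
  have A: "A \<ge> 0" using QT by (simp add: A_def)
  \<comment> \<open>Chosen so that the mixed terms, after \<open>young_two\<close>, contribute at
    most another 1/4 of \<open>S\<close>.\<close>
  define \<mu> where "\<mu> = (1 / (4 * (A * C + 1))) powr (1 / (p - 2))"
  have AC: "A * C \<ge> 0" using A C by simp
  have \<mu>: "\<mu> > 0" "\<mu> powr (p - 2) = 1 / (4 * (A * C + 1))"
    using AC p by (auto simp: \<mu>_def powr_powr)
  define c1 where "c1 = 2 * Q * (\<eta> * T + \<eta> powr (3 - p) * \<mu> powr (p - 2))"
  define c2 where "c2 = 2 * Q * \<eta> powr (3 - p) * (1 / \<mu>)\<^sup>2"
  have c12: "c1 \<ge> 0" "c2 \<ge> 0" using QT \<eta> by (auto simp: c1_def c2_def)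
  have c1C: "2 * \<eta> + c1 * C \<le> 1 / 2"
  proof -
    have "2 * \<eta> + c1 * C = 2 * \<eta> * (1 + T * Q * C) + A * C * \<mu> powr (p - 2)"
      by (simp add: c1_def A_def algebra_simps)
    also have "\<dots> = 1 / 4 + A * C / (4 * (A * C + 1))" unfolding \<eta>(2) \<mu>(2) by simp
    also have "A * C / (4 * (A * C + 1)) \<le> 1 / 4" using AC by (simp add: field_simps)
    finally show ?thesis by simp
  qed
  define \<gamma> where "\<gamma> n = norm (g (\<Lambda> n))" for n
  have bound: "(\<Sum>n<N. szego_weight (\<Lambda> n) * \<gamma> n powr p) \<le> 2 * c2 * E" if N: "N > 0" for N
  proof -
    define S where "S = (\<Sum>n<N. szego_weight (\<Lambda> n) * \<gamma> n powr p)"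
    have S: "S \<ge> 0" unfolding S_def using szego_weight_pos[OF \<Lambda>]
      by (intro sum_nonneg mult_nonneg_nonneg) (auto simp: less_imp_le)
    have "\<exists>G\<in>hardy_space p. (\<forall>n<N. G (\<Lambda> n) = cis (2 * pi * real n * real k / real N) * g (\<Lambda> n)) \<and>
      hardy_norm_powr p G \<le> ennreal (C * S)" for k
      using ub[of N "\<lambda>n. cis (2 * pi * real n * real k / real N) * g (\<Lambda> n)"]
      by (simp add: norm_mult S_def \<gamma>_def)
    then obtain G where G: "\<And>k. G k \<in> hardy_space p"
      "\<And>k n. n < N \<Longrightarrow> G k (\<Lambda> n) = cis (2 * pi * real n * real k / real N) * g (\<Lambda> n)"
      "\<And>k. hardy_norm_powr p (G k) \<le> ennreal (C * S)" by metis
    have svG: "sv_holomorphic_on (G k) polydisc" for k using G(1) by (simp add: hardy_space_def)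
    \<comment> \<open>Inverse transform of the G_k: at \<lambda>_j the phases cancel and the value
      is g(\<lambda>_j).\<close>
    define F where "F j x = (\<Sum>k<N. cis (- (2 * pi * real j * real k / real N)) * (G k x / N))" for j x
    have svF: "sv_holomorphic_on (F j) polydisc" for j
      unfolding F_def divide_inverse
      by (intro sv_holomorphic_on_sum sv_holomorphic_on_cmult sv_holomorphic_on_mult sv_holomorphic_on_const svG)
    have F\<Lambda>: "F j (\<Lambda> j) = g (\<Lambda> j)" if "j < N" for j
    proof -
      have "F j (\<Lambda> j) = (\<Sum>k<N. g (\<Lambda> j) / N)"
        unfolding F_def using that by (intro sum.cong refl) (simp add: G(2) mult.assoc[symmetric] cis_mult)
      then show ?thesis using N by simp
    qed
    obtain r where r: "0 < r" "r < 1" "\<And>n. n < N \<Longrightarrow> (1 / r) *\<^sub>R \<Lambda> n \<in> polydisc"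
      "\<And>n. n < N \<Longrightarrow> szego_weight (\<Lambda> n) \<le> 2 * szego_weight ((1 / r) *\<^sub>R \<Lambda> n)"
      using exists_dilation[where \<Lambda>=\<Lambda> and N=N, OF \<Lambda>] by blast
    define a where "a n = (1 / r) *\<^sub>R \<Lambda> n" for n
    define w where "w n = szego_weight (a n)" for n
    have a: "a n \<in> polydisc" "r *\<^sub>R a n = \<Lambda> n" "w n > 0" "w n \<le> szego_weight (\<Lambda> n)" "szego_weight (\<Lambda> n) \<le> 2 * w n"
      if "n < N" for n
      using r(3,4)[OF that] r(1,2) szego_weight_pos[OF r(3)[OF that]] szego_weight_dilate_le[OF r(1,2) r(3)[OF that]]
      by (auto simp: a_def w_def)
    note [measurable] = measurable_scaled[OF svF r(1,2)] measurable_scaled[OF svG r(1,2)] measurable_scaled[OF svg r(1,2)]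
    define X where "X j x = norm (scaled r (F j) x)" for j x
    define Z where "Z k x = norm (scaled r (G k) x)" for k x
    define Y where "Y x = norm (scaled r g x)" for x
    have XYZ: "X j x \<ge> 0" "Y x \<ge> 0" "Z k x \<ge> 0" for j k x by (auto simp: X_def Y_def Z_def)
    have [measurable]: "X j \<in> borel_measurable borel" "Y \<in> borel_measurable borel" "Z k \<in> borel_measurable borel" for j k
      unfolding X_def Y_def Z_def by measurable
    \<comment> \<open>Collects the terms whose Poisson kernel has been estimated by
      \<open>w j * torus_poisson (a j) x \<le> Q\<close>.\<close>
    define V where "V j x = 2 * Q * (\<eta> * X j x powr p + \<eta> powr (3 - p) * ((X j x)\<^sup>2 * Y x powr (p - 2)))" for j x
    have V0: "V j x \<ge> 0" for j x using QT \<eta> XYZ by (auto simp: V_def)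
    have [measurable]: "V j \<in> borel_measurable borel" for j unfolding V_def by measurable
    \<comment> \<open>The term with \<gamma>_j^p alone keeps its Poisson kernel, whose integral is
      1, and so returns a small multiple of the left side. The factor 2 accounts for the change of
      weight under dilation.\<close>
    have per_point: "ennreal (2 * w j * \<gamma> j powr p) \<le> ennreal (2 * \<eta> * (w j * \<gamma> j powr p)) + (\<integral>\<^sup>+ x. ennreal (V j x) \<partial>torus_measure)"
      if j: "j < N" for j
    proof -
      have \<gamma>0: "\<gamma> j \<ge> 0" by (simp add: \<gamma>_def)
      have "\<gamma> j powr p = \<gamma> j ^ 3 * \<gamma> j powr (p - 3)"
        using \<gamma>0 powr_add[of "\<gamma> j" 3 "p - 3"] by (cases "\<gamma> j = 0") (auto simp: powr_numeral)
      then have e1: "ennreal (2 * w j * \<gamma> j powr p) = ennreal (2 * w j * \<gamma> j powr (p - 3)) * ennreal (\<gamma> j ^ 3)"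
        using a(3)[OF j] \<gamma>0 by (simp add: ennreal_mult[symmetric] mult_ac)
      have "ennreal (\<gamma> j ^ 3) \<le> (\<integral>\<^sup>+ x. ennreal ((X j x)\<^sup>2 * Y x * torus_poisson (a j) x) \<partial>torus_measure)"
      proof -
        have sv: "sv_holomorphic_on (\<lambda>x. F j x * F j x * g x) polydisc"
          by (intro sv_holomorphic_on_mult svF svg)
        have "ennreal (\<gamma> j ^ 3) = ennreal (norm (F j (r *\<^sub>R a j) * F j (r *\<^sub>R a j) * g (r *\<^sub>R a j)))"
          using F\<Lambda>[OF j] a(2)[OF j] by (simp add: \<gamma>_def norm_mult power3_eq_cube)
        also have "\<dots> \<le> (\<integral>\<^sup>+ x. ennreal (norm (F j (r *\<^sub>R x) * F j (r *\<^sub>R x) * g (r *\<^sub>R x)) * torus_poisson (a j) x) \<partial>torus_measure)"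
          by (rule sv_submean[OF sv r(1,2) a(1)[OF j]])
        also have "\<dots> = (\<integral>\<^sup>+ x. ennreal ((X j x)\<^sup>2 * Y x * torus_poisson (a j) x) \<partial>torus_measure)"
          by (rule nn_integral_torus_cong) (simp add: X_def Y_def scaled_torus norm_mult power2_eq_square)
        finally show ?thesis .
      qed
      then have "ennreal (2 * w j * \<gamma> j powr (p - 3)) * ennreal (\<gamma> j ^ 3) \<le>
        ennreal (2 * w j * \<gamma> j powr (p - 3)) * (\<integral>\<^sup>+ x. ennreal ((X j x)\<^sup>2 * Y x * torus_poisson (a j) x) \<partial>torus_measure)"
        by (rule mult_left_mono) auto
      also have "\<dots> = (\<integral>\<^sup>+ x. ennreal (2 * w j * \<gamma> j powr (p - 3)) * ennreal ((X j x)\<^sup>2 * Y x * torus_poisson (a j) x) \<partial>torus_measure)"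
        by (rule nn_integral_cmult[symmetric]) measurable
      also have "\<dots> \<le> (\<integral>\<^sup>+ x. ennreal (2 * \<eta> * (w j * \<gamma> j powr p)) * ennreal (torus_poisson (a j) x) + ennreal (V j x) \<partial>torus_measure)"
      proof (rule nn_integral_torus_mono)
        fix x :: "complex ^ 'd" assume x: "x \<in> torus"
        let ?P = "torus_poisson (a j) x"
        have P: "?P \<ge> 0" by (rule torus_poisson_nonneg[OF a(1)[OF j]])
        have wP: "w j * ?P \<le> Q" unfolding w_def Q_def
          by (rule szego_weight_torus_poisson_le[OF a(1)[OF j]]) (use x torus_subset_closed_polydisc in auto)
        have "2 * w j * \<gamma> j powr (p - 3) * ((X j x)\<^sup>2 * Y x * ?P) = 2 * (w j * ?P) * ((X j x)\<^sup>2 * Y x * \<gamma> j powr (p - 3))"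
          by (simp add: mult_ac)
        also have "\<dots> \<le> 2 * (w j * ?P) * (\<eta> * (X j x powr p + \<gamma> j powr p) + \<eta> powr (3 - p) * ((X j x)\<^sup>2 * Y x powr (p - 2)))"
          using a(3)[OF j] P by (intro mult_left_mono young_three XYZ \<gamma>0 \<eta> p) auto
        also have "\<dots> = 2 * \<eta> * (w j * \<gamma> j powr p) * ?P +
            2 * (w j * ?P) * (\<eta> * X j x powr p + \<eta> powr (3 - p) * ((X j x)\<^sup>2 * Y x powr (p - 2)))"
          by (simp add: algebra_simps)
        also have "\<dots> \<le> 2 * \<eta> * (w j * \<gamma> j powr p) * ?P + V j x"
          unfolding V_def using wP \<eta> XYZ by (intro add_left_mono mult_right_mono) auto
        finally have "2 * w j * \<gamma> j powr (p - 3) * ((X j x)\<^sup>2 * Y x * ?P) \<le> 2 * \<eta> * (w j * \<gamma> j powr p) * ?P + V j x" .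
        then have "ennreal (2 * w j * \<gamma> j powr (p - 3) * ((X j x)\<^sup>2 * Y x * ?P)) \<le> ennreal (2 * \<eta> * (w j * \<gamma> j powr p) * ?P + V j x)"
          by (rule ennreal_leI)
        then show "ennreal (2 * w j * \<gamma> j powr (p - 3)) * ennreal ((X j x)\<^sup>2 * Y x * ?P) \<le>
            ennreal (2 * \<eta> * (w j * \<gamma> j powr p)) * ennreal ?P + ennreal (V j x)"
          using a(3)[OF j] P \<eta> XYZ V0 by (simp add: ennreal_mult[symmetric] ennreal_plus[symmetric] del: ennreal_plus)
      qed
      also have "\<dots> = ennreal (2 * \<eta> * (w j * \<gamma> j powr p)) + (\<integral>\<^sup>+ x. ennreal (V j x) \<partial>torus_measure)"
        using nn_integral_torus_poisson[OF a(1)[OF j]]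
        by (subst nn_integral_add) (auto simp: nn_integral_cmult)
      finally show ?thesis unfolding e1 .
    qed
    \<comment> \<open>By Parseval everything that depends on the F_j becomes an average over the
      G_k, so no factor \<open>N\<close> is lost.\<close>
    have V_sum: "(\<Sum>j<N. V j x) \<le> (\<Sum>k<N. c1 / N * Z k x powr p + c2 / N * Y x powr p)" for x
    proof -
      have "scaled r (F j) x = (\<Sum>k<N. cis (- (2 * pi * real j * real k / real N)) * (scaled r (G k) x / N))" for j
        by (auto simp: scaled_def F_def)
      then have "(\<Sum>j<N. (X j x)\<^sup>2) = N * (\<Sum>k<N. (norm (scaled r (G k) x / N))\<^sup>2)"
        unfolding X_def by (simp only: dft_parseval)
      also have "\<dots> = (\<Sum>k<N. (Z k x)\<^sup>2) / N"
        using N by (simp add: Z_def norm_divide power_divide sum_divide_distrib[symmetric] power2_eq_square)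
      finally have eq: "(\<Sum>j<N. (X j x)\<^sup>2) = (\<Sum>k<N. (Z k x)\<^sup>2) / N" .
      have 1: "(\<Sum>j<N. X j x powr p) \<le> T * ((\<Sum>k<N. Z k x powr p) / N)"
        unfolding T_def by (rule sum_powr_le_mean[OF XYZ(1) XYZ(3) N _ eq]) (use p in auto)
      have 2: "(\<Sum>j<N. (X j x)\<^sup>2 * Y x powr (p - 2)) \<le> (\<Sum>k<N. \<mu> powr (p - 2) * Z k x powr p + (1 / \<mu>)\<^sup>2 * Y x powr p) / N"
      proof -
        have "(\<Sum>j<N. (X j x)\<^sup>2 * Y x powr (p - 2)) = (\<Sum>k<N. (Z k x)\<^sup>2 * Y x powr (p - 2)) / N"
          by (simp add: sum_distrib_right[symmetric] eq)
        also have "\<dots> \<le> (\<Sum>k<N. \<mu> powr (p - 2) * Z k x powr p + (1 / \<mu>)\<^sup>2 * Y x powr p) / N"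
          using p by (intro divide_right_mono sum_mono young_two XYZ \<mu>) auto
        finally show ?thesis .
      qed
      have "(\<Sum>j<N. V j x) = 2 * Q * (\<eta> * (\<Sum>j<N. X j x powr p) + \<eta> powr (3 - p) * (\<Sum>j<N. (X j x)\<^sup>2 * Y x powr (p - 2)))"
        by (simp add: V_def sum_distrib_left sum.distrib distrib_left)
      also have "\<dots> \<le> 2 * Q * (\<eta> * (T * ((\<Sum>k<N. Z k x powr p) / N)) +
          \<eta> powr (3 - p) * ((\<Sum>k<N. \<mu> powr (p - 2) * Z k x powr p + (1 / \<mu>)\<^sup>2 * Y x powr p) / N))"
        using QT \<eta> by (intro mult_left_mono add_mono 1 2) auto
      also have "\<dots> = (\<Sum>k<N. c1 / N * Z k x powr p + c2 / N * Y x powr p)"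
      proof -
        define SZ y t where "SZ = (\<Sum>k<N. Z k x powr p)" and "y = (1 / \<mu>)\<^sup>2 * Y x powr p" and "t = \<eta> powr (3 - p)"
        have l: "(\<Sum>k<N. \<mu> powr (p - 2) * Z k x powr p + (1 / \<mu>)\<^sup>2 * Y x powr p) = \<mu> powr (p - 2) * SZ + N * y"
          by (simp add: sum.distrib sum_distrib_left[symmetric] SZ_def y_def)
        have r: "(\<Sum>k<N. c1 / N * Z k x powr p + c2 / N * Y x powr p) = c1 / N * SZ + 2 * Q * t * y"
          using N by (simp add: sum.distrib sum_distrib_left[symmetric] sum_divide_distrib[symmetric] SZ_def y_def t_def c2_def)
        show ?thesis unfolding l r unfolding SZ_def[symmetric] t_def[symmetric] c1_def
          using N by (simp add: field_simps)
      qed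
      finally show ?thesis .
    qed
    have "ennreal S \<le> ennreal (\<Sum>j<N. 2 * w j * \<gamma> j powr p)"
      unfolding S_def using a by (intro ennreal_leI sum_mono mult_right_mono) auto
    also have "\<dots> = (\<Sum>j<N. ennreal (2 * w j * \<gamma> j powr p))"
      using a by (intro sum_ennreal[symmetric]) (auto simp: less_imp_le)
    also have "\<dots> \<le> (\<Sum>j<N. ennreal (2 * \<eta> * (w j * \<gamma> j powr p)) + (\<integral>\<^sup>+ x. ennreal (V j x) \<partial>torus_measure))"
      by (intro sum_mono per_point) auto
    also have "\<dots> = ennreal (\<Sum>j<N. 2 * \<eta> * (w j * \<gamma> j powr p)) + (\<integral>\<^sup>+ x. ennreal (\<Sum>j<N. V j x) \<partial>torus_measure)"
    proof -
      have "(\<Sum>j<N. ennreal (2 * \<eta> * (w j * \<gamma> j powr p))) = ennreal (\<Sum>j<N. 2 * \<eta> * (w j * \<gamma> j powr p))"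
        using a \<eta> by (intro sum_ennreal) (auto simp: less_imp_le)
      moreover have "(\<Sum>j<N. \<integral>\<^sup>+ x. ennreal (V j x) \<partial>torus_measure) = (\<integral>\<^sup>+ x. ennreal (\<Sum>j<N. V j x) \<partial>torus_measure)"
        using V0 by (subst nn_integral_sum[symmetric]) (auto simp: sum_ennreal)
      ultimately show ?thesis by (simp add: sum.distrib)
    qed
    also have "\<dots> \<le> ennreal (2 * \<eta> * S) + ennreal (c1 * (C * S) + c2 * E)"
    proof (rule add_mono)
      have "(\<Sum>j<N. 2 * \<eta> * (w j * \<gamma> j powr p)) \<le> 2 * \<eta> * S"
        unfolding S_def sum_distrib_left using a \<eta> by (intro sum_mono mult_left_mono mult_right_mono) auto
      then show "ennreal (\<Sum>j<N. 2 * \<eta> * (w j * \<gamma> j powr p)) \<le> ennreal (2 * \<eta> * S)" by (rule ennreal_leI)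
      have "(\<integral>\<^sup>+ x. ennreal (\<Sum>j<N. V j x) \<partial>torus_measure) \<le>
        (\<integral>\<^sup>+ x. (\<Sum>k<N. ennreal (c1 / N) * ennreal (Z k x powr p) + ennreal (c2 / N) * ennreal (Y x powr p)) \<partial>torus_measure)"
      proof (rule nn_integral_mono)
        fix x
        have "ennreal (\<Sum>j<N. V j x) \<le> ennreal (\<Sum>k<N. c1 / N * Z k x powr p + c2 / N * Y x powr p)"
          by (rule ennreal_leI[OF V_sum])
        also have "\<dots> = (\<Sum>k<N. ennreal (c1 / N * Z k x powr p + c2 / N * Y x powr p))"
          using c12 by (intro sum_ennreal[symmetric]) auto
        also have "\<dots> = (\<Sum>k<N. ennreal (c1 / N) * ennreal (Z k x powr p) + ennreal (c2 / N) * ennreal (Y x powr p))"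
          using c12 by (intro sum.cong refl) (simp add: ennreal_mult[symmetric])
        finally show "ennreal (\<Sum>j<N. V j x) \<le> \<dots>" .
      qed
      also have "\<dots> = (\<Sum>k<N. ennreal (c1 / N) * (\<integral>\<^sup>+ x. ennreal (Z k x powr p) \<partial>torus_measure) +
          ennreal (c2 / N) * (\<integral>\<^sup>+ x. ennreal (Y x powr p) \<partial>torus_measure))"
        by (simp add: nn_integral_sum nn_integral_add nn_integral_cmult)
      also have "\<dots> \<le> (\<Sum>k<N. ennreal (c1 / N) * ennreal (C * S) + ennreal (c2 / N) * ennreal E)"
      proof (intro sum_mono add_mono mult_left_mono)
        show "(\<integral>\<^sup>+ x. ennreal (Z k x powr p) \<partial>torus_measure) \<le> ennreal (C * S)" for k
          unfolding Z_def by (rule order_trans[OF hardy_mean_le[OF r(1,2)] G(3)])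
        show "(\<integral>\<^sup>+ x. ennreal (Y x powr p) \<partial>torus_measure) \<le> ennreal E"
          unfolding Y_def E(2)[symmetric] by (rule hardy_mean_le[OF r(1,2)])
      qed auto
      also have "\<dots> = (\<Sum>k<N. ennreal (c1 / N * (C * S) + c2 / N * E))"
        using c12 C S E by (intro sum.cong refl) (simp add: ennreal_mult[symmetric])
      also have "\<dots> = ennreal (\<Sum>k<N. c1 / N * (C * S) + c2 / N * E)"
        using c12 C S E by (intro sum_ennreal) auto
      also have "(\<Sum>k<N. c1 / N * (C * S) + c2 / N * E) = c1 * (C * S) + c2 * E"
        using N by (simp add: field_simps)
      finally show "(\<integral>\<^sup>+ x. ennreal (\<Sum>j<N. V j x) \<partial>torus_measure) \<le> ennreal (c1 * (C * S) + c2 * E)" .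
    qed
    also have "\<dots> = ennreal (2 * \<eta> * S + (c1 * (C * S) + c2 * E))"
      using c12 C S E \<eta> by (intro ennreal_plus[symmetric]) auto
    \<comment> \<open>\<open>S\<close> is a finite real number, so the half of it that appears on
      the right can be subtracted.\<close>
    finally have "S \<le> 2 * \<eta> * S + (c1 * (C * S) + c2 * E)"
      using c12 C S E \<eta> by (subst (asm) ennreal_le_iff) auto
    also have "\<dots> = (2 * \<eta> + c1 * C) * S + c2 * E" by (simp add: algebra_simps)
    also have "\<dots> \<le> 1 / 2 * S + c2 * E" using c1C S by (intro add_right_mono mult_right_mono)
    finally show ?thesis unfolding S_def by simp
  qed
  show ?thesis
  proof (rule bounded_imp_summable)
    show "0 \<le> szego_weight (\<Lambda> n) * norm (g (\<Lambda> n)) powr p" for n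
      using szego_weight_pos[OF \<Lambda>, of n] by simp
    show "(\<Sum>n\<le>N. szego_weight (\<Lambda> n) * norm (g (\<Lambda> n)) powr p) \<le> 2 * c2 * E" for N
      using bound[of "Suc N"] by (simp add: \<gamma>_def lessThan_Suc_atMost)
  qed
qed

theorem universally_interpolating_if_simply_interpolating:
  fixes \<Lambda> :: "nat \<Rightarrow> complex ^ 'd::finite"
  assumes p: "p \<ge> 3" and \<Lambda>: "\<And>n. \<Lambda> n \<in> polydisc" and si: "simply_interpolating p \<Lambda>"
  shows "universally_interpolating p \<Lambda>"
proof -
  obtain C where C: "C \<ge> 0" "\<And>N b. \<exists>G\<in>hardy_space p. (\<forall>n<N. G (\<Lambda> n) = b n) \<and>
      hardy_norm_powr p G \<le> ennreal (C * (\<Sum>n<N. szego_weight (\<Lambda> n) * norm (b n) powr p))"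
    using simply_interpolating_uniform[of p \<Lambda>] p \<Lambda> si by auto
  have "interp_map p \<Lambda> g \<in> ell_p p" if "g \<in> hardy_space p" for g
    using carleson_of_uniform_interpolation[OF p \<Lambda> C that] p
    by (simp add: ell_p_def norm_interp_map_powr[OF \<Lambda>])
  then show ?thesis
    using si unfolding universally_interpolating_def simply_interpolating_def by auto
qed

subsection \<open>A criterion for simple interpolation\<close>

text \<open>In place of Hoelder's inequality: y \<le> \<epsilon> + \<epsilon>^(1-p) y^p for every y
  \<ge> 0. Both terms integrate to at most \<epsilon>, which explains the factor 2.\<close>

lemma hardy_point_bound:
  fixes h :: "complex ^ 'd::finite \<Rightarrow> complex"
  assumes h: "sv_holomorphic_on h polydisc" and p: "p \<ge> 1" and r: "0 < r" "r < 1" and a: "a \<in> polydisc"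
    and \<epsilon>: "\<epsilon> > 0" and bound: "hardy_norm_powr p h \<le> ennreal (\<epsilon> powr p)"
  shows "norm (h (r *\<^sub>R a)) \<le> 2 * 4 ^ CARD('d) / szego_weight a * \<epsilon>"
proof -
  define B where "B = 4 ^ CARD('d) / szego_weight a"
  have B: "B > 0" using szego_weight_pos[OF a] by (simp add: B_def)
  note [measurable] = measurable_scaled[OF h r]
  have "ennreal (norm (h (r *\<^sub>R a))) \<le> (\<integral>\<^sup>+ x. ennreal (norm (h (r *\<^sub>R x)) * torus_poisson a x) \<partial>torus_measure)"
    by (rule sv_submean[OF h r a])
  also have "\<dots> \<le> (\<integral>\<^sup>+ x. ennreal (B * \<epsilon>) + ennreal (B * \<epsilon> powr (1 - p)) * ennreal (norm (scaled r h x) powr p) \<partial>torus_measure)"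
  proof (rule nn_integral_torus_mono)
    fix x :: "complex ^ 'd" assume x: "x \<in> torus"
    let ?y = "norm (h (r *\<^sub>R x))"
    have "szego_weight a * torus_poisson a x \<le> 4 ^ CARD('d)"
      by (rule szego_weight_torus_poisson_le[OF a]) (use x torus_subset_closed_polydisc in auto)
    then have P: "torus_poisson a x \<le> B" using szego_weight_pos[OF a] by (simp add: B_def field_simps)
    have "?y \<le> \<epsilon> + \<epsilon> powr (1 - p) * ?y powr p"
    proof (cases "?y \<le> \<epsilon>")
      case True
      then show ?thesis by (smt (verit) mult_nonneg_nonneg powr_ge_zero)
    next
      case False
      have "1 = \<epsilon> powr (1 - p) * \<epsilon> powr (p - 1)" using \<epsilon> by (simp add: powr_add[symmetric])
      also have "\<dots> \<le> \<epsilon> powr (1 - p) * ?y powr (p - 1)"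
        using False \<epsilon> p by (intro mult_left_mono powr_mono2) auto
      finally have "?y * 1 \<le> ?y * (\<epsilon> powr (1 - p) * ?y powr (p - 1))" by (intro mult_left_mono) auto
      also have "\<dots> = \<epsilon> powr (1 - p) * ?y powr p"
        using False \<epsilon> powr_add[of ?y 1 "p - 1"] by simp
      finally show ?thesis using \<epsilon> by simp
    qed
    then have "?y * torus_poisson a x \<le> (\<epsilon> + \<epsilon> powr (1 - p) * ?y powr p) * B"
      using P torus_poisson_nonneg[OF a, of x] by (intro mult_mono) (auto simp: \<epsilon> less_imp_le)
    also have "\<dots> = B * \<epsilon> + B * \<epsilon> powr (1 - p) * norm (scaled r h x) powr p"
      using x by (simp add: scaled_torus algebra_simps)
    finally show "ennreal (?y * torus_poisson a x) \<le>
        ennreal (B * \<epsilon>) + ennreal (B * \<epsilon> powr (1 - p)) * ennreal (norm (scaled r h x) powr p)"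
      using B \<epsilon> by (simp add: ennreal_mult[symmetric] ennreal_plus[symmetric] ennreal_leI del: ennreal_plus)
  qed
  also have "\<dots> = ennreal (B * \<epsilon>) + ennreal (B * \<epsilon> powr (1 - p)) * (\<integral>\<^sup>+ x. ennreal (norm (scaled r h x) powr p) \<partial>torus_measure)"
  proof -
    have "emeasure (torus_measure :: (complex ^ 'd) measure) UNIV = 1"
      using prob_space.emeasure_space_1[OF prob_space_torus_measure, where 'd1='d] by simp
    then show ?thesis by (subst nn_integral_add) (auto simp: nn_integral_cmult)
  qed
  also have "\<dots> \<le> ennreal (B * \<epsilon>) + ennreal (B * \<epsilon> powr (1 - p)) * ennreal (\<epsilon> powr p)"
    by (intro add_left_mono mult_left_mono order_trans[OF hardy_mean_le[OF r] bound]) auto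
  also have "\<dots> = ennreal (2 * B * \<epsilon>)"
    using B \<epsilon> by (simp add: ennreal_mult[symmetric] ennreal_plus[symmetric] powr_add[symmetric] del: ennreal_plus)
  finally have "norm (h (r *\<^sub>R a)) \<le> 2 * B * \<epsilon>"
    using B \<epsilon> by (subst (asm) ennreal_le_iff) auto
  then show ?thesis by (simp add: B_def)
qed

lemma szego_weight_ge:
  assumes "\<And>i. norm (a $ i) \<le> s" "s < 1"
  shows "(1 - s\<^sup>2) ^ CARD('d) \<le> szego_weight (a :: complex ^ 'd::finite)"
proof -
  have s: "0 \<le> s" using assms(1) norm_ge_zero order_trans by blast
  have "(\<Prod>i\<in>(UNIV :: 'd set). 1 - s\<^sup>2) \<le> szego_weight a"
    unfolding szego_weight_def
    using assms s by (intro prod_mono conjI) (auto intro!: power_mono simp: abs_square_le_1)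
  then show ?thesis by simp
qed

text \<open>The series of the A_j f_j is summed directly. The bound on tails and the pointwise bound
  give locally uniform convergence, so the limit is holomorphic, and Fatou's lemma bounds its
  norm.\<close>

lemma simply_interpolating_criterion:
  fixes \<Lambda> :: "nat \<Rightarrow> complex ^ 'd::finite"
  assumes p: "p \<ge> 1" and \<Lambda>: "\<And>n. \<Lambda> n \<in> polydisc"
    and f: "\<And>n. sv_holomorphic_on (f n) polydisc"
    and dual: "\<And>m n. f m (\<Lambda> n) = (if m = n then 1 else 0)"
    and C: "C \<ge> 0" and bound: "\<And>J A. finite J \<Longrightarrow>
      hardy_norm_powr p (\<lambda>x. \<Sum>j\<in>J. A j * f j x) \<le> ennreal (C * (\<Sum>j\<in>J. szego_weight (\<Lambda> j) * norm (A j) powr p))"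
  shows "simply_interpolating p \<Lambda>"
  unfolding simply_interpolating_def
proof
  fix a assume "a \<in> ell_p p"
  then have summ: "summable (\<lambda>n. norm (a n) powr p)" by (simp add: ell_p_def)
  \<comment> \<open>The values to be attained, with the normalization of \<open>interp_map\<close>
    undone.\<close>
  define A where "A n = a n / of_real (szego_weight (\<Lambda> n) powr (1 / p))" for n
  have A: "szego_weight (\<Lambda> n) * norm (A n) powr p = norm (a n) powr p" for n
    using p szego_weight_pos[OF \<Lambda>, of n] by (simp add: A_def norm_divide powr_divide powr_powr)
  define F where "F n x = (\<Sum>j<n. A j * f j x)" for n x
  have svF: "sv_holomorphic_on (F n) polydisc" for n
    unfolding F_def by (intro sv_holomorphic_on_sum sv_holomorphic_on_cmult f)
  have diff: "hardy_norm_powr p (\<lambda>x. F n x - F m x) \<le> ennreal (C * (\<Sum>j\<in>{m..<n}. norm (a j) powr p))" if "m \<le> n" for m n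
  proof -
    have "F n x - F m x = (\<Sum>j\<in>{m..<n}. A j * f j x)" for x
      using that by (simp add: F_def sum_diff_nat_ivl lessThan_atLeast0)
    then show ?thesis using bound[of "{m..<n}" A] by (simp add: A)
  qed
  have unif: "uniform_limit X F (\<lambda>x. lim (\<lambda>n. F n x)) sequentially"
    if X: "\<And>x i. x \<in> X \<Longrightarrow> norm (x $ i) \<le> \<rho>" "0 < \<rho>" "\<rho> < 1" for X :: "(complex ^ 'd) set" and \<rho>
  proof -
    \<comment> \<open>Splits the margin evenly: a point with coordinates bounded by \<rho> is r y
      with the coordinates of y bounded by r < 1, so both the dilation and the weight of y are under
      control.\<close>
    define r where "r = sqrt \<rho>"
    have r: "0 < r" "r < 1" "r * r = \<rho>" using X by (auto simp: r_def)
    define K where "K = 2 * 4 ^ CARD('d) / (1 - \<rho>) ^ CARD('d)"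
    have K: "K > 0" using X by (simp add: K_def)
    have pt: "norm (F n x - F m x) \<le> K * \<epsilon>"
      if "x \<in> X" "\<epsilon> > 0" "hardy_norm_powr p (\<lambda>x. F n x - F m x) \<le> ennreal (\<epsilon> powr p)" for n m x \<epsilon>
    proof -
      define y where "y = (1 / r) *\<^sub>R x"
      have yr: "norm (y $ i) \<le> r" for i
      proof -
        have "norm (x $ i) \<le> r * r" using X(1)[OF that(1)] r by simp
        then show ?thesis using r by (simp add: y_def field_simps)
      qed
      have y: "y \<in> polydisc" "r *\<^sub>R y = x" using r le_less_trans[OF yr r(2)] by (auto simp: polydisc_def y_def)
      have "sv_holomorphic_on (\<lambda>x. F n x + (-1) * F m x) polydisc"
        by (intro sv_holomorphic_on_add sv_holomorphic_on_cmult svF)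
      then have sv: "sv_holomorphic_on (\<lambda>x. F n x - F m x) polydisc" by simp
      have "norm (F n x - F m x) \<le> 2 * 4 ^ CARD('d) / szego_weight y * \<epsilon>"
        using hardy_point_bound[OF sv p r(1,2) y(1) that(2,3)] y(2) by simp
      also have "\<dots> \<le> K * \<epsilon>"
      proof -
        have "(1 - \<rho>) ^ CARD('d) \<le> szego_weight y"
          using szego_weight_ge[of y r] yr r by (simp add: power2_eq_square)
        then show ?thesis unfolding K_def using X that szego_weight_pos[OF y(1)]
          by (intro mult_right_mono divide_left_mono mult_pos_pos zero_less_power) auto
      qed
      finally show ?thesis .
    qed
    have "uniformly_Cauchy_on X F"
      unfolding uniformly_Cauchy_on_def
    proof (intro allI impI)
      fix e :: real assume e: "e > 0"
      define \<epsilon> where "\<epsilon> = e / (2 * K)"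
      have \<epsilon>: "\<epsilon> > 0" "K * \<epsilon> < e" using e K by (auto simp: \<epsilon>_def)
      have "\<epsilon> powr p / (C + 1) > 0" using \<epsilon> C by simp
      then obtain N where N: "\<And>m n. m \<ge> N \<Longrightarrow> norm (\<Sum>j\<in>{m..<n}. norm (a j) powr p) < \<epsilon> powr p / (C + 1)"
        using summ unfolding summable_Cauchy by blast
      have le: "norm (F n x - F m x) < e" if "N \<le> m" "m \<le> n" "x \<in> X" for m n x
      proof -
        have "(\<Sum>j\<in>{m..<n}. norm (a j) powr p) \<le> \<epsilon> powr p / (C + 1)"
          using N[of m n] that by (simp add: abs_of_nonneg sum_nonneg)
        then have "C * (\<Sum>j\<in>{m..<n}. norm (a j) powr p) \<le> C * (\<epsilon> powr p / (C + 1))"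
          using C by (intro mult_left_mono)
        also have "\<dots> \<le> \<epsilon> powr p" using C by (simp add: field_simps)
        finally have "hardy_norm_powr p (\<lambda>x. F n x - F m x) \<le> ennreal (\<epsilon> powr p)"
          using diff[OF that(2)] by (meson ennreal_leI order_trans)
        from pt[OF that(3) \<epsilon>(1) this] show ?thesis using \<epsilon>(2) by simp
      qed
      show "\<exists>M. \<forall>x\<in>X. \<forall>m\<ge>M. \<forall>n\<ge>M. dist (F m x) (F n x) < e"
      proof (intro exI[of _ N] ballI allI impI)
        fix x m n assume "x \<in> X" "m \<ge> N" "n \<ge> N"
        then show "dist (F m x) (F n x) < e"
          using le[of m n x] le[of n m x] by (cases "m \<le> n") (auto simp: dist_norm norm_minus_commute)
      qed
    qed
    then show ?thesis
      using Cauchy_uniformly_convergent uniformly_convergent_uniform_limit_iff by blast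
  qed
  define G where "G x = lim (\<lambda>n. F n x)" for x
  have G_lim: "(\<lambda>n. F n x) \<longlonglongrightarrow> G x" if "x \<in> polydisc" for x
  proof -
    define M where "M = Max (range (\<lambda>i. norm (x $ i)))"
    define \<rho> where "\<rho> = (M + 1) / 2"
    have M1: "M < 1" using that by (simp add: polydisc_def M_def)
    have le: "norm (x $ i) \<le> M" for i by (simp add: M_def)
    have M0: "0 \<le> M" using le norm_ge_zero order_trans by blast
    have "norm (x $ i) \<le> \<rho>" "0 < \<rho>" "\<rho> < 1" for i
      using le[of i] M0 M1 unfolding \<rho>_def by auto
    from tendsto_uniform_limitI[OF unif[of "{x}" \<rho>]] this show ?thesis unfolding G_def by auto
  qed
  have svG: "sv_holomorphic_on G polydisc"
  proof (rule sv_holomorphic_uniform_limit[OF svF open_polydisc])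
    fix x :: "complex ^ 'd" assume x: "x \<in> polydisc"
    define M where "M = Max (range (\<lambda>i. norm (x $ i)))"
    have M1: "M < 1" using x by (simp add: polydisc_def M_def)
    have le: "norm (x $ i) \<le> M" for i by (simp add: M_def)
    have M0: "0 \<le> M" using le norm_ge_zero order_trans by blast
    define e where "e = (1 - M) / 2"
    have e: "e > 0" "M + e < 1" "M + e > 0" using M1 M0 by (auto simp: e_def field_simps)
    have b: "norm (y $ i) \<le> M + e" if "y \<in> cball x e" for y i
    proof -
      have "norm (y $ i) \<le> norm (x $ i) + norm ((y - x) $ i)"
        using norm_triangle_ineq[of "x $ i" "(y - x) $ i"] by simp
      also have "norm ((y - x) $ i) \<le> norm (y - x)" by (rule Finite_Cartesian_Product.norm_nth_le)
      finally show ?thesis using that le[of i] by (simp add: dist_norm norm_minus_commute)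
    qed
    have "uniform_limit (cball x e) F G sequentially"
      unfolding G_def by (rule unif[of _ "M + e"]) (use b e in auto)
    moreover have "cball x e \<subseteq> polydisc" using b e(2) le_less_trans by (fastforce simp: polydisc_def)
    ultimately show "\<exists>e>0. cball x e \<subseteq> polydisc \<and> uniform_limit (cball x e) F G sequentially"
      using e(1) by blast
  qed
  have "hardy_norm_powr p G \<le> ennreal (C * (\<Sum>n. norm (a n) powr p))"
    unfolding hardy_norm_powr_eq
  proof (rule SUP_least)
    fix r :: real assume "r \<in> {0<..<1}"
    then have r: "0 < r" "r < 1" by auto
    note [measurable] = measurable_scaled[OF svF r]
    have "(\<integral>\<^sup>+ x. ennreal (norm (scaled r G x) powr p) \<partial>torus_measure) =
      (\<integral>\<^sup>+ x. liminf (\<lambda>n. ennreal (norm (scaled r (F n) x) powr p)) \<partial>torus_measure)"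
    proof (rule nn_integral_torus_cong)
      fix x :: "complex ^ 'd" assume x: "x \<in> torus"
      then have "r *\<^sub>R x \<in> polydisc" using scaleR_in_polydisc[OF r] torus_subset_closed_polydisc by auto
      then have "(\<lambda>n. ennreal (norm (scaled r (F n) x) powr p)) \<longlonglongrightarrow> ennreal (norm (scaled r G x) powr p)"
        unfolding scaled_torus[OF x]
        by (intro tendsto_ennrealI tendsto_powr2 tendsto_norm tendsto_const G_lim) (use p in auto)
      then show "ennreal (norm (scaled r G x) powr p) = liminf (\<lambda>n. ennreal (norm (scaled r (F n) x) powr p))"
        by (intro lim_imp_Liminf[symmetric]) auto
    qed
    also have "\<dots> \<le> liminf (\<lambda>n. \<integral>\<^sup>+ x. ennreal (norm (scaled r (F n) x) powr p) \<partial>torus_measure)"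
      by (rule nn_integral_liminf) measurable
    also have "\<dots> \<le> ennreal (C * (\<Sum>n. norm (a n) powr p))"
    proof (rule Liminf_le)
      have "(\<integral>\<^sup>+ x. ennreal (norm (scaled r (F n) x) powr p) \<partial>torus_measure) \<le> ennreal (C * (\<Sum>n. norm (a n) powr p))" for n
      proof -
        have "(\<integral>\<^sup>+ x. ennreal (norm (scaled r (F n) x) powr p) \<partial>torus_measure) \<le> hardy_norm_powr p (F n)"
          by (rule hardy_mean_le[OF r])
        also have "\<dots> \<le> ennreal (C * (\<Sum>j<n. norm (a j) powr p))"
          using bound[of "{..<n}" A] unfolding F_def by (simp add: A)
        also have "\<dots> \<le> ennreal (C * (\<Sum>n. norm (a n) powr p))"
          using C by (intro ennreal_leI mult_left_mono sum_le_suminf summ) auto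
        finally show ?thesis .
      qed
      then show "\<forall>\<^sub>F n in sequentially. (\<integral>\<^sup>+ x. ennreal (norm (scaled r (F n) x) powr p) \<partial>torus_measure) \<le> ennreal (C * (\<Sum>n. norm (a n) powr p))"
        by simp
    qed auto
    finally show "(\<integral>\<^sup>+ x. ennreal (norm (scaled r G x) powr p) \<partial>torus_measure) \<le> ennreal (C * (\<Sum>n. norm (a n) powr p))" .
  qed
  then have "G \<in> hardy_space p"
    using svG le_less_trans[OF _ ennreal_less_top] by (auto simp: hardy_space_def)
  moreover have "interp_map p \<Lambda> G = a"
  proof
    fix n
    have *: "F m (\<Lambda> n) = A n" if "n < m" for m
      using that by (simp add: F_def dual if_distrib[where f="\<lambda>x. _ * x"] cong: if_cong)
    have "\<forall>\<^sub>F m in sequentially. F m (\<Lambda> n) = A n"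
      using eventually_gt_at_top[of n] by eventually_elim (rule *)
    then have "(\<lambda>m. F m (\<Lambda> n)) \<longlonglongrightarrow> A n" by (rule tendsto_eventually)
    then have "G (\<Lambda> n) = A n" using G_lim[OF \<Lambda>] LIMSEQ_unique by blast
    then show "interp_map p \<Lambda> G n = a n"
      using szego_weight_pos[OF \<Lambda>, of n]
      by (simp add: interp_map_def A_def szego_weight_powr[OF \<Lambda>] del: of_real_prod)
  qed
  ultimately show "a \<in> interp_map p \<Lambda> ` hardy_space p" by blast
qed

subsection \<open>Marcinkiewicz interpolation for finite sums\<close>

lemma nn_integral_powr_Icc:
  assumes "a > -1" "c \<ge> (0::real)"
  shows "(\<integral>\<^sup>+ t. ennreal (indicator {0..c} t * t powr a) \<partial>lborel) = ennreal (c powr (a + 1) / (a + 1))"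
proof -
  have eq: "(\<lambda>t. if t \<in> {0..c} then t powr a else 0) = (\<lambda>t. indicator {0..c} t * t powr a)" by auto
  have "((\<lambda>t. indicator {0..c} t * t powr a) has_integral c powr (a + 1) / (a + 1)) UNIV"
    using has_integral_powr_from_0[OF assms] unfolding has_integral_restrict_UNIV[symmetric, of _ _ "{0..c}"] eq .
  from nn_integral_has_integral_lborel[OF _ _ this] show ?thesis by simp
qed

lemma nn_integral_powr_Ici:
  assumes "a < -1" "c > (0::real)"
  shows "(\<integral>\<^sup>+ t. ennreal (indicator {c..} t * t powr a) \<partial>lborel) = ennreal (c powr (a + 1) / (- a - 1))"
proof -
  have "- (c powr (a + 1)) / (a + 1) = c powr (a + 1) / (- a - 1)"
    using assms by (simp add: field_simps)
  moreover have eq: "(\<lambda>t. if t \<in> {c..} then t powr a else 0) = (\<lambda>t. indicator {c..} t * t powr a)" by auto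
  ultimately have "((\<lambda>t. indicator {c..} t * t powr a) has_integral c powr (a + 1) / (- a - 1)) UNIV"
    using has_integral_powr_to_inf[OF assms] unfolding has_integral_restrict_UNIV[symmetric, of _ _ "{c..}"] eq by simp
  from nn_integral_has_integral_lborel[OF _ _ this] show ?thesis by simp
qed

text \<open>Either x or y is at least t / 2. This pointwise form replaces the usual weak-type
  estimates of distribution functions.\<close>

lemma marcinkiewicz_split:
  fixes x y h :: real
  assumes "0 < t" "t \<le> h" "h \<le> x + y" "x \<ge> 0" "y \<ge> 0"
  shows "t powr (p - 1) \<le> 2 * (t powr (p - 2) * x) + 4 * (t powr (p - 3) * y\<^sup>2)"
proof -
  have 1: "t powr (p - 1) = t powr (p - 2) * t" "t powr (p - 1) = t powr (p - 3) * t\<^sup>2"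
    using assms powr_add[of t "p - 2" 1] powr_add[of t "p - 3" 2] by (auto simp: powr_numeral)
  show ?thesis
  proof (cases "t \<le> 2 * x")
    case True
    have "t powr (p - 1) \<le> t powr (p - 2) * (2 * x)" unfolding 1(1) using True by (intro mult_left_mono) auto
    also have "\<dots> = 2 * (t powr (p - 2) * x)" by simp
    finally have "t powr (p - 1) \<le> 2 * (t powr (p - 2) * x)" .
    moreover have "0 \<le> t powr (p - 3) * y\<^sup>2" by simp
    ultimately show ?thesis by linarith
  next
    case False
    then have "t\<^sup>2 \<le> (2 * y)\<^sup>2" using assms by (intro power_mono) auto
    then have "t powr (p - 1) \<le> t powr (p - 3) * (2 * y)\<^sup>2" unfolding 1(2) by (intro mult_left_mono) auto
    moreover have "0 \<le> t powr (p - 2) * x" using assms by auto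
    ultimately show ?thesis by (simp add: power_mult_distrib)
  qed
qed

text \<open>The formula for 1 < p < 2 blows up at both ends, where the hypotheses apply directly
  with constant 1.\<close>

definition marcinkiewicz_const :: "real \<Rightarrow> real" where
  "marcinkiewicz_const p = (if 1 < p \<and> p < 2 then p * (2 / (p - 1) + 4 / (2 - p)) else 1)"

lemma marcinkiewicz_const_nonneg: "marcinkiewicz_const p \<ge> 0"
  by (auto simp: marcinkiewicz_const_def)

text \<open>Write h^p as p times the integral of t^(p-1) over 0 < t < h. At height t the
  coefficients larger than t are treated in L^1 and the others in L^2. After exchanging the
  integrals, each coefficient leaves an integral of t^(p-2) up to |A_j|, finite as p > 1, and one of
  t^(p-3) beyond it, finite as p < 2.\<close>

lemma marcinkiewicz:
  fixes \<Phi> :: "'j \<Rightarrow> 'a \<Rightarrow> complex" and w :: "'j \<Rightarrow> real"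
  assumes M: "sigma_finite_measure M" and J: "finite J" and C: "C \<ge> 0"
    and [measurable]: "\<And>j. j \<in> J \<Longrightarrow> \<Phi> j \<in> borel_measurable M" and w: "\<And>j. j \<in> J \<Longrightarrow> w j \<ge> 0"
    and L1: "\<And>A. (\<integral>\<^sup>+ x. ennreal (norm (\<Sum>j\<in>J. A j * \<Phi> j x)) \<partial>M) \<le> ennreal (C * (\<Sum>j\<in>J. w j * norm (A j)))"
    and L2: "\<And>A. (\<integral>\<^sup>+ x. ennreal ((norm (\<Sum>j\<in>J. A j * \<Phi> j x))\<^sup>2) \<partial>M) \<le> ennreal (C * (\<Sum>j\<in>J. w j * (norm (A j))\<^sup>2))"
    and p: "1 \<le> p" "p \<le> 2"
  shows "(\<integral>\<^sup>+ x. ennreal (norm (\<Sum>j\<in>J. A j * \<Phi> j x) powr p) \<partial>M) \<le>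
      ennreal (marcinkiewicz_const p * C * (\<Sum>j\<in>J. w j * norm (A j) powr p))"
proof -
  consider "p = 1" | "p = 2" | "1 < p" "p < 2" using p by linarith
  then show ?thesis
  proof cases
    case 1
    then show ?thesis using L1[of A] by (simp add: marcinkiewicz_const_def)
  next
    case 2
    then show ?thesis using L2[of A] by (simp add: marcinkiewicz_const_def powr_numeral)
  next
    case 3
    interpret sigma_finite_measure M by (rule M)
    interpret P: pair_sigma_finite M lborel ..
    define big where "big t j = (if norm (A j) > t then A j else 0)" for t :: real and j
    define small where "small t j = (if norm (A j) > t then 0 else A j)" for t :: real and j
    define h where "h B x = norm (\<Sum>j\<in>J. B j * \<Phi> j x)" for B x
    have h0: "h B x \<ge> 0" for B x by (simp add: h_def)
    have tri: "h A x \<le> h (big t) x + h (small t) x" for t x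
    proof -
      have "(\<Sum>j\<in>J. A j * \<Phi> j x) = (\<Sum>j\<in>J. big t j * \<Phi> j x) + (\<Sum>j\<in>J. small t j * \<Phi> j x)"
        unfolding sum.distrib[symmetric] by (intro sum.cong refl) (auto simp: big_def small_def)
      then show ?thesis unfolding h_def by (simp add: norm_triangle_ineq)
    qed
    have [measurable]: "(\<lambda>q. \<Phi> j (fst q)) \<in> borel_measurable (M \<Otimes>\<^sub>M lborel)" if "j \<in> J" for j
      using that by measurable
    have [measurable]: "(\<lambda>q. big (snd q) j) \<in> borel_measurable (M \<Otimes>\<^sub>M lborel)"
      "(\<lambda>q. small (snd q) j) \<in> borel_measurable (M \<Otimes>\<^sub>M lborel)" for j
      unfolding big_def small_def by measurable
    have [measurable]: "(\<lambda>q. h (big (snd q)) (fst q)) \<in> borel_measurable (M \<Otimes>\<^sub>M lborel)"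
      unfolding h_def by measurable
    have [measurable]: "(\<lambda>q. h (small (snd q)) (fst q)) \<in> borel_measurable (M \<Otimes>\<^sub>M lborel)"
      unfolding h_def by measurable
    \<comment> \<open>The majorant is used for all t > 0 and not only for t \<le> h, so it is linear
      in the two quantities that L1 and L2 control.\<close>
    define k where "k t x = p * (2 * (t powr (p - 2) * h (big t) x) + 4 * (t powr (p - 3) * (h (small t) x)\<^sup>2)) * indicator {0<..} t"
      for t x
    have meas_k: "(\<lambda>q. ennreal (k (snd q) (fst q))) \<in> borel_measurable (M \<Otimes>\<^sub>M lborel)"
      unfolding k_def by measurable
    have "(\<integral>\<^sup>+ x. ennreal (h A x powr p) \<partial>M) \<le> (\<integral>\<^sup>+ x. (\<integral>\<^sup>+ t. ennreal (k t x) \<partial>lborel) \<partial>M)"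
    proof (rule nn_integral_mono)
      fix x
      have "ennreal (h A x powr p) = ennreal p * (\<integral>\<^sup>+ t. ennreal (indicator {0..h A x} t * t powr (p - 1)) \<partial>lborel)"
        using 3 h0 by (subst nn_integral_powr_Icc) (auto simp: ennreal_mult[symmetric])
      also have "\<dots> = (\<integral>\<^sup>+ t. ennreal p * ennreal (indicator {0..h A x} t * t powr (p - 1)) \<partial>lborel)"
        by (rule nn_integral_cmult[symmetric]) measurable
      also have "\<dots> \<le> (\<integral>\<^sup>+ t. ennreal (k t x) \<partial>lborel)"
      proof (rule nn_integral_mono)
        fix t :: real
        show "ennreal p * ennreal (indicator {0..h A x} t * t powr (p - 1)) \<le> ennreal (k t x)"
        proof (cases "0 < t \<and> t \<le> h A x")
          case True
          then have "p * t powr (p - 1) \<le> k t x"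
            using 3 marcinkiewicz_split[of t "h A x" "h (big t) x" "h (small t) x" p] tri[of x t] h0
            by (simp add: k_def)
          then show ?thesis using True 3 by (simp add: ennreal_mult[symmetric] ennreal_leI)
        next
          case False
          then have z: "indicator {0..h A x} t * t powr (p - 1) = 0" by (auto simp: indicator_def)
          show ?thesis unfolding z by simp
        qed
      qed
      finally show "ennreal (h A x powr p) \<le> (\<integral>\<^sup>+ t. ennreal (k t x) \<partial>lborel)" .
    qed
    also have "\<dots> = (\<integral>\<^sup>+ t. (\<integral>\<^sup>+ x. ennreal (k t x) \<partial>M) \<partial>lborel)"
      by (rule P.Fubini'[symmetric]) (use meas_k in \<open>simp add: split_beta'\<close>)
    also have "\<dots> \<le> (\<integral>\<^sup>+ t. (\<Sum>j\<in>J. ennreal (2 * p * C * w j * norm (A j)) * ennreal (indicator {0..norm (A j)} t * t powr (p - 2)) +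
        ennreal (4 * p * C * w j * (norm (A j))\<^sup>2) * ennreal (indicator {norm (A j)..} t * t powr (p - 3))) \<partial>lborel)"
    proof (rule nn_integral_mono)
      fix t :: real
      show "(\<integral>\<^sup>+ x. ennreal (k t x) \<partial>M) \<le> (\<Sum>j\<in>J. ennreal (2 * p * C * w j * norm (A j)) * ennreal (indicator {0..norm (A j)} t * t powr (p - 2)) +
        ennreal (4 * p * C * w j * (norm (A j))\<^sup>2) * ennreal (indicator {norm (A j)..} t * t powr (p - 3)))"
      proof (cases "0 < t")
        case True
        have [measurable]: "h B \<in> borel_measurable M" for B unfolding h_def by measurable
        have "(\<integral>\<^sup>+ x. ennreal (k t x) \<partial>M) = (\<integral>\<^sup>+ x. ennreal (2 * p * t powr (p - 2)) * ennreal (h (big t) x) +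
            ennreal (4 * p * t powr (p - 3)) * ennreal ((h (small t) x)\<^sup>2) \<partial>M)"
          using True 3 h0 by (intro nn_integral_cong) (simp add: k_def ennreal_mult[symmetric] ennreal_plus[symmetric] algebra_simps del: ennreal_plus)
        also have "\<dots> = ennreal (2 * p * t powr (p - 2)) * (\<integral>\<^sup>+ x. ennreal (h (big t) x) \<partial>M) +
            ennreal (4 * p * t powr (p - 3)) * (\<integral>\<^sup>+ x. ennreal ((h (small t) x)\<^sup>2) \<partial>M)"
          by (simp add: nn_integral_add nn_integral_cmult)
        also have "\<dots> \<le> ennreal (2 * p * t powr (p - 2)) * ennreal (C * (\<Sum>j\<in>J. w j * norm (big t j))) +
            ennreal (4 * p * t powr (p - 3)) * ennreal (C * (\<Sum>j\<in>J. w j * (norm (small t j))\<^sup>2))"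
          unfolding h_def by (intro add_mono mult_left_mono L1 L2) auto
        also have "\<dots> = ennreal (\<Sum>j\<in>J. 2 * p * t powr (p - 2) * C * (w j * norm (big t j)) + 4 * p * t powr (p - 3) * C * (w j * (norm (small t j))\<^sup>2))"
        proof -
          define Sb Ss where "Sb = (\<Sum>j\<in>J. w j * norm (big t j))" and "Ss = (\<Sum>j\<in>J. w j * (norm (small t j))\<^sup>2)"
          have nn: "0 \<le> C * Sb" "0 \<le> C * Ss"
            unfolding Sb_def Ss_def using w C by (auto intro!: sum_nonneg mult_nonneg_nonneg)
          have nn': "0 \<le> 2 * p * t powr (p - 2)" "0 \<le> 4 * p * t powr (p - 3)" using 3 by auto
          have "(\<Sum>j\<in>J. 2 * p * t powr (p - 2) * C * (w j * norm (big t j)) + 4 * p * t powr (p - 3) * C * (w j * (norm (small t j))\<^sup>2))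
            = 2 * p * t powr (p - 2) * C * Sb + 4 * p * t powr (p - 3) * C * Ss"
            unfolding Sb_def Ss_def sum.distrib sum_distrib_left ..
          then show ?thesis unfolding Sb_def[symmetric] Ss_def[symmetric]
            using nn nn' ennreal_mult[OF nn'(1) nn(1)] ennreal_mult[OF nn'(2) nn(2)]
              ennreal_plus[OF mult_nonneg_nonneg[OF nn'(1) nn(1)] mult_nonneg_nonneg[OF nn'(2) nn(2)]]
            by (simp only: mult.assoc)
        qed
        also have "\<dots> = (\<Sum>j\<in>J. ennreal (2 * p * t powr (p - 2) * C * (w j * norm (big t j)) + 4 * p * t powr (p - 3) * C * (w j * (norm (small t j))\<^sup>2)))"
        proof (rule sum_ennreal[symmetric])
          fix j assume "j \<in> J"
          then show "0 \<le> 2 * p * t powr (p - 2) * C * (w j * norm (big t j)) + 4 * p * t powr (p - 3) * C * (w j * (norm (small t j))\<^sup>2)"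
            using w[of j] 3 C by (intro add_nonneg_nonneg mult_nonneg_nonneg) auto
        qed
        also have "\<dots> \<le> (\<Sum>j\<in>J. ennreal (2 * p * C * w j * norm (A j)) * ennreal (indicator {0..norm (A j)} t * t powr (p - 2)) +
          ennreal (4 * p * C * w j * (norm (A j))\<^sup>2) * ennreal (indicator {norm (A j)..} t * t powr (p - 3)))"
        proof (rule sum_mono)
          fix j assume j: "j \<in> J"
          define X1 where "X1 = 2 * p * C * w j * norm (A j)"
          define X2 where "X2 = 4 * p * C * w j * (norm (A j))\<^sup>2"
          have X: "X1 \<ge> 0" "X2 \<ge> 0"
            unfolding X1_def X2_def using w[OF j] 3 C by (auto intro!: mult_nonneg_nonneg)
          have "2 * p * t powr (p - 2) * C * (w j * norm (big t j)) + 4 * p * t powr (p - 3) * C * (w j * (norm (small t j))\<^sup>2)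
            \<le> X1 * (indicator {0..norm (A j)} t * t powr (p - 2)) + X2 * (indicator {norm (A j)..} t * t powr (p - 3))"
          proof (cases "norm (A j) > t")
            case True
            then show ?thesis using \<open>0 < t\<close> by (simp add: big_def small_def X1_def)
          next
            case False
            have "0 \<le> X1 * (indicator {0..norm (A j)} t * t powr (p - 2))" using X by simp
            with False show ?thesis by (simp add: big_def small_def X2_def)
          qed
          then have "ennreal (2 * p * t powr (p - 2) * C * (w j * norm (big t j)) + 4 * p * t powr (p - 3) * C * (w j * (norm (small t j))\<^sup>2))
            \<le> ennreal (X1 * (indicator {0..norm (A j)} t * t powr (p - 2)) + X2 * (indicator {norm (A j)..} t * t powr (p - 3)))"
            by (rule ennreal_leI)
          also have "\<dots> = ennreal X1 * ennreal (indicator {0..norm (A j)} t * t powr (p - 2)) +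
            ennreal X2 * ennreal (indicator {norm (A j)..} t * t powr (p - 3))"
            using X by (subst ennreal_plus; simp only: ennreal_mult'' ennreal_mult mult_nonneg_nonneg indicator_pos_le powr_ge_zero)
          finally show "ennreal (2 * p * t powr (p - 2) * C * (w j * norm (big t j)) + 4 * p * t powr (p - 3) * C * (w j * (norm (small t j))\<^sup>2)) \<le>
            ennreal (2 * p * C * w j * norm (A j)) * ennreal (indicator {0..norm (A j)} t * t powr (p - 2)) +
            ennreal (4 * p * C * w j * (norm (A j))\<^sup>2) * ennreal (indicator {norm (A j)..} t * t powr (p - 3))"
            unfolding X1_def X2_def .
        qed
        finally show ?thesis .
      qed (simp add: k_def)
    qed
    also have "\<dots> = (\<Sum>j\<in>J. ennreal (2 * p * C * w j * norm (A j)) * (\<integral>\<^sup>+ t. ennreal (indicator {0..norm (A j)} t * t powr (p - 2)) \<partial>lborel) +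
        ennreal (4 * p * C * w j * (norm (A j))\<^sup>2) * (\<integral>\<^sup>+ t. ennreal (indicator {norm (A j)..} t * t powr (p - 3)) \<partial>lborel))"
      by (simp add: nn_integral_sum nn_integral_add nn_integral_cmult)
    also have "\<dots> = (\<Sum>j\<in>J. ennreal (marcinkiewicz_const p * C * (w j * norm (A j) powr p)))"
    proof (rule sum.cong[OF refl])
      fix j assume j: "j \<in> J"
      show "ennreal (2 * p * C * w j * norm (A j)) * (\<integral>\<^sup>+ t. ennreal (indicator {0..norm (A j)} t * t powr (p - 2)) \<partial>lborel) +
        ennreal (4 * p * C * w j * (norm (A j))\<^sup>2) * (\<integral>\<^sup>+ t. ennreal (indicator {norm (A j)..} t * t powr (p - 3)) \<partial>lborel) =
        ennreal (marcinkiewicz_const p * C * (w j * norm (A j) powr p))"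
      proof (cases "A j = 0")
        case False
        define y where "y = norm (A j)"
        have y: "y > 0" using False by (simp add: y_def)
        have e: "y * y powr (p - 1) = y powr p" "y\<^sup>2 * y powr (p - 2) = y powr p"
          using y powr_add[of y 1 "p - 1"] powr_add[of y 2 "p - 2"] by (auto simp: powr_numeral)
        have i1: "(\<integral>\<^sup>+ t. ennreal (indicator {0..y} t * t powr (p - 2)) \<partial>lborel) = ennreal (y powr (p - 1) / (p - 1))"
          using nn_integral_powr_Icc[of "p - 2" y] 3 y by simp
        have i2: "(\<integral>\<^sup>+ t. ennreal (indicator {y..} t * t powr (p - 3)) \<partial>lborel) = ennreal (y powr (p - 2) / (2 - p))"
          using nn_integral_powr_Ici[of "p - 3" y] 3 y by simp
        have "2 * p * C * w j * y * (y powr (p - 1) / (p - 1)) + 4 * p * C * w j * y\<^sup>2 * (y powr (p - 2) / (2 - p)) =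
          p * C * w j * (2 / (p - 1) * (y * y powr (p - 1)) + 4 / (2 - p) * (y\<^sup>2 * y powr (p - 2)))"
          by (simp add: distrib_left mult_ac)
        also have "\<dots> = marcinkiewicz_const p * C * (w j * y powr p)"
          unfolding e marcinkiewicz_const_def using 3 by (simp add: algebra_simps)
        finally have "ennreal (2 * p * C * w j * y * (y powr (p - 1) / (p - 1)) + 4 * p * C * w j * y\<^sup>2 * (y powr (p - 2) / (2 - p))) =
            ennreal (marcinkiewicz_const p * C * (w j * y powr p))" by simp
        then show ?thesis unfolding y_def[symmetric] i1 i2 using 3 C w[OF j] y
          by (simp add: ennreal_mult[symmetric] ennreal_plus[symmetric] del: ennreal_plus)
      qed simp
    qed
    also have "\<dots> = ennreal (\<Sum>j\<in>J. marcinkiewicz_const p * C * (w j * norm (A j) powr p))"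
      using w C marcinkiewicz_const_nonneg by (intro sum_ennreal) auto
    also have "(\<Sum>j\<in>J. marcinkiewicz_const p * C * (w j * norm (A j) powr p)) = marcinkiewicz_const p * C * (\<Sum>j\<in>J. w j * norm (A j) powr p)"
      by (simp add: sum_distrib_left)
    finally show ?thesis unfolding h_def .
  qed
qed

section \<open>Fubini in one and in two coordinates of the torus\<close>

text \<open>Allows an estimate in one variable, with the others frozen on the torus, to be
  integrated. The orthogonality of blocks holds only in this fiberwise sense.\<close>

lemma nn_integral_torus_fiber_mono:
  fixes G H :: "complex ^ 'd::finite \<Rightarrow> ennreal"
  assumes G [measurable]: "G \<in> borel_measurable borel" and H [measurable]: "H \<in> borel_measurable borel"
    and le: "\<And>y. y \<in> torus \<Longrightarrow> (\<integral>\<^sup>+ z. G (vec_upd y i z) \<partial>circle_measure) \<le> (\<integral>\<^sup>+ z. H (vec_upd y i z) \<partial>circle_measure)"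
  shows "(\<integral>\<^sup>+ x. G x \<partial>torus_measure) \<le> (\<integral>\<^sup>+ x. H x \<partial>torus_measure)"
proof -
  interpret product_sigma_finite "\<lambda>_::'d. circle_measure" by (rule product_sigma_finite_circle)
  interpret prob_space circle_measure by (rule prob_space_circle_measure)
  interpret PP: product_prob_space "\<lambda>_::'d. circle_measure" UNIV ..
  let ?S = "UNIV - {i}"
  have U: "insert i ?S = UNIV" by auto
  have iter: "(\<integral>\<^sup>+ x. F x \<partial>torus_measure) =
      (\<integral>\<^sup>+ x. (\<integral>\<^sup>+ z. F (vec_lambda (x(i := z))) \<partial>circle_measure) \<partial>(\<Pi>\<^sub>M i\<in>?S. circle_measure))"
    if [measurable]: "F \<in> borel_measurable borel" for F :: "complex ^ 'd \<Rightarrow> ennreal"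
  proof -
    have "(\<lambda>x. F (vec_lambda x)) \<in> borel_measurable (\<Pi>\<^sub>M i\<in>insert i ?S. circle_measure)"
      unfolding U by measurable
    from product_nn_integral_insert[OF _ _ this] show ?thesis
      by (simp add: nn_integral_torus insert_absorb)
  qed
  have AE: "AE x in (\<Pi>\<^sub>M i\<in>?S. circle_measure). \<forall>j\<in>?S. norm (x j) = 1"
  proof (rule AE_finite_allI)
    fix j assume "j \<in> ?S"
    then show "AE x in (\<Pi>\<^sub>M i\<in>?S. circle_measure). norm (x j) = 1"
      using AE_circle_measure by (intro AE_PiM_component prob_space_circle_measure) auto
  qed simp
  show ?thesis unfolding iter[OF G] iter[OF H]
  proof (rule nn_integral_mono_AE)
    show "AE x in (\<Pi>\<^sub>M i\<in>?S. circle_measure). (\<integral>\<^sup>+ z. G (vec_lambda (x(i := z))) \<partial>circle_measure) \<le>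
        (\<integral>\<^sup>+ z. H (vec_lambda (x(i := z))) \<partial>circle_measure)"
      using AE
    proof eventually_elim
      case (elim x)
      \<comment> \<open>The value 1 is a placeholder that makes the point lie on the torus;
        \<open>vec_upd\<close> overwrites it.\<close>
      let ?y = "vec_lambda (x(i := 1))"
      have y: "?y \<in> torus" using elim by (auto simp: torus_def)
      have eq: "vec_lambda (x(i := z)) = vec_upd ?y i z" for z
        by (auto simp: vec_eq_iff vec_upd_nth)
      from le[OF y] show ?case by (simp only: eq[symmetric])
    qed
  qed
qed

lemma nn_integral_torus_two:
  fixes L K :: "complex \<Rightarrow> ennreal"
  assumes [measurable]: "L \<in> borel_measurable borel" "K \<in> borel_measurable borel" and ij: "i \<noteq> (j :: 'd::finite)"
  shows "(\<integral>\<^sup>+ x. L (x $ i) * K (x $ j) \<partial>torus_measure) =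
      (\<integral>\<^sup>+ z. L z \<partial>circle_measure) * (\<integral>\<^sup>+ z. K z \<partial>circle_measure)"
proof -
  interpret product_sigma_finite "\<lambda>_::'d. circle_measure" by (rule product_sigma_finite_circle)
  define f where "f k = (if k = i then L else if k = j then K else (\<lambda>_. 1))" for k
  have [measurable]: "f k \<in> borel_measurable circle_measure" for k
    unfolding f_def by auto
  have one: "(\<integral>\<^sup>+ z. 1 \<partial>circle_measure) = 1"
    using prob_space.emeasure_space_1[OF prob_space_circle_measure] by simp
  have split: "(\<Prod>k\<in>UNIV. g k) = g i * g j * (\<Prod>k\<in>UNIV - {i, j}. g k)" for g :: "'d \<Rightarrow> ennreal"
  proof -
    have U: "UNIV = insert i (insert j (UNIV - {i, j}))" by auto
    have 1: "prod g (insert i (insert j (UNIV - {i, j}))) = g i * prod g (insert j (UNIV - {i, j}))"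
      by (rule prod.insert) (use ij in auto)
    have 2: "prod g (insert j (UNIV - {i, j})) = g j * prod g (UNIV - {i, j})"
      by (rule prod.insert) auto
    show ?thesis unfolding mult.assoc 2[symmetric] 1[symmetric] U[symmetric] ..
  qed
  have "(\<integral>\<^sup>+ x. L (x $ i) * K (x $ j) \<partial>torus_measure) = (\<integral>\<^sup>+ x. (\<Prod>k\<in>UNIV. f k (x k)) \<partial>(\<Pi>\<^sub>M i\<in>UNIV. circle_measure))"
  proof -
    have "(\<Prod>k\<in>UNIV. f k (x k)) = L (x i) * K (x j)" for x
      unfolding split using ij by (simp add: f_def)
    then show ?thesis by (subst nn_integral_torus) auto
  qed
  also have "\<dots> = (\<Prod>k\<in>UNIV. \<integral>\<^sup>+ z. f k z \<partial>circle_measure)"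
    by (rule product_nn_integral_prod) auto
  also have "\<dots> = (\<integral>\<^sup>+ z. L z \<partial>circle_measure) * (\<integral>\<^sup>+ z. K z \<partial>circle_measure)"
    unfolding split using ij one by (simp add: f_def)
  finally show ?thesis .
qed

subsection \<open>Square means on the circle\<close>

lemma poisson_swap:
  assumes "norm z = 1" "norm \<eta> = 1"
  shows "poisson (of_real r * z) \<eta> = poisson (of_real r * \<eta>) z"
proof -
  have "norm (1 - cnj (of_real r * z) * \<eta>) = norm (cnj (1 - cnj (of_real r * z) * \<eta>))"
    by (simp only: complex_mod_cnj)
  also have "cnj (1 - cnj (of_real r * z) * \<eta>) = 1 - cnj (of_real r * \<eta>) * z"
    by (simp add: mult_ac)
  finally show ?thesis using assms by (simp add: poisson_def norm_mult)
qed

text \<open>The Poisson inequality for h^2, integrated over the circle; by symmetry of the kernel in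
  its two boundary points the outer integral gives 1. It moves z out to the circle, the only place
  where the inner functions are unimodular.\<close>

lemma circle_L2_radial_mono:
  assumes h: "continuous_on (cball 0 1) h" "h holomorphic_on ball 0 1" and r: "0 \<le> r" "r < 1"
  shows "(\<integral>\<^sup>+ z. ennreal ((norm (h (of_real r * z)))\<^sup>2) \<partial>circle_measure) \<le>
    (\<integral>\<^sup>+ z. ennreal ((norm (h z))\<^sup>2) \<partial>circle_measure)"
proof -
  interpret prob_space circle_measure by (rule prob_space_circle_measure)
  interpret P: pair_sigma_finite circle_measure circle_measure ..
  define k where "k \<eta> = (if norm \<eta> = 1 then (norm (h \<eta>))\<^sup>2 else 0)" for \<eta>
  have [measurable]: "k \<in> borel_measurable borel"
    unfolding k_def using h(1)
    by (intro borel_measurable_on_sphere continuous_intros) (auto intro: continuous_on_subset)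
  have k0: "k \<eta> \<ge> 0" for \<eta> by (simp add: k_def)
  have [measurable]: "cnj \<in> borel_measurable borel"
    by (intro borel_measurable_continuous_onI continuous_intros)
  have meas: "(\<lambda>q. ennreal (k (fst q) * poisson (of_real r * fst q) (snd q))) \<in> borel_measurable (circle_measure \<Otimes>\<^sub>M circle_measure)"
    unfolding poisson_def by measurable
  have "(\<integral>\<^sup>+ z. ennreal ((norm (h (of_real r * z)))\<^sup>2) \<partial>circle_measure) \<le>
    (\<integral>\<^sup>+ z. (\<integral>\<^sup>+ \<eta>. ennreal (k \<eta> * poisson (of_real r * \<eta>) z) \<partial>circle_measure) \<partial>circle_measure)"
  proof (rule nn_integral_circle_mono)
    fix z :: complex assume z: "norm z = 1"
    have "ennreal ((norm (h (of_real r * z)))\<^sup>2) = ennreal (norm (h (of_real r * z) * h (of_real r * z)))"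
      by (simp add: norm_mult power2_eq_square)
    also have "\<dots> \<le> (\<integral>\<^sup>+ \<eta>. ennreal (norm (h \<eta> * h \<eta>) * poisson (of_real r * z) \<eta>) \<partial>circle_measure)"
      by (rule poisson_submean[where h="\<lambda>z. h z * h z"])
        (use h r z in \<open>auto intro!: continuous_intros holomorphic_intros simp: norm_mult\<close>)
    also have "\<dots> = (\<integral>\<^sup>+ \<eta>. ennreal (k \<eta> * poisson (of_real r * \<eta>) z) \<partial>circle_measure)"
      by (rule nn_integral_circle_cong) (simp add: k_def norm_mult power2_eq_square poisson_swap[OF z])
    finally show "ennreal ((norm (h (of_real r * z)))\<^sup>2) \<le> \<dots>" .
  qed
  also have "\<dots> = (\<integral>\<^sup>+ \<eta>. (\<integral>\<^sup>+ z. ennreal (k \<eta> * poisson (of_real r * \<eta>) z) \<partial>circle_measure) \<partial>circle_measure)"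
    by (rule P.Fubini') (use meas in \<open>simp add: split_beta'\<close>)
  also have "\<dots> = (\<integral>\<^sup>+ z. ennreal ((norm (h z))\<^sup>2) \<partial>circle_measure)"
  proof (rule nn_integral_circle_cong)
    fix \<eta> :: complex assume \<eta>: "norm \<eta> = 1"
    have n: "norm (of_real r * \<eta>) < 1" using r \<eta> by (simp add: norm_mult)
    have "(\<integral>\<^sup>+ z. ennreal (k \<eta> * poisson (of_real r * \<eta>) z) \<partial>circle_measure) =
      (\<integral>\<^sup>+ z. ennreal (k \<eta>) * ennreal (poisson (of_real r * \<eta>) z) \<partial>circle_measure)"
      by (intro nn_integral_cong ennreal_mult k0 poisson_nonneg n)
    also have "\<dots> = ennreal (k \<eta>)"
      by (subst nn_integral_cmult) (auto simp: nn_integral_poisson[OF n])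
    finally show "(\<integral>\<^sup>+ z. ennreal (k \<eta> * poisson (of_real r * \<eta>) z) \<partial>circle_measure) = ennreal ((norm (h \<eta>))\<^sup>2)"
      using \<eta> by (simp add: k_def)
  qed
  finally show ?thesis .
qed

text \<open>The L^2 inner product on the circle; the cut-off makes the integrand Borel when the
  functions are merely continuous on the circle.\<close>

definition circle_inner :: "(complex \<Rightarrow> complex) \<Rightarrow> (complex \<Rightarrow> complex) \<Rightarrow> complex" where
  "circle_inner f g = (LINT z|circle_measure. (if norm z = 1 then f z * cnj (g z) else 0))"

lemma circle_inner_commute: "circle_inner g f = cnj (circle_inner f g)"
proof -
  have "cnj (circle_inner f g) = (LINT z|circle_measure. cnj (if norm z = 1 then f z * cnj (g z) else 0))"
    unfolding circle_inner_def by (rule Bochner_Integration.integral_cnj[symmetric])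
  also have "\<dots> = circle_inner g f"
    unfolding circle_inner_def by (intro Bochner_Integration.integral_cong) auto
  finally show ?thesis ..
qed

lemma integrable_circle_restrict:
  fixes f :: "complex \<Rightarrow> complex"
  assumes "continuous_on (sphere 0 1) f"
  shows "integrable circle_measure (\<lambda>z. if norm z = 1 then f z else 0)"
  by (rule integrable_circle[OF borel_measurable_on_sphere[OF assms]])
    (rule continuous_on_cong[THEN iffD1, rotated 2, OF assms], auto)

lemma nn_integral_circle_square:
  assumes f: "continuous_on (sphere 0 1) f"
  shows "(\<integral>\<^sup>+ z. ennreal ((norm (f z))\<^sup>2) \<partial>circle_measure) = ennreal (Re (circle_inner f f))"
proof -
  have c: "continuous_on (sphere 0 1) (\<lambda>z. f z * cnj (f z))" using f by (intro continuous_intros)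
  have "(\<integral>\<^sup>+ z. ennreal ((norm (f z))\<^sup>2) \<partial>circle_measure) =
     (\<integral>\<^sup>+ z. ennreal (Re (if norm z = 1 then f z * cnj (f z) else 0)) \<partial>circle_measure)"
    by (rule nn_integral_circle_cong) (simp add: complex_norm_square[symmetric])
  also have "\<dots> = ennreal (LINT z|circle_measure. Re (if norm z = 1 then f z * cnj (f z) else 0))"
    using integrable_circle_restrict[OF c] by (intro nn_integral_eq_integral integrable_Re) (auto simp: complex_norm_square[symmetric])
  also have "(LINT z|circle_measure. Re (if norm z = 1 then f z * cnj (f z) else 0)) = Re (circle_inner f f)"
    unfolding circle_inner_def using integrable_circle_restrict[OF c] by (rule integral_Re)
  finally show ?thesis .
qed

lemma circle_pythagoras:
  assumes I: "finite I" and g: "\<And>i. i \<in> I \<Longrightarrow> continuous_on (sphere 0 1) (g i)"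
    and orth: "\<And>i j. i \<in> I \<Longrightarrow> j \<in> I \<Longrightarrow> i \<noteq> j \<Longrightarrow> circle_inner (g i) (g j) = 0"
  shows "(\<integral>\<^sup>+ z. ennreal ((norm (\<Sum>i\<in>I. g i z))\<^sup>2) \<partial>circle_measure) =
    (\<Sum>i\<in>I. \<integral>\<^sup>+ z. ennreal ((norm (g i z))\<^sup>2) \<partial>circle_measure)"
proof -
  have int: "integrable circle_measure (\<lambda>z. if norm z = 1 then g i z * cnj (g j z) else 0)" if "i \<in> I" "j \<in> I" for i j
    using that by (intro integrable_circle_restrict continuous_intros g)
  have "circle_inner (\<lambda>z. \<Sum>i\<in>I. g i z) (\<lambda>z. \<Sum>i\<in>I. g i z) =
      (LINT z|circle_measure. (\<Sum>i\<in>I. \<Sum>j\<in>I. if norm z = 1 then g i z * cnj (g j z) else 0))"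
    unfolding circle_inner_def by (intro Bochner_Integration.integral_cong refl) (auto simp: sum_product)
  also have "\<dots> = (\<Sum>i\<in>I. \<Sum>j\<in>I. circle_inner (g i) (g j))"
    unfolding circle_inner_def using int by simp
  also have "\<dots> = (\<Sum>i\<in>I. \<Sum>j\<in>I. if j = i then circle_inner (g i) (g j) else 0)"
    using orth by (intro sum.cong refl) auto
  also have "\<dots> = (\<Sum>i\<in>I. circle_inner (g i) (g i))" using I by simp
  finally have eq: "circle_inner (\<lambda>z. \<Sum>i\<in>I. g i z) (\<lambda>z. \<Sum>i\<in>I. g i z) = (\<Sum>i\<in>I. circle_inner (g i) (g i))" .
  have nonneg: "0 \<le> Re (circle_inner (g i) (g i))" if "i \<in> I" for i
  proof -
    have "Re (circle_inner (g i) (g i)) = (LINT z|circle_measure. Re (if norm z = 1 then g i z * cnj (g i z) else 0))"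
      unfolding circle_inner_def using int[OF that that] by (rule integral_Re[symmetric])
    also have "0 \<le> \<dots>" by (intro Bochner_Integration.integral_nonneg) (auto simp: complex_norm_square[symmetric])
    finally show ?thesis .
  qed
  have cont: "continuous_on (sphere 0 1) (\<lambda>z. \<Sum>i\<in>I. g i z)" using g by (intro continuous_intros)
  show ?thesis
    unfolding nn_integral_circle_square[OF cont] eq
    using g nonneg by (simp add: nn_integral_circle_square Re_sum)
qed

text \<open>The common factor \<Theta> cancels. A polynomial of degree below D times the conjugate
  of z^D H is, on the circle, the conjugate of a holomorphic function vanishing at 0, whose mean is
  0.\<close>

lemma circle_inner_eq_0:
  fixes c :: "nat \<Rightarrow> complex"
  assumes \<Theta>: "\<And>z. norm z = 1 \<Longrightarrow> norm (\<Theta> z) = 1"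
    and H: "continuous_on (cball 0 1) H" "H holomorphic_on ball 0 1"
  shows "circle_inner (\<lambda>z. \<Theta> z * (\<Sum>n<D. c n * z ^ n)) (\<lambda>z. \<Theta> z * z ^ D * H z) = 0"
proof -
  define \<phi> where "\<phi> z = (\<Sum>n<D. cnj (c n) * z ^ (D - n)) * H z" for z
  have \<phi>: "continuous_on (cball 0 1) \<phi>" "\<phi> holomorphic_on ball 0 1"
    unfolding \<phi>_def by (intro continuous_intros holomorphic_intros H)+
  have cont: "continuous_on (sphere 0 1) \<phi>" using \<phi>(1) by (rule continuous_on_subset) auto
  have eq: "\<Theta> z * (\<Sum>n<D. c n * z ^ n) * cnj (\<Theta> z * z ^ D * H z) = cnj (\<phi> z)" if z: "norm z = 1" for z
  proof -
    have "\<Theta> z * cnj (\<Theta> z) = 1" using \<Theta>[OF z] by (simp add: complex_norm_square[symmetric])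
    moreover have "z ^ n * cnj (z ^ D) = cnj (z ^ (D - n))" if "n < D" for n
    proof -
      have "z ^ D = z ^ n * z ^ (D - n)" using that by (simp add: power_add[symmetric])
      moreover have "z ^ n * cnj (z ^ n) = 1" using z by (simp add: complex_norm_square[symmetric] norm_power del: complex_cnj_power)
      ultimately show ?thesis by (simp only: complex_cnj_mult mult.assoc[symmetric] mult_1_left)
    qed
    then have "(\<Sum>n<D. c n * z ^ n) * cnj (z ^ D) = cnj (\<Sum>n<D. cnj (c n) * z ^ (D - n))"
      unfolding sum_distrib_right cnj_sum
      by (intro sum.cong refl) (simp only: mult.assoc complex_cnj_mult complex_cnj_cnj lessThan_iff)
    ultimately show ?thesis
      unfolding \<phi>_def complex_cnj_mult
      by (metis (no_types, lifting) mult.assoc mult.commute mult_1_left)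
  qed
  have "circle_inner (\<lambda>z. \<Theta> z * (\<Sum>n<D. c n * z ^ n)) (\<lambda>z. \<Theta> z * z ^ D * H z) =
      (LINT z|circle_measure. cnj (if norm z = 1 then \<phi> z else 0))"
    unfolding circle_inner_def
    by (intro Bochner_Integration.integral_cong refl) (auto simp: eq simp del: complex_cnj_mult)
  also have "\<dots> = cnj (LINT z|circle_measure. (if norm z = 1 then \<phi> z else 0))"
    by (rule Bochner_Integration.integral_cnj)
  also have "(LINT z|circle_measure. (if norm z = 1 then \<phi> z else 0)) = \<phi> 0"
    by (rule circle_cauchy[OF \<phi> borel_measurable_on_sphere[OF cont]]) auto
  also have "\<phi> 0 = 0"
    unfolding \<phi>_def by (intro mult_eq_0_iff[THEN iffD2] disjI1 sum.neutral) (auto simp: zero_power)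
  finally show ?thesis by simp
qed

lemma nn_integral_circle_polynomial:
  "(\<integral>\<^sup>+ z. ennreal ((norm (\<Sum>n<M. c n * z ^ n))\<^sup>2) \<partial>circle_measure) = ennreal (\<Sum>n<M. (norm (c n))\<^sup>2)"
proof -
  have lt: "circle_inner (\<lambda>z. c m * z ^ m) (\<lambda>z. c n * z ^ n) = 0" if "m < n" for m n
  proof -
    have "(\<Sum>k<n. (if k = m then c m else 0) * z ^ k) = c m * z ^ m" for z
      using that by (simp add: if_distrib[where f="\<lambda>x. x * _"] cong: if_cong)
    then show ?thesis
      using circle_inner_eq_0[of "\<lambda>_. 1" "\<lambda>_. c n" "\<lambda>k. if k = m then c m else 0" n]
      by (simp add: mult.commute)
  qed
  have orth: "circle_inner (\<lambda>z. c m * z ^ m) (\<lambda>z. c n * z ^ n) = 0" if "m \<noteq> n" for m n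
    using lt[of m n] lt[of n m] circle_inner_commute[of "\<lambda>z. c m * z ^ m" "\<lambda>z. c n * z ^ n"] that
    by (cases "m < n") auto
  have one: "emeasure circle_measure UNIV = 1"
    using prob_space.emeasure_space_1[OF prob_space_circle_measure] by simp
  have "(\<integral>\<^sup>+ z. ennreal ((norm (\<Sum>n<M. c n * z ^ n))\<^sup>2) \<partial>circle_measure) =
      (\<Sum>n<M. \<integral>\<^sup>+ z. ennreal ((norm (c n * z ^ n))\<^sup>2) \<partial>circle_measure)"
    by (rule circle_pythagoras) (auto intro!: continuous_intros orth)
  also have "\<dots> = (\<Sum>n<M. \<integral>\<^sup>+ z. ennreal ((norm (c n))\<^sup>2) * 1 \<partial>circle_measure)"
    by (intro sum.cong refl nn_integral_circle_cong) (simp add: norm_mult norm_power)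
  also have "\<dots> = (\<Sum>n<M. ennreal ((norm (c n))\<^sup>2))"
    by (subst nn_integral_cmult) (auto simp: one)
  also have "\<dots> = ennreal (\<Sum>n<M. (norm (c n))\<^sup>2)" by (intro sum_ennreal) auto
  finally show ?thesis .
qed

section \<open>Squared Szego kernels\<close>

text \<open>The squared modulus of the Szego kernel at \<open>a\<close>, normalized to have the
  value 1 at \<open>a\<close>. On the circle it is 1 - |a|^2 times the Poisson kernel.\<close>

definition kernel_sq :: "complex \<Rightarrow> complex \<Rightarrow> real" where
  "kernel_sq a z = ((1 - (norm a)\<^sup>2) / norm (1 - cnj a * z))\<^sup>2"

lemma measurable_kernel_sq [measurable]: "kernel_sq a \<in> borel_measurable borel"
  unfolding kernel_sq_def by measurable

lemma kernel_sq_nonneg: "kernel_sq a z \<ge> 0"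
  by (simp add: kernel_sq_def)

lemma nn_integral_kernel_sq_le:
  assumes a: "norm a < 1" and r: "0 \<le> r" "r \<le> 1"
  shows "(\<integral>\<^sup>+ z. ennreal (kernel_sq a (of_real r * z)) \<partial>circle_measure) \<le> ennreal (1 - (norm a)\<^sup>2)"
proof -
  define b where "b = of_real r * a"
  have nb: "norm b \<le> norm a" using r a mult_left_le_one_le[of "norm a" r] by (simp add: b_def norm_mult)
  then have b: "norm b < 1" using a by simp
  have a2: "1 - (norm a)\<^sup>2 > 0" using a by (simp add: abs_square_less_1)
  have b2: "1 - (norm a)\<^sup>2 \<le> 1 - (norm b)\<^sup>2" using nb by (simp add: power_mono)
  have "(\<integral>\<^sup>+ z. ennreal (kernel_sq a (of_real r * z)) \<partial>circle_measure) \<le>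
      (\<integral>\<^sup>+ z. ennreal (1 - (norm a)\<^sup>2) * ennreal (poisson b z) \<partial>circle_measure)"
  proof (rule nn_integral_mono)
    fix z
    have "kernel_sq a (of_real r * z) = (1 - (norm a)\<^sup>2) * ((1 - (norm a)\<^sup>2) / (norm (1 - cnj b * z))\<^sup>2)"
      by (simp add: kernel_sq_def b_def power2_eq_square mult_ac)
    also have "\<dots> \<le> (1 - (norm a)\<^sup>2) * poisson b z"
      unfolding poisson_def using a2 b2 by (intro mult_left_mono divide_right_mono) auto
    finally show "ennreal (kernel_sq a (of_real r * z)) \<le> ennreal (1 - (norm a)\<^sup>2) * ennreal (poisson b z)"
      using a2 poisson_nonneg[OF b] by (simp add: ennreal_mult[symmetric] ennreal_leI)
  qed
  also have "\<dots> = ennreal (1 - (norm a)\<^sup>2)"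
    by (subst nn_integral_cmult) (auto simp: nn_integral_poisson[OF b])
  finally show ?thesis .
qed

subsection \<open>Roots of unity grids in the first variable\<close>

lemma prod_ge_one_minus_sum:
  fixes x :: "'a \<Rightarrow> real"
  assumes "finite A" "\<And>i. i \<in> A \<Longrightarrow> 0 \<le> x i" "\<And>i. i \<in> A \<Longrightarrow> x i \<le> 1"
  shows "1 - (\<Sum>i\<in>A. 1 - x i) \<le> (\<Prod>i\<in>A. x i)"
  using assms
proof (induction A rule: finite_induct)
  case (insert a A)
  have P: "(\<Prod>i\<in>A. x i) \<le> 1" "0 \<le> (\<Prod>i\<in>A. x i)" using insert.prems by (auto intro!: prod_le_1 prod_nonneg)
  have "(\<Prod>i\<in>A. x i) - (1 - x a) \<le> (\<Prod>i\<in>A. x i) - (1 - x a) * (\<Prod>i\<in>A. x i)"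
    using P insert.prems(2)[of a] mult_left_mono[OF P(1), of "1 - x a"] by simp
  moreover have "1 - (\<Sum>i\<in>A. 1 - x i) \<le> (\<Prod>i\<in>A. x i)" by (rule insert.IH) (use insert.prems in auto)
  ultimately show ?case using insert.hyps by (simp add: algebra_simps)
qed simp

lemma sum_geometric_le:
  assumes "finite A" "\<And>m. m \<in> A \<Longrightarrow> m < (i::nat)"
  shows "(\<Sum>m\<in>A. 8 * (100 ^ m / 100 ^ i :: real)) \<le> 1 / 2"
proof -
  have "(\<Sum>m<i. 8 * (100 ^ m / 100 ^ i :: real)) \<le> 8 / 99"
  proof -
    have "(\<Sum>m<i. 8 * (100 ^ m / 100 ^ i :: real)) = 8 / 100 ^ i * (\<Sum>m<i. 100 ^ m)"
      by (simp add: sum_distrib_left)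
    also have "(\<Sum>m<i. 100 ^ m :: real) = (100 ^ i - 1) / 99" by (subst geometric_sum) auto
    finally have eq: "(\<Sum>m<i. 8 * (100 ^ m / 100 ^ i :: real)) = 8 / 100 ^ i * ((100 ^ i - 1) / 99)" .
    show ?thesis unfolding eq by (simp add: field_simps)
  qed
  moreover have "(\<Sum>m\<in>A. 8 * (100 ^ m / 100 ^ i :: real)) \<le> (\<Sum>m<i. 8 * (100 ^ m / 100 ^ i))"
    using assms by (intro sum_mono2) auto
  ultimately show ?thesis by simp
qed

text \<open>The automorphism of the disc that vanishes at 1/2, the value taken on block m by
  z^(100^m) and by exp (- cayley w / 100^m).\<close>

definition blaschke :: "complex \<Rightarrow> complex" where
  "blaschke \<xi> = (2 * \<xi> - 1) / (2 - \<xi>)"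

lemma blaschke_denom:
  fixes \<xi> :: complex
  assumes "norm \<xi> \<le> 1" shows "1 \<le> norm (2 - \<xi>)" "2 - \<xi> \<noteq> 0"
  using norm_triangle_ineq2[of 2 \<xi>] assms by auto

lemma norm_blaschke_square:
  assumes "norm \<xi> \<le> 1"
  shows "1 - (norm (blaschke \<xi>))\<^sup>2 = 3 * (1 - (norm \<xi>)\<^sup>2) / (norm (2 - \<xi>))\<^sup>2"
proof -
  have "(norm (2 - \<xi>))\<^sup>2 - (norm (2 * \<xi> - 1))\<^sup>2 = 3 * (1 - (norm \<xi>)\<^sup>2)"
    unfolding cmod_power2 by (simp add: power2_eq_square algebra_simps)
  moreover have "norm (2 - \<xi>) \<noteq> 0" using blaschke_denom[OF assms] by auto
  ultimately show ?thesis
    unfolding blaschke_def norm_divide power_divide by (simp add: field_simps)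
qed

lemma norm_blaschke_le_1:
  assumes "norm \<xi> \<le> 1" shows "norm (blaschke \<xi>) \<le> 1"
proof -
  have "0 \<le> 3 * (1 - (norm \<xi>)\<^sup>2) / (norm (2 - \<xi>))\<^sup>2" using assms by (simp add: abs_square_le_1)
  then have "(norm (blaschke \<xi>))\<^sup>2 \<le> 1" using norm_blaschke_square[OF assms] by simp
  then show ?thesis by (simp add: abs_square_le_1)
qed

lemma norm_blaschke_eq_1: "norm \<xi> = 1 \<Longrightarrow> norm (blaschke \<xi>) = 1"
  using norm_blaschke_square[of \<xi>] by (simp add: power2_eq_1_iff)  (smt (verit) norm_ge_zero)

lemma norm_blaschke_ge:
  assumes "norm \<xi> \<le> 1" shows "1 - 6 * (1 - norm \<xi>) \<le> norm (blaschke \<xi>)"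
proof -
  have "3 * (1 - (norm \<xi>)\<^sup>2) / (norm (2 - \<xi>))\<^sup>2 \<le> 3 * (1 - (norm \<xi>)\<^sup>2) / 1"
    using assms blaschke_denom[OF assms] by (intro divide_left_mono) (auto simp: abs_square_le_1)
  also have "\<dots> \<le> 6 * (1 - norm \<xi>)"
  proof -
    have "1 - (norm \<xi>)\<^sup>2 = (1 - norm \<xi>) * (1 + norm \<xi>)" by (simp add: power2_eq_square algebra_simps)
    also have "\<dots> \<le> (1 - norm \<xi>) * 2" using assms by (intro mult_left_mono) auto
    finally show ?thesis by simp
  qed
  finally have "1 - 6 * (1 - norm \<xi>) \<le> (norm (blaschke \<xi>))\<^sup>2" using norm_blaschke_square[OF assms] by simp
  also have "\<dots> \<le> norm (blaschke \<xi>)"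
    using norm_blaschke_le_1[OF assms] mult_left_le[of "norm (blaschke \<xi>)" "norm (blaschke \<xi>)"]
    by (simp add: power2_eq_square)
  finally show ?thesis .
qed

lemma blaschke_half: "blaschke (1 / 2) = 0"
  by (simp add: blaschke_def)

lemma blaschke_holomorphic: "f holomorphic_on A \<Longrightarrow> (\<And>z. z \<in> A \<Longrightarrow> norm (f z) \<le> 1) \<Longrightarrow> (\<lambda>z. blaschke (f z)) holomorphic_on A"
  unfolding blaschke_def using blaschke_denom(2) by (intro holomorphic_intros) auto

lemma blaschke_continuous: "continuous_on A f \<Longrightarrow> (\<And>z. z \<in> A \<Longrightarrow> norm (f z) \<le> 1) \<Longrightarrow> continuous_on A (\<lambda>z. blaschke (f z))"
  unfolding blaschke_def using blaschke_denom(2) by (intro continuous_intros) auto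

section \<open>Grid points and their Lagrange polynomials\<close>

definition grid_radius :: "nat \<Rightarrow> real" where
  "grid_radius i = 2 powr (- 1 / 100 ^ i)"

definition grid_point :: "nat \<Rightarrow> nat \<Rightarrow> complex" where
  "grid_point i j = of_real (grid_radius i) * cis (2 * pi * real j / 100 ^ i)"

lemma grid_radius_pos: "0 < grid_radius i"
  by (simp add: grid_radius_def)

lemma grid_radius_power: "grid_radius i ^ n = 2 powr (- real n / 100 ^ i)"
  by (simp add: grid_radius_def powr_power)

lemma grid_radius_less_1: "grid_radius i < 1"
  unfolding grid_radius_def by (rule powr_less_one) auto

lemma norm_grid_point: "norm (grid_point i j) = grid_radius i"
  using grid_radius_pos[of i] by (simp add: grid_point_def norm_mult)

lemma grid_point_nonzero: "grid_point i j \<noteq> 0"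
  using norm_grid_point[of i j] grid_radius_pos[of i] by auto

lemma grid_point_power: "grid_point i j ^ (100 ^ i) = 1 / 2"
proof -
  have "grid_point i j ^ (100 ^ i) = of_real (grid_radius i ^ (100 ^ i)) * cis (2 * pi * real j)"
    by (simp add: grid_point_def power_mult_distrib Complex.DeMoivre)
  also have "grid_radius i ^ (100 ^ i) = 1 / 2"
    by (simp add: grid_radius_power powr_minus_divide)
  also have "cis (2 * pi * real j) = 1"
    using cis_multiple_2pi[of "real j"] by simp
  finally show ?thesis by simp
qed

lemma two_powr_minus_ge:
  assumes "0 \<le> (y::real)" shows "1 - y \<le> 2 powr (- y)"
proof -
  have "1 - y \<le> 1 - y * ln 2" using assms ln_2_less_1 mult_left_mono[of "ln 2" 1 y] by simp
  also have "\<dots> \<le> exp (- (y * ln 2))" using exp_ge_add_one_self[of "- (y * ln 2)"] by simp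
  also have "\<dots> = 2 powr (- y)" by (simp add: powr_def)
  finally show ?thesis .
qed

text \<open>The spacing 1 / 100^i of a grid is at most a multiple of its distance from the circle.
  This turns integrals of Lagrange polynomials into weights and bounds the total weight of a grid
  from below.\<close>

lemma one_minus_grid_radius_square: "1 / 100 ^ i \<le> 2 * (1 - (grid_radius i)\<^sup>2)"
proof -
  define M :: real where "M = 100 ^ i"
  have M: "M \<ge> 1" by (simp add: M_def)
  define x where "x = 2 * ln 2 / M"
  have "1 \<le> 2 * ln (2::real)" using ln2_ge_two_thirds by simp
  then have "1 / M \<le> x" using M by (simp add: x_def divide_right_mono)
  then have x: "1 / M \<le> x" "0 < x" using M by (auto intro: less_le_trans[of 0 "1 / M"])
  have "(grid_radius i)\<^sup>2 = exp (- x)"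
    unfolding grid_radius_power by (simp add: powr_def x_def M_def)
  also have "\<dots> \<le> 1 / (1 + x)"
    using x exp_ge_add_one_self[of x] by (simp add: exp_minus inverse_eq_divide frac_le)
  also have "\<dots> \<le> 1 / (1 + 1 / M)" 
  proof (rule frac_le)
    show "0 < 1 + 1 / M" using M by (simp add: add_pos_nonneg)
  qed (use x in auto)
  also have "\<dots> \<le> 1 - 1 / (2 * M)" using M by (simp add: field_simps)
  finally show ?thesis by (simp add: M_def)
qed

text \<open>A geometric sum: the Lagrange polynomial, of degree below 100^i, for the 100^i-th roots
  of 1/2.\<close>

definition grid_lagrange :: "nat \<Rightarrow> nat \<Rightarrow> complex \<Rightarrow> complex" where
  "grid_lagrange i j z = (\<Sum>n<100 ^ i. (z / grid_point i j) ^ n) / 100 ^ i"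

lemma grid_lagrange_grid_point:
  assumes "j < 100 ^ i" "j' < 100 ^ i"
  shows "grid_lagrange i j (grid_point i j') = (if j = j' then 1 else 0)"
proof (cases "j = j'")
  case True
  then show ?thesis using grid_point_nonzero[of i j'] by (simp add: grid_lagrange_def)
next
  case False
  have "grid_point i j' / grid_point i j = cis (2 * pi * of_int (int j' - int j) / real (100 ^ i))"
  proof -
    have "grid_point i j' / grid_point i j = cis (2 * pi * real j' / 100 ^ i) / cis (2 * pi * real j / 100 ^ i)"
      using grid_radius_pos[of i] by (simp add: grid_point_def)
    also have "\<dots> = cis (2 * pi * real j' / 100 ^ i - 2 * pi * real j / 100 ^ i)"
      by (rule cis_divide)
    finally show ?thesis by (simp add: diff_divide_distrib right_diff_distrib)
  qed
  then have "(grid_point i j' / grid_point i j) ^ n = cis (2 * pi * real n * of_int (int j' - int j) / real (100 ^ i))" for n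
    by (simp only: Complex.DeMoivre) (simp add: mult_ac)
  then have "(\<Sum>n<100 ^ i. (grid_point i j' / grid_point i j) ^ n) = 0"
  proof -
    have "int j < int (100 ^ i)" "int j' < int (100 ^ i)"
      using assms by (simp_all only: of_nat_less_iff)
    then have "\<bar>int j' - int j\<bar> < int (100 ^ i)" by linarith
    from sum_cis_eq_0[OF this] show ?thesis
      using False \<open>\<And>n. (grid_point i j' / grid_point i j) ^ n = _\<close> by simp
  qed
  then show ?thesis using False by (simp add: grid_lagrange_def)
qed

lemma inverse_grid_radius_power_le:
  assumes "n \<le> 100 ^ i" shows "(1 / grid_radius i) ^ n \<le> 2"
proof -
  have "real n \<le> real (100 ^ i)" using assms of_nat_le_iff by blast
  then have "(2::real) powr (real n / 100 ^ i) \<le> 2 powr 1" by (intro powr_mono) auto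
  then show ?thesis by (simp add: power_divide grid_radius_power powr_minus_divide)
qed

lemma grid_lagrange_dft:
  "grid_lagrange i j z = (\<Sum>n<100 ^ i. cis (- (2 * pi * real j * real n / real (100 ^ i))) * ((z / grid_radius i) ^ n / 100 ^ i))"
proof -
  have inv: "1 / grid_point i j = (1 / grid_radius i) * cis (- (2 * pi * real j / 100 ^ i))"
    by (simp add: grid_point_def cis_inverse[symmetric] field_simps)
  have "z / grid_point i j = z * (1 / grid_point i j)" by simp
  also have "\<dots> = (z / grid_radius i) * cis (- (2 * pi * real j / 100 ^ i))"
    unfolding inv by simp
  finally have eq: "z / grid_point i j = (z / grid_radius i) * cis (- (2 * pi * real j / 100 ^ i))" .
  have "(z / grid_point i j) ^ n = cis (- (2 * pi * real j * real n / real (100 ^ i))) * (z / grid_radius i) ^ n" for n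
    unfolding eq power_mult_distrib Complex.DeMoivre by (simp add: mult_ac)
  then show ?thesis unfolding grid_lagrange_def sum_divide_distrib by simp
qed

text \<open>As functions of j the Lagrange values are a discrete Fourier transform of M = 100^i
  numbers of modulus at most 2 / M; Parseval gives M * M * (2 / M)^2 = 4.\<close>

lemma sum_grid_lagrange_le:
  assumes "norm z \<le> 1"
  shows "(\<Sum>j<100 ^ i. (norm (grid_lagrange i j z))\<^sup>2) \<le> 4"
proof -
  define M where "M = (100::nat) ^ i"
  have M: "M > 0" by (simp add: M_def)
  have "norm ((z / grid_radius i) ^ n / 100 ^ i) \<le> 2 / M" if "n < M" for n
  proof -
    have "norm ((z / grid_radius i) ^ n / 100 ^ i) = norm z ^ n * (1 / grid_radius i) ^ n / M"
      using grid_radius_pos[of i] by (simp add: norm_divide norm_mult norm_power power_divide M_def)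
    also have "\<dots> \<le> 1 * 2 / M"
      using assms that inverse_grid_radius_power_le[of n i] grid_radius_pos[of i]
      by (intro divide_right_mono mult_mono power_le_one) (auto simp: M_def)
    finally show ?thesis by simp
  qed
  then have "(\<Sum>n<M. (norm ((z / grid_radius i) ^ n / 100 ^ i))\<^sup>2) \<le> (\<Sum>n<M. (2 / M)\<^sup>2)"
    by (intro sum_mono power_mono) auto
  also have "\<dots> = 4 / M" using M by (simp add: power2_eq_square field_simps)
  finally have "M * (\<Sum>n<M. (norm ((z / grid_radius i) ^ n / 100 ^ i))\<^sup>2) \<le> M * (4 / M)"
    by (intro mult_left_mono) auto
  then show ?thesis
    using dft_parseval[of M "\<lambda>n. (z / grid_radius i) ^ n / 100 ^ i"] M
    unfolding grid_lagrange_dft M_def by simp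
qed

lemma nn_integral_grid_lagrange_le:
  assumes "0 \<le> r" "r \<le> 1"
  shows "(\<integral>\<^sup>+ z. ennreal ((norm (grid_lagrange i j (of_real r * z)))\<^sup>2) \<partial>circle_measure) \<le> ennreal (4 / 100 ^ i)"
proof -
  define M where "M = (100::nat) ^ i"
  have M: "M > 0" by (simp add: M_def)
  define c where "c n = (of_real r / grid_point i j) ^ n / 100 ^ i" for n
  have "grid_lagrange i j (of_real r * z) = (\<Sum>n<M. c n * z ^ n)" for z
    by (simp add: grid_lagrange_def c_def M_def sum_divide_distrib power_divide power_mult_distrib mult_ac)
  then have "(\<integral>\<^sup>+ z. ennreal ((norm (grid_lagrange i j (of_real r * z)))\<^sup>2) \<partial>circle_measure) = ennreal (\<Sum>n<M. (norm (c n))\<^sup>2)"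
    by (simp only: nn_integral_circle_polynomial)
  also have "(\<Sum>n<M. (norm (c n))\<^sup>2) \<le> (\<Sum>n<M. (2 / M)\<^sup>2)"
  proof (intro sum_mono power_mono)
    fix n assume "n \<in> {..<M}"
    have "norm (c n) = r ^ n * (1 / grid_radius i) ^ n / M"
      using assms by (simp add: c_def norm_divide norm_mult norm_power power_divide norm_grid_point M_def)
    also have "\<dots> \<le> 1 * 2 / M"
      using assms \<open>n \<in> {..<M}\<close> inverse_grid_radius_power_le[of n i] grid_radius_pos[of i]
      by (intro divide_right_mono mult_mono power_le_one) (auto simp: M_def)
    finally show "norm (c n) \<le> 2 / M" by simp
  qed auto
  then have "ennreal (\<Sum>n<M. (norm (c n))\<^sup>2) \<le> ennreal (\<Sum>n<M. (2 / M)\<^sup>2)" by (rule ennreal_leI)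
  also have "(\<Sum>n<M. (2 / M)\<^sup>2) = 4 / M" using M by (simp add: power2_eq_square field_simps)
  finally show ?thesis by (simp add: M_def)
qed

text \<open>This degree bound dictates the power of z in \<open>inner_factor\<close>: a squared
  Lagrange polynomial of block i must be orthogonal to multiples of z^(2 * 100^i).\<close>

lemma grid_lagrange_square_polynomial:
  "\<exists>c. \<forall>z. (grid_lagrange i j z)\<^sup>2 = (\<Sum>n<2 * 100 ^ i. c n * z ^ n)"
proof -
  define M where "M = (100::nat) ^ i"
  define d where "d n = (1 / grid_point i j) ^ n / 100 ^ i" for n
  have l: "grid_lagrange i j z = (\<Sum>n<M. d n * z ^ n)" for z
    by (simp add: grid_lagrange_def d_def M_def sum_divide_distrib power_divide mult_ac)
  define c where "c n = (\<Sum>k\<in>{k. k < M \<and> k \<le> n \<and> n - k < M}. d k * d (n - k))" for n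
  have "(grid_lagrange i j z)\<^sup>2 = (\<Sum>n<2 * M. c n * z ^ n)" for z
  proof -
    have "(grid_lagrange i j z)\<^sup>2 = (\<Sum>(k,l)\<in>{..<M} \<times> {..<M}. d k * d l * z ^ (k + l))"
      unfolding l power2_eq_square sum_product sum.cartesian_product
      by (intro sum.cong refl) (auto simp: power_add mult_ac)
    also have "\<dots> = (\<Sum>n<2 * M. \<Sum>(k,l)\<in>{x \<in> {..<M} \<times> {..<M}. fst x + snd x = n}. d k * d l * z ^ (k + l))"
      by (rule sum.group[symmetric]) auto
    also have "\<dots> = (\<Sum>n<2 * M. c n * z ^ n)"
    proof (rule sum.cong[OF refl])
      fix n
      have "(\<Sum>(k,l)\<in>{x \<in> {..<M} \<times> {..<M}. fst x + snd x = n}. d k * d l * z ^ (k + l)) =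
          (\<Sum>k\<in>{k. k < M \<and> k \<le> n \<and> n - k < M}. d k * d (n - k) * z ^ n)"
        by (rule sum.reindex_bij_witness[where i="\<lambda>k. (k, n - k)" and j=fst]) auto
      then show "(\<Sum>(k,l)\<in>{x \<in> {..<M} \<times> {..<M}. fst x + snd x = n}. d k * d l * z ^ (k + l)) = c n * z ^ n"
        by (simp add: c_def sum_distrib_right)
    qed
    finally show ?thesis .
  qed
  then show ?thesis unfolding M_def by blast
qed

section \<open>Inner functions vanishing on the earlier blocks\<close>

definition inner_factor :: "nat \<Rightarrow> complex \<Rightarrow> complex" where
  "inner_factor m z = z ^ (2 * 100 ^ m) * blaschke (z ^ (100 ^ m))"

definition inner_prod :: "nat \<Rightarrow> complex \<Rightarrow> complex" where
  "inner_prod i z = (\<Prod>m<i. inner_factor m z)"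

lemma norm_inner_factor_le_1:
  assumes "norm z \<le> 1" shows "norm (inner_factor m z) \<le> 1"
  unfolding inner_factor_def norm_mult norm_power
  using assms norm_blaschke_le_1[of "z ^ (100 ^ m)"]
  by (intro mult_le_one) (auto simp: power_le_one norm_power)

lemma norm_inner_factor_eq_1: "norm z = 1 \<Longrightarrow> norm (inner_factor m z) = 1"
  using norm_blaschke_eq_1[of "z ^ (100 ^ m)"] by (simp add: inner_factor_def norm_mult norm_power)

lemma norm_inner_prod_le_1: "norm z \<le> 1 \<Longrightarrow> norm (inner_prod i z) \<le> 1"
  unfolding inner_prod_def prod_norm[symmetric] by (intro prod_le_1) (auto intro: norm_inner_factor_le_1)

lemma norm_inner_prod_eq_1: "norm z = 1 \<Longrightarrow> norm (inner_prod i z) = 1"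
  unfolding inner_prod_def prod_norm[symmetric] by (simp add: norm_inner_factor_eq_1)

lemma inner_factor_holomorphic: "inner_factor m holomorphic_on ball 0 1"
  unfolding inner_factor_def
  by (intro holomorphic_intros blaschke_holomorphic) (auto simp: norm_power power_le_one)

lemma inner_factor_continuous: "continuous_on (cball 0 1) (inner_factor m)"
  unfolding inner_factor_def
  by (intro continuous_intros blaschke_continuous) (auto simp: norm_power power_le_one)

lemma inner_prod_holomorphic: "inner_prod i holomorphic_on ball 0 1"
  unfolding inner_prod_def by (intro holomorphic_intros inner_factor_holomorphic)

lemma inner_prod_continuous: "continuous_on (cball 0 1) (inner_prod i)"
  unfolding inner_prod_def by (intro continuous_intros inner_factor_continuous)

lemma inner_prod_grid_point_eq_0:
  assumes "m < i" shows "inner_prod i (grid_point m j) = 0"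
proof -
  have "inner_factor m (grid_point m j) = 0"
    by (simp add: inner_factor_def grid_point_power blaschke_half)
  then show ?thesis unfolding inner_prod_def using assms by (intro prod_zero) auto
qed

text \<open>Put \<xi> = z^(100^m) at a point of block i > m. Its modulus is 1 up to q = 100^m /
  100^i; the factor \<xi>^2 loses at most 2 q and the Blaschke factor at most 6 q, and the sum of
  all these losses stays below 1/2.\<close>

lemma norm_inner_prod_grid_point_ge: "1 / 2 \<le> norm (inner_prod i (grid_point i j))"
proof -
  have z: "norm (grid_point i j) \<le> 1" using grid_radius_less_1[of i] by (simp add: norm_grid_point)
  have "1 - norm (inner_factor m (grid_point i j)) \<le> 8 * (100 ^ m / 100 ^ i)" if "m < i" for m
  proof -
    define \<xi> where "\<xi> = grid_point i j ^ (100 ^ m)"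
    have n: "norm \<xi> \<le> 1" using z by (simp add: \<xi>_def norm_power power_le_one)
    have "1 - 100 ^ m / 100 ^ i \<le> norm \<xi>"
      using two_powr_minus_ge[of "100 ^ m / 100 ^ i :: real"]
      by (simp add: \<xi>_def norm_power norm_grid_point grid_radius_power)
    then have l: "1 - norm \<xi> \<le> 100 ^ m / 100 ^ i" by simp
    have "inner_factor m (grid_point i j) = \<xi>\<^sup>2 * blaschke \<xi>"
      by (simp add: inner_factor_def \<xi>_def power_mult[symmetric] mult.commute)
    then have eq: "norm (inner_factor m (grid_point i j)) = norm \<xi> * (norm \<xi> * norm (blaschke \<xi>))"
      by (simp add: norm_mult norm_power power2_eq_square)
    have three: "1 - ((1 - a) + (1 - b) + (1 - c)) \<le> a * (b * c)"
      if "0 \<le> a" "a \<le> 1" "0 \<le> b" "b \<le> 1" "0 \<le> c" "c \<le> 1" for a b c :: real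
    proof -
      have bc: "b * c \<le> 1" using that by (simp add: mult_le_one)
      have "0 \<le> (1 - a) * (1 - b * c)" "0 \<le> (1 - b) * (1 - c)" using that bc by auto
      then show ?thesis by (simp add: algebra_simps)
    qed
    have "1 - ((1 - norm \<xi>) + (1 - norm \<xi>) + (1 - norm (blaschke \<xi>))) \<le> norm (inner_factor m (grid_point i j))"
      unfolding eq by (rule three) (use n norm_blaschke_le_1[OF n] in auto)
    then have "1 - norm (inner_factor m (grid_point i j)) \<le> 2 * (1 - norm \<xi>) + (1 - norm (blaschke \<xi>))"
      by (simp add: algebra_simps)
    also have "\<dots> \<le> 2 * (1 - norm \<xi>) + 6 * (1 - norm \<xi>)"
      using norm_blaschke_ge[OF n] by simp
    also have "\<dots> = 8 * (1 - norm \<xi>)" by simp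
    also have "\<dots> \<le> 8 * (100 ^ m / 100 ^ i)" using l by (rule mult_left_mono) simp
    finally show ?thesis .
  qed
  then have "(\<Sum>m<i. 1 - norm (inner_factor m (grid_point i j))) \<le> (\<Sum>m<i. 8 * (100 ^ m / 100 ^ i))"
    by (intro sum_mono) auto
  also have "\<dots> \<le> 1 / 2" by (rule sum_geometric_le) auto
  finally have "1 / 2 \<le> 1 - (\<Sum>m<i. 1 - norm (inner_factor m (grid_point i j)))" by simp
  also have "\<dots> \<le> (\<Prod>m<i. norm (inner_factor m (grid_point i j)))"
    by (rule prod_ge_one_minus_sum) (auto intro: norm_inner_factor_le_1 z)
  finally show ?thesis by (simp add: inner_prod_def prod_norm)
qed

text \<open>Brings the later product into the shape that \<open>circle_inner_eq_0\<close> needs: the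
  common unimodular part, the power of z that exceeds the degree of block i, and a holomorphic
  rest.\<close>

lemma inner_prod_split:
  assumes "i < i'"
  shows "inner_prod i' z = inner_prod i z * z ^ (2 * 100 ^ i) * (blaschke (z ^ (100 ^ i)) * (\<Prod>m\<in>{Suc i..<i'}. inner_factor m z))"
proof -
  have "inner_prod i' z = inner_prod i z * (\<Prod>m\<in>{i..<i'}. inner_factor m z)"
    unfolding inner_prod_def lessThan_atLeast0
    using assms by (intro prod.atLeastLessThan_concat[symmetric]) auto
  also have "(\<Prod>m\<in>{i..<i'}. inner_factor m z) = inner_factor i z * (\<Prod>m\<in>{Suc i..<i'}. inner_factor m z)"
    by (rule prod.atLeast_Suc_lessThan[OF assms])
  finally have "inner_prod i' z = inner_prod i z * (inner_factor i z * (\<Prod>m\<in>{Suc i..<i'}. inner_factor m z))" .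
  then show ?thesis by (simp add: inner_factor_def mult_ac)
qed

lemma circle_inner_grid_blocks:
  assumes "i < i'"
  shows "circle_inner (\<lambda>z. inner_prod i z * (\<Sum>x\<in>X. c x * (grid_lagrange i (f x) z)\<^sup>2))
     (\<lambda>z. inner_prod i' z * (\<Sum>y\<in>Y. c' y * (grid_lagrange i' (f' y) z)\<^sup>2)) = 0"
proof -
  obtain d where d: "\<And>j z. (grid_lagrange i j z)\<^sup>2 = (\<Sum>n<2 * 100 ^ i. d j n * z ^ n)"
    using grid_lagrange_square_polynomial[of i] by metis
  have 1: "(\<Sum>x\<in>X. c x * (grid_lagrange i (f x) z)\<^sup>2) = (\<Sum>n<2 * 100 ^ i. (\<Sum>x\<in>X. c x * d (f x) n) * z ^ n)" for z
    unfolding d sum_distrib_left sum_distrib_right by (subst sum.swap) (simp add: mult.assoc)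
  define H where "H z = blaschke (z ^ (100 ^ i)) * (\<Prod>m\<in>{Suc i..<i'}. inner_factor m z) * (\<Sum>y\<in>Y. c' y * (grid_lagrange i' (f' y) z)\<^sup>2)" for z
  have H: "continuous_on (cball 0 1) H" "H holomorphic_on ball 0 1"
    unfolding H_def grid_lagrange_def
    by (intro continuous_intros holomorphic_intros blaschke_continuous blaschke_holomorphic inner_factor_continuous
        inner_factor_holomorphic; simp add: norm_power power_le_one grid_point_nonzero)+
  have 2: "inner_prod i' z * (\<Sum>y\<in>Y. c' y * (grid_lagrange i' (f' y) z)\<^sup>2) = inner_prod i z * z ^ (2 * 100 ^ i) * H z" for z
    unfolding inner_prod_split[OF assms] H_def by (simp add: mult_ac)
  show ?thesis unfolding 1 2 by (rule circle_inner_eq_0[OF norm_inner_prod_eq_1 H])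
qed

subsection \<open>Horocycles in the second variable\<close>

definition cayley :: "complex \<Rightarrow> complex" where
  "cayley w = (1 + w) / (1 - w)"

definition inv_cayley :: "complex \<Rightarrow> complex" where
  "inv_cayley \<zeta> = (\<zeta> - 1) / (\<zeta> + 1)"

lemma cayley_Re_pos:
  assumes "norm w < 1" shows "0 < Re (cayley w)"
proof -
  have ne: "1 - w \<noteq> 0" using assms by auto
  have "cayley w = (1 + w) * cnj (1 - w) / ((1 - w) * cnj (1 - w))"
    using ne by (simp add: cayley_def)
  also have "(1 - w) * cnj (1 - w) = of_real ((norm (1 - w))\<^sup>2)" by (rule complex_norm_square[symmetric])
  finally have "Re (cayley w) = Re ((1 + w) * cnj (1 - w)) / (norm (1 - w))\<^sup>2"
    by (simp only: Re_divide_of_real)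
  also have "Re ((1 + w) * cnj (1 - w)) = 1 - (norm w)\<^sup>2"
    unfolding cmod_power2 by (simp add: power2_eq_square algebra_simps)
  finally show ?thesis using assms ne by (simp add: abs_square_less_1)
qed

lemma cayley_holomorphic: "cayley holomorphic_on ball 0 1"
  unfolding cayley_def by (intro holomorphic_intros) auto

lemma plus_one_nonzero: "0 < Re \<zeta> \<Longrightarrow> \<zeta> + 1 \<noteq> 0"
  by (auto simp: complex_eq_iff)

lemma cayley_inv_cayley:
  assumes "0 < Re \<zeta>" shows "cayley (inv_cayley \<zeta>) = \<zeta>"
proof -
  have "1 + inv_cayley \<zeta> = 2 * \<zeta> / (\<zeta> + 1)" "1 - inv_cayley \<zeta> = 2 / (\<zeta> + 1)"
    using plus_one_nonzero[OF assms] by (simp_all add: inv_cayley_def field_simps)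
  then show ?thesis using plus_one_nonzero[OF assms] by (simp add: cayley_def)
qed

lemma inv_cayley_cayley:
  assumes "norm w < 1" shows "inv_cayley (cayley w) = w"
proof -
  have ne: "1 - w \<noteq> 0" using assms by auto
  then have "cayley w - 1 = 2 * w / (1 - w)" "cayley w + 1 = 2 / (1 - w)"
    by (simp_all add: cayley_def field_simps)
  then show ?thesis using ne by (simp add: inv_cayley_def)
qed

lemma one_minus_norm_inv_cayley:
  assumes "0 < Re \<zeta>"
  shows "1 - (norm (inv_cayley \<zeta>))\<^sup>2 = 4 * Re \<zeta> / (norm (\<zeta> + 1))\<^sup>2"
proof -
  have "(norm (\<zeta> + 1))\<^sup>2 - (norm (\<zeta> - 1))\<^sup>2 = 4 * Re \<zeta>"
    unfolding cmod_power2 by (simp add: power2_eq_square algebra_simps)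
  moreover have "1 - (norm (inv_cayley \<zeta>))\<^sup>2 = ((norm (\<zeta> + 1))\<^sup>2 - (norm (\<zeta> - 1))\<^sup>2) / (norm (\<zeta> + 1))\<^sup>2"
    unfolding inv_cayley_def norm_divide power_divide
    using plus_one_nonzero[OF assms] by (simp add: diff_divide_distrib)
  ultimately show ?thesis by simp
qed

lemma norm_inv_cayley_less_1:
  assumes "0 < Re \<zeta>" shows "norm (inv_cayley \<zeta>) < 1"
proof -
  have "0 < 4 * Re \<zeta> / (norm (\<zeta> + 1))\<^sup>2" using assms plus_one_nonzero[OF assms] by simp
  then show ?thesis unfolding one_minus_norm_inv_cayley[OF assms, symmetric] by (simp add: abs_square_less_1)
qed

text \<open>The kernel in half-plane coordinates, where the points of a block are equally spaced on
  a vertical line.\<close>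

lemma kernel_sq_cayley:
  assumes a: "0 < Re a" and w: "norm w < 1"
  defines "\<zeta> \<equiv> cayley w"
  shows "kernel_sq (inv_cayley a) w = (2 * Re a * norm (\<zeta> + 1) / (norm (a + 1) * norm (\<zeta> + cnj a)))\<^sup>2"
proof -
  have z: "0 < Re \<zeta>" unfolding \<zeta>_def by (rule cayley_Re_pos[OF w])
  have ne: "a + 1 \<noteq> 0" "cnj a + 1 \<noteq> 0" "\<zeta> + 1 \<noteq> 0" "\<zeta> + cnj a \<noteq> 0"
    using a z plus_one_nonzero[OF a] plus_one_nonzero[OF z] by (auto simp: complex_eq_iff)
  have "1 - cnj (inv_cayley a) * w = 1 - cnj (inv_cayley a) * inv_cayley \<zeta>"
    using inv_cayley_cayley[OF w] by (simp add: \<zeta>_def)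
  also have "\<dots> = 2 * (\<zeta> + cnj a) / ((cnj a + 1) * (\<zeta> + 1))"
  proof -
    have "1 - (p - 1) / (p + 1) * ((\<zeta> - 1) / (\<zeta> + 1)) = 2 * (\<zeta> + p) / ((p + 1) * (\<zeta> + 1))"
      if "p + 1 \<noteq> 0" for p
      using that ne(3) by (simp add: divide_simps) (simp add: algebra_simps)
    from this[OF ne(2)] show ?thesis by (simp add: inv_cayley_def)
  qed
  finally have "norm (1 - cnj (inv_cayley a) * w) = 2 * norm (\<zeta> + cnj a) / (norm (cnj a + 1) * norm (\<zeta> + 1))"
    by (simp only: norm_mult norm_divide norm_numeral)
  moreover have "norm (cnj a + 1) = norm (cnj (a + 1))" by simp
  ultimately have 1: "norm (1 - cnj (inv_cayley a) * w) = 2 * norm (\<zeta> + cnj a) / (norm (a + 1) * norm (\<zeta> + 1))"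
    by (simp only: complex_mod_cnj)
  show ?thesis
    unfolding kernel_sq_def 1 one_minus_norm_inv_cayley[OF a]
    using ne by (simp add: power2_eq_square field_simps)
qed

lemma norm_one_minus_exp_le:
  assumes u: "- s \<le> Re u" and s: "0 \<le> s"
  shows "norm (1 - exp (- u)) \<le> exp s * norm u"
proof -
  have "norm (exp (- 0) - exp (- u)) \<le> exp s * norm (0 - u)"
  proof (rule field_differentiable_bound[where S="{u. - s \<le> Re u}" and f="\<lambda>u. exp (- u)" and f'="\<lambda>u. - exp (- u)"])
    show "convex {u. - s \<le> Re u}" by (rule convex_halfspace_Re_ge)
    show "((\<lambda>u. exp (- u)) has_field_derivative - exp (- z)) (at z within {u. - s \<le> Re u})" for z :: complex
      by (auto intro!: derivative_eq_intros)
    show "norm (- exp (- z)) \<le> exp s" if "z \<in> {u. - s \<le> Re u}" for z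
      using that by simp
  qed (use u s in auto)
  then show ?thesis by simp
qed

section \<open>Inner functions vanishing on the later blocks\<close>

definition horo_factor :: "nat \<Rightarrow> complex \<Rightarrow> complex" where
  "horo_factor m w = blaschke (exp (- (cayley w / 100 ^ m)))"

lemma norm_exp_cayley_le_1: "norm w < 1 \<Longrightarrow> norm (exp (- (cayley w / 100 ^ m))) \<le> 1"
proof -
  assume "norm w < 1"
  then have "0 < Re (cayley w)" by (rule cayley_Re_pos)
  then have "0 \<le> Re (cayley w / of_real (100 ^ m))" by (simp only: Re_divide_of_real) simp
  then show ?thesis by simp
qed

lemma norm_horo_factor_le_1: "norm w < 1 \<Longrightarrow> norm (horo_factor m w) \<le> 1"
  unfolding horo_factor_def by (intro norm_blaschke_le_1 norm_exp_cayley_le_1)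

lemma horo_factor_holomorphic: "horo_factor m holomorphic_on ball 0 1"
  unfolding horo_factor_def
  by (intro blaschke_holomorphic holomorphic_intros cayley_holomorphic) (auto intro: norm_exp_cayley_le_1 simp del: norm_exp_eq_Re)

lemma norm_one_minus_horo_factor_le:
  assumes "norm w < 1"
  shows "norm (1 - horo_factor m w) \<le> 3 * norm (cayley w) / 100 ^ m"
proof -
  define \<xi> where "\<xi> = exp (- (cayley w / 100 ^ m))"
  have n: "norm \<xi> \<le> 1" unfolding \<xi>_def by (rule norm_exp_cayley_le_1[OF assms])
  have "0 \<le> Re (cayley w / of_real (100 ^ m))" using cayley_Re_pos[OF assms] by (simp only: Re_divide_of_real) simp
  then have 1: "norm (1 - \<xi>) \<le> norm (cayley w) / 100 ^ m"
    using norm_one_minus_exp_le[of 0 "cayley w / 100 ^ m"] by (simp add: \<xi>_def norm_divide norm_power)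
  have "1 - horo_factor m w = 3 * (1 - \<xi>) / (2 - \<xi>)"
    using blaschke_denom(2)[OF n] unfolding horo_factor_def \<xi>_def[symmetric] blaschke_def by (simp add: field_simps)
  then have "norm (1 - horo_factor m w) = 3 * norm (1 - \<xi>) / norm (2 - \<xi>)"
    by (simp only: norm_mult norm_divide norm_numeral)
  also have "\<dots> \<le> 3 * norm (1 - \<xi>) / 1"
    using blaschke_denom(1)[OF n] by (intro divide_left_mono) auto
  finally show ?thesis using 1 by simp
qed

definition horo_partial :: "nat \<Rightarrow> nat \<Rightarrow> complex \<Rightarrow> complex" where
  "horo_partial i n w = (\<Prod>m<n. horo_factor (Suc i + m) w)"

definition horo_prod :: "nat \<Rightarrow> complex \<Rightarrow> complex" where
  "horo_prod i w = lim (\<lambda>n. horo_partial i n w)"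

lemma norm_horo_partial_le_1: "norm w < 1 \<Longrightarrow> norm (horo_partial i n w) \<le> 1"
  unfolding horo_partial_def prod_norm[symmetric] by (intro prod_le_1) (auto intro: norm_horo_factor_le_1)

text \<open>The M-test for differences of consecutive partial products: these products are bounded
  by 1, and factor m differs from 1 by at most 3 |cayley w| / 100^m.\<close>

lemma uniform_limit_horo_partial:
  assumes X: "\<And>w. w \<in> X \<Longrightarrow> norm w < 1" "\<And>w. w \<in> X \<Longrightarrow> norm (cayley w) \<le> K"
  shows "uniform_limit X (horo_partial i) (horo_prod i) sequentially"
proof -
  define d where "d n w = horo_partial i (Suc n) w - horo_partial i n w" for n w
  have "norm (d n w) \<le> 3 * K * (1 / 100) ^ n" if "w \<in> X" for n w
  proof -
    have K: "0 \<le> K" using X(2)[OF that] norm_ge_zero order_trans by blast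
    have "d n w = horo_partial i n w * (horo_factor (Suc i + n) w - 1)"
      by (simp add: d_def horo_partial_def algebra_simps)
    then have "norm (d n w) = norm (horo_partial i n w) * norm (1 - horo_factor (Suc i + n) w)"
      by (simp add: norm_mult norm_minus_commute)
    also have "\<dots> \<le> 1 * (3 * norm (cayley w) / 100 ^ (Suc i + n))"
      using X(1)[OF that] by (intro mult_mono norm_horo_partial_le_1 norm_one_minus_horo_factor_le) auto
    also have "\<dots> \<le> 3 * K / 100 ^ n"
      unfolding mult_1_left using X(2)[OF that] K by (intro frac_le power_increasing) auto
    finally show ?thesis by (simp add: power_divide)
  qed
  then have "uniform_limit X (\<lambda>n w. \<Sum>k<n. d k w) (\<lambda>w. suminf (\<lambda>k. d k w)) sequentially"
    by (rule Weierstrass_m_test) (auto intro!: summable_mult summable_geometric)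
  moreover have "(\<Sum>k<n. d k w) = horo_partial i n w - 1" for n w
    unfolding d_def by (subst sum_lessThan_telescope) (simp add: horo_partial_def)
  ultimately have "uniform_limit X (\<lambda>n w. horo_partial i n w - 1) (\<lambda>w. suminf (\<lambda>k. d k w)) sequentially"
    by simp
  then have "uniform_limit X (\<lambda>n w. (horo_partial i n w - 1) + 1) (\<lambda>w. suminf (\<lambda>k. d k w) + 1) sequentially"
    by (intro uniform_limit_intros)
  then have "uniformly_convergent_on X (horo_partial i)"
    unfolding uniformly_convergent_on_def by auto
  then show ?thesis
    unfolding uniformly_convergent_uniform_limit_iff horo_prod_def .
qed

lemma horo_partial_tendsto: "norm w < 1 \<Longrightarrow> (\<lambda>n. horo_partial i n w) \<longlonglongrightarrow> horo_prod i w"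
  using tendsto_uniform_limitI[OF uniform_limit_horo_partial[of "{w}" "norm (cayley w)" i]] by auto

lemma horo_prod_holomorphic: "horo_prod i holomorphic_on ball 0 1"
proof (rule holomorphic_uniform_sequence[where f="horo_partial i"])
  show "horo_partial i n holomorphic_on ball 0 1" for n
    unfolding horo_partial_def by (intro holomorphic_intros horo_factor_holomorphic)
  fix w :: complex assume w: "w \<in> ball 0 1"
  then obtain e where e: "e > 0" "cball w e \<subseteq> ball 0 1" using open_ball[of "0::complex" 1] unfolding open_contains_cball by blast
  have "compact (cayley ` cball w e)"
    by (intro compact_continuous_image continuous_on_subset[OF holomorphic_on_imp_continuous_on[OF cayley_holomorphic]] e) auto
  then obtain K where "\<And>x. x \<in> cball w e \<Longrightarrow> norm (cayley x) \<le> K"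
    using compact_imp_bounded bounded_iff by (metis imageI)
  then have "uniform_limit (cball w e) (horo_partial i) (horo_prod i) sequentially"
    using e(2) by (intro uniform_limit_horo_partial) auto
  then show "\<exists>d>0. cball w d \<subseteq> ball 0 1 \<and> uniform_limit (cball w d) (horo_partial i) (horo_prod i) sequentially"
    using e by blast
qed auto

lemma norm_horo_prod_le_1: "norm w < 1 \<Longrightarrow> norm (horo_prod i w) \<le> 1"
  by (rule tendsto_upperbound[OF tendsto_norm[OF horo_partial_tendsto]])
    (auto intro!: always_eventually norm_horo_partial_le_1)

text \<open>All solutions of exp (- \<zeta> / 100^i) = 1/2; \<open>k\<close> enumerates the branches
  of the logarithm of 2.\<close>

definition horo_zeta :: "nat \<Rightarrow> int \<Rightarrow> complex" where
  "horo_zeta i k = Complex (ln 2) (2 * pi * of_int k) * of_real (100 ^ i)"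

definition horo_point :: "nat \<Rightarrow> int \<Rightarrow> complex" where
  "horo_point i k = inv_cayley (horo_zeta i k)"

lemma Re_horo_zeta: "Re (horo_zeta i k) = ln 2 * 100 ^ i"
  by (simp add: horo_zeta_def del: of_real_power)

lemma Im_horo_zeta: "Im (horo_zeta i k) = 2 * pi * of_int k * 100 ^ i"
  by (simp add: horo_zeta_def del: of_real_power)

lemma Re_horo_zeta_pos: "0 < Re (horo_zeta i k)"
  by (simp add: Re_horo_zeta)

lemma norm_horo_point_less_1: "norm (horo_point i k) < 1"
  unfolding horo_point_def by (rule norm_inv_cayley_less_1[OF Re_horo_zeta_pos])

lemma cayley_horo_point: "cayley (horo_point i k) = horo_zeta i k"
  unfolding horo_point_def by (rule cayley_inv_cayley[OF Re_horo_zeta_pos])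

lemma horo_zeta_div: "horo_zeta i k / 100 ^ i = of_real (ln 2) + of_int k * (of_real (2 * pi) * \<i>)"
  by (simp add: horo_zeta_def complex_eq_iff)

lemma exp_horo_zeta: "exp (- (horo_zeta i k / 100 ^ i)) = 1 / 2"
proof -
  have "exp (horo_zeta i k / 100 ^ i) = exp (of_real (ln 2)) * exp (of_int k * (of_real (2 * pi) * \<i>))"
    unfolding horo_zeta_div exp_add ..
  also have "exp (of_real (ln 2) :: complex) = 2" by (simp add: exp_of_real)
  also have "exp (of_int k * (of_real (2 * pi) * \<i>)) = 1"
    by (simp add: exp_eq_1)
  finally show ?thesis by (simp add: exp_minus inverse_eq_divide)
qed

lemma horo_prod_horo_point_eq_0:
  assumes "i < m" shows "horo_prod i (horo_point m k) = 0"
proof -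
  have z: "horo_factor m (horo_point m k) = 0"
    by (simp add: horo_factor_def cayley_horo_point exp_horo_zeta blaschke_half)
  have "horo_partial i n (horo_point m k) = 0" if "n \<ge> m" for n
  proof -
    \<comment> \<open>Factor \<open>m\<close> sits at position \<open>m - Suc i\<close> of the
      shifted product.\<close>
    have "Suc i + (m - Suc i) = m" "m - Suc i < n" using assms that by auto
    then show ?thesis unfolding horo_partial_def using z by (intro prod_zero) (auto intro!: bexI[of _ "m - Suc i"])
  qed
  then have "\<forall>\<^sub>F n in sequentially. horo_partial i n (horo_point m k) = 0"
    unfolding eventually_sequentially by blast
  then have "(\<lambda>n. horo_partial i n (horo_point m k)) \<longlonglongrightarrow> 0" by (rule tendsto_eventually)
  then show ?thesis using horo_partial_tendsto[OF norm_horo_point_less_1] LIMSEQ_unique by blast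
qed

text \<open>The counterpart in w of \<open>norm_inner_prod_grid_point_ge\<close>: going to later
  blocks, exp (- \<zeta> / 100^m) has modulus 2^(-100^(i-m)), whose distance from 1 is at most
  100^(i-m). The bound passes to the infinite product.\<close>

lemma norm_horo_prod_horo_point_ge: "1 / 2 \<le> norm (horo_prod i (horo_point i k))"
proof -
  let ?w = "horo_point i k"
  have w: "norm ?w < 1" by (rule norm_horo_point_less_1)
  have fac: "1 - norm (horo_factor (Suc i + m) ?w) \<le> 6 * (1 / 100) ^ Suc m" for m
  proof -
    define \<xi> where "\<xi> = exp (- (cayley ?w / 100 ^ (Suc i + m)))"
    have n: "norm \<xi> \<le> 1" unfolding \<xi>_def by (rule norm_exp_cayley_le_1[OF w])
    have "Re (horo_zeta i k / of_real (100 ^ (Suc i + m))) = ln 2 * 100 ^ i / 100 ^ (Suc i + m)"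
      unfolding Re_divide_of_real Re_horo_zeta ..
    also have "\<dots> = ln 2 / 100 ^ Suc m" by (simp add: power_add)
    finally have "norm \<xi> = exp (- (ln 2 / 100 ^ Suc m))"
      unfolding \<xi>_def cayley_horo_point by simp
    also have "\<dots> = 2 powr (- ((1 / 100) ^ Suc m))" by (simp add: powr_def power_divide)
    finally have l: "1 - norm \<xi> \<le> (1 / 100) ^ Suc m"
      using two_powr_minus_ge[of "(1 / 100) ^ Suc m :: real"] by simp
    have "1 - 6 * (1 - norm \<xi>) \<le> norm (horo_factor (Suc i + m) ?w)"
      unfolding horo_factor_def \<xi>_def[symmetric] by (rule norm_blaschke_ge[OF n])
    then have "1 - norm (horo_factor (Suc i + m) ?w) \<le> 6 * (1 - norm \<xi>)" by simp
    also have "\<dots> \<le> 6 * (1 / 100) ^ Suc m" using l by (rule mult_left_mono) simp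
    finally show ?thesis .
  qed
  have "1 / 2 \<le> norm (horo_partial i n ?w)" for n
  proof -
    have "(\<Sum>m<n. 1 - norm (horo_factor (Suc i + m) ?w)) \<le> (\<Sum>m<n. 6 * (1 / 100) ^ Suc m)"
      by (intro sum_mono fac)
    also have "\<dots> = 6 / 100 * (\<Sum>m<n. (1 / 100) ^ m)" by (simp add: sum_distrib_left)
    also have "(\<Sum>m<n. (1 / 100 :: real) ^ m) \<le> 100 / 99"
      by (subst sum_gp_strict) (simp add: field_simps)
    finally have "1 / 2 \<le> 1 - (\<Sum>m<n. 1 - norm (horo_factor (Suc i + m) ?w))" by simp
    also have "\<dots> \<le> (\<Prod>m<n. norm (horo_factor (Suc i + m) ?w))"
      by (rule prod_ge_one_minus_sum) (auto intro: norm_horo_factor_le_1 w)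
    finally show ?thesis by (simp add: horo_partial_def prod_norm)
  qed
  then show ?thesis
    by (intro tendsto_lowerbound[OF tendsto_norm[OF horo_partial_tendsto[OF w]]]) auto
qed

section \<open>Lagrange functions on a horocycle\<close>

text \<open>An entire function with value 1 at 0 and zeros at the nonzero multiples of 2 pi i: the
  analogue of a Lagrange polynomial for points equally spaced on a vertical line.\<close>

definition exp_quot :: "complex \<Rightarrow> complex" where
  "exp_quot u = (if u = 0 then 1 else (1 - exp (- u)) / u)"

lemma exp_quot_holomorphic: "exp_quot holomorphic_on UNIV"
proof -
  have d: "deriv (\<lambda>u::complex. - exp (- u)) 0 = 1"
    by (rule DERIV_imp_deriv) (auto intro!: derivative_eq_intros)
  have "(\<lambda>u::complex. - exp (- u)) holomorphic_on UNIV" by (intro holomorphic_intros)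
  from pole_lemma_open[OF this open_UNIV, of 0] show ?thesis
    unfolding d by (rule holomorphic_transform) (auto simp: exp_quot_def)
qed

text \<open>The shift is the reflection: for u = (\<zeta> - a) / 100^i with Re a = ln 2 * 100^i, u +
  2 ln 2 is (\<zeta> + cnj a) / 100^i, the denominator of the kernel at a. For |u| \<le> 1 use |1 -
  exp (- u)| \<le> 2 |u|, otherwise |1 - exp (- u)| \<le> 3.\<close>

lemma norm_exp_quot_le:
  assumes "- ln 2 \<le> Re u" shows "norm (exp_quot u) * norm (u + of_real (2 * ln 2)) \<le> 9"
proof (cases "u = 0")
  case True
  then show ?thesis using ln_2_less_1 by (simp add: exp_quot_def norm_mult)
next
  case False
  have le2: "norm (1 - exp (- u)) \<le> 2 * norm u"
    using norm_one_minus_exp_le[OF assms] by simp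
  have "norm (exp (- u)) \<le> 2"
  proof -
    have "exp (- Re u) \<le> exp (ln 2)" using assms by (subst exp_le_cancel_iff) simp
    then show ?thesis by simp
  qed
  then have le3: "norm (1 - exp (- u)) \<le> 3" using norm_triangle_ineq4[of 1 "exp (- u)"] by simp
  have "norm (u + of_real (2 * ln 2)) \<le> norm u + norm (of_real (2 * ln 2) :: complex)" by (rule norm_triangle_ineq)
  also have "norm (of_real (2 * ln 2) :: complex) \<le> 2" using ln_2_less_1 by (simp add: norm_mult)
  finally have s: "norm (u + of_real (2 * ln 2)) \<le> norm u + 2" by simp
  have "norm (1 - exp (- u)) * norm (u + of_real (2 * ln 2)) \<le> 9 * norm u"
  proof (cases "norm u \<le> 1")
    case True
    have "norm (1 - exp (- u)) * norm (u + of_real (2 * ln 2)) \<le> (2 * norm u) * 3"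
      using le2 s True by (intro mult_mono) auto
    also have "\<dots> \<le> 9 * norm u" by simp
    finally show ?thesis .
  next
    case False
    have "norm (1 - exp (- u)) * norm (u + of_real (2 * ln 2)) \<le> 3 * (3 * norm u)"
      using le3 s False by (intro mult_mono) auto
    then show ?thesis by simp
  qed
  then show ?thesis using False by (simp add: exp_quot_def norm_divide field_simps)
qed

text \<open>The quotient of \<zeta> + 1 by its value at the node turns decay in the half-plane into
  a Szego kernel of the disc, and the square makes that kernel integrable and summable over the
  block.\<close>

definition horo_lagrange :: "nat \<Rightarrow> int \<Rightarrow> complex \<Rightarrow> complex" where
  "horo_lagrange i k w = (exp_quot ((cayley w - horo_zeta i k) / 100 ^ i) * ((cayley w + 1) / (horo_zeta i k + 1)))\<^sup>2"

lemma horo_lagrange_holomorphic: "horo_lagrange i k holomorphic_on ball 0 1"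
proof -
  have "exp_quot \<circ> (\<lambda>w. (cayley w - horo_zeta i k) / 100 ^ i) holomorphic_on ball 0 1"
    by (rule holomorphic_on_compose_gen[OF _ exp_quot_holomorphic]) (auto intro!: holomorphic_intros cayley_holomorphic)
  then show ?thesis
    unfolding horo_lagrange_def o_def
    using plus_one_nonzero[OF Re_horo_zeta_pos] by (intro holomorphic_intros cayley_holomorphic) auto
qed

lemma horo_lagrange_horo_point:
  "horo_lagrange i k (horo_point i k') = (if k = k' then 1 else 0)"
proof (cases "k = k'")
  case True
  then show ?thesis using plus_one_nonzero[OF Re_horo_zeta_pos]
    by (simp add: horo_lagrange_def cayley_horo_point exp_quot_def)
next
  case False
  define u where "u = (horo_zeta i k' - horo_zeta i k) / 100 ^ i"
  have u: "u = of_int (k' - k) * (of_real (2 * pi) * \<i>)"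
    unfolding u_def diff_divide_distrib horo_zeta_div by (simp add: algebra_simps)
  then have "u \<noteq> 0" using False by simp
  moreover have "exp (- u) = 1"
  proof -
    have "exp (- u) = exp (of_int (k - k') * (of_real (2 * pi) * \<i>))" by (simp add: u algebra_simps)
    also have "\<dots> = 1" by (simp add: exp_eq_1) (metis of_int_diff)
    finally show ?thesis .
  qed
  ultimately have "exp_quot u = 0" by (simp add: exp_quot_def)
  then show ?thesis using False by (simp add: horo_lagrange_def cayley_horo_point u_def)
qed

lemma norm_horo_lagrange_le:
  assumes w: "norm w < 1"
  shows "norm (horo_lagrange i k w) \<le> 81 * kernel_sq (horo_point i k) w"
proof -
  define a where "a = horo_zeta i k"
  define \<zeta> where "\<zeta> = cayley w"
  define u where "u = (\<zeta> - a) / 100 ^ i"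
  have a: "0 < Re a" "Re a = ln 2 * 100 ^ i" by (simp_all add: a_def Re_horo_zeta)
  have z: "0 < Re \<zeta>" unfolding \<zeta>_def by (rule cayley_Re_pos[OF w])
  have "u = (\<zeta> - a) / of_real (100 ^ i)" by (simp add: u_def)
  then have "Re u = (Re \<zeta> - Re a) / 100 ^ i" by (simp only: Re_divide_of_real minus_complex.simps)
  then have "Re u = Re \<zeta> / 100 ^ i - ln 2" by (simp add: diff_divide_distrib a(2))
  moreover have "0 \<le> Re \<zeta> / 100 ^ i" using z by simp
  ultimately have "- ln 2 \<le> Re u" by simp
  note bd = norm_exp_quot_le[OF this]
  have "a + cnj a = of_real (2 * ln 2) * 100 ^ i"
    using a(2) by (simp add: complex_add_cnj)
  then have ua: "u + of_real (2 * ln 2) = (\<zeta> + cnj a) / 100 ^ i"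
    by (simp add: u_def field_simps)
  have "0 < Re (\<zeta> + cnj a)" using a(1) z by simp
  then have "\<zeta> + cnj a \<noteq> 0" by (metis less_irrefl zero_complex.sel(1))
  then have ne: "norm (a + 1) > 0" "norm (\<zeta> + cnj a) > 0"
    using plus_one_nonzero[OF a(1)] by simp_all
  have "norm (exp_quot u) \<le> 9 * 100 ^ i / norm (\<zeta> + cnj a)"
    using bd ne unfolding ua by (simp add: norm_divide norm_power field_simps)
  then have "norm (exp_quot u * ((\<zeta> + 1) / (a + 1))) \<le> 9 * 100 ^ i / norm (\<zeta> + cnj a) * (norm (\<zeta> + 1) / norm (a + 1))"
    unfolding norm_mult norm_divide by (intro mult_right_mono) auto
  also have "\<dots> \<le> 9 * (2 * Re a * norm (\<zeta> + 1) / (norm (a + 1) * norm (\<zeta> + cnj a)))"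
  proof -
    have "1 \<le> 2 * ln (2::real)" using ln2_ge_two_thirds by simp
    then have "100 ^ i \<le> 2 * Re a" unfolding a(2) by simp
    then have "9 * (100 ^ i * (norm (\<zeta> + 1) / (norm (a + 1) * norm (\<zeta> + cnj a)))) \<le>
        9 * (2 * Re a * (norm (\<zeta> + 1) / (norm (a + 1) * norm (\<zeta> + cnj a))))"
      by (intro mult_left_mono mult_right_mono) auto
    then show ?thesis by (simp add: mult_ac)
  qed
  finally have "(norm (exp_quot u * ((\<zeta> + 1) / (a + 1))))\<^sup>2 \<le> (9 * (2 * Re a * norm (\<zeta> + 1) / (norm (a + 1) * norm (\<zeta> + cnj a))))\<^sup>2"
    by (intro power_mono) auto
  also have "\<dots> = 81 * (2 * Re a * norm (\<zeta> + 1) / (norm (a + 1) * norm (\<zeta> + cnj a)))\<^sup>2"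
  proof -
    have "(9 * y)\<^sup>2 = 81 * y\<^sup>2" for y :: real by (simp add: power2_eq_square)
    then show ?thesis .
  qed
  also have "\<dots> = 81 * kernel_sq (horo_point i k) w"
    using kernel_sq_cayley[OF a(1) w] unfolding horo_point_def a_def[symmetric] \<zeta>_def[symmetric] by simp
  finally show ?thesis
    by (simp add: horo_lagrange_def norm_power u_def a_def \<zeta>_def)
qed

section \<open>Kernel sums over a horocycle\<close>

lemma sum_inverse_one_plus_square_le:
  fixes K :: "int set"
  assumes "finite K" shows "(\<Sum>k\<in>K. 1 / (1 + (real_of_int k)\<^sup>2)) \<le> 5"
proof -
  \<comment> \<open>The new pair of terms is dominated by 4 / x - 4 / (x + 1), which telescopes;
    equality at N = 0 fixes the constant 5.\<close>
  have sym: "(\<Sum>k\<in>{- int N..int N}. 1 / (1 + (real_of_int k)\<^sup>2)) \<le> 5 - 4 / (real N + 1)" for N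
  proof (induction N)
    case (Suc N)
    have eq: "{- int (Suc N)..int (Suc N)} = insert (int (Suc N)) (insert (- int (Suc N)) {- int N..int N})" by auto
    define x where "x = real N + 1"
    have x: "x \<ge> 1" by (simp add: x_def)
    have "1 / (1 + x\<^sup>2) \<le> 2 / (x * (x + 1))"
    proof -
      have "x * (x + 1) \<le> 2 * (1 + x\<^sup>2)"
        using zero_le_power2[of "2 * x - 1"] by (simp add: power2_eq_square algebra_simps)
      then show ?thesis using x by (simp add: divide_simps add_pos_nonneg)
    qed
    moreover have "2 * (2 / (x * (x + 1))) = 4 / x - 4 / (x + 1)" using x by (simp add: divide_simps)
    moreover have "(\<Sum>k\<in>{- int (Suc N)..int (Suc N)}. 1 / (1 + (real_of_int k)\<^sup>2)) =
        2 * (1 / (1 + x\<^sup>2)) + (\<Sum>k\<in>{- int N..int N}. 1 / (1 + (real_of_int k)\<^sup>2))"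
      unfolding eq by (simp add: x_def power2_eq_square algebra_simps)
    ultimately show ?case using Suc by (simp add: x_def)
  qed simp
  define N where "N = nat (Max (insert 0 (abs ` K)))"
  have "\<bar>k\<bar> \<le> int N" if "k \<in> K" for k using that assms by (simp add: N_def)
  then have "- int N \<le> k \<and> k \<le> int N" if "k \<in> K" for k using that by (meson abs_le_D1 abs_le_D2 minus_le_iff)
  then have "K \<subseteq> {- int N..int N}" by auto
  then have "(\<Sum>k\<in>K. 1 / (1 + (real_of_int k)\<^sup>2)) \<le> (\<Sum>k\<in>{- int N..int N}. 1 / (1 + (real_of_int k)\<^sup>2))"
    by (intro sum_mono2) auto
  also have "\<dots> \<le> 5" using sym[of N] by (smt (verit) divide_nonneg_nonneg of_nat_0_le_iff)
  finally show ?thesis .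
qed

text \<open>Subtract the floor of t. For 0 \<le> x \<le> 1 and an integer n, which is \<le> 0 or
  \<ge> 1, replacing x - n by n changes the summand by a factor of at most 4.\<close>

lemma sum_inverse_one_plus_shift_le:
  fixes K :: "int set" and t :: real
  assumes "finite K" shows "(\<Sum>k\<in>K. 1 / (1 + (t - real_of_int k)\<^sup>2)) \<le> 20"
proof -
  define k0 where "k0 = \<lfloor>t\<rfloor>"
  define x where "x = t - real_of_int k0"
  have x: "0 \<le> x" "x \<le> 1" unfolding x_def k0_def by linarith+
  have "1 / (1 + (t - real_of_int k)\<^sup>2) \<le> 4 * (1 / (1 + (real_of_int (k - k0))\<^sup>2))" for k
  proof -
    define n where "n = real_of_int (k - k0)"
    have eq: "t - real_of_int k = x - n" by (simp add: x_def n_def)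
    have "n \<le> 0 \<or> 1 \<le> n" unfolding n_def by (cases "k \<le> k0") auto
    then have "1 + n\<^sup>2 \<le> 4 * (1 + (x - n)\<^sup>2)"
    proof
      assume "n \<le> 0"
      then have "(- n)\<^sup>2 \<le> (x - n)\<^sup>2" using x by (intro power_mono) auto
      then have le: "n\<^sup>2 \<le> (x - n)\<^sup>2" by simp
      have "1 + a \<le> 4 * (1 + b)" if "a \<le> b" "0 \<le> b" for a b :: real
        using that by simp
      from this[OF le zero_le_power2] show ?thesis .
    next
      assume "1 \<le> n"
      then have "(n - 1)\<^sup>2 \<le> (n - x)\<^sup>2" using x by (intro power_mono) auto
      moreover have "1 + n\<^sup>2 \<le> 4 * (1 + (n - 1)\<^sup>2)"
        using zero_le_power2[of "3 * n - 4"] by (simp add: power2_eq_square algebra_simps)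
      ultimately show ?thesis by (simp add: power2_commute)
    qed
    then show ?thesis unfolding eq n_def[symmetric] by (simp add: divide_simps add_pos_nonneg)
  qed
  then have "(\<Sum>k\<in>K. 1 / (1 + (t - real_of_int k)\<^sup>2)) \<le> (\<Sum>k\<in>K. 4 * (1 / (1 + (real_of_int (k - k0))\<^sup>2)))"
    by (intro sum_mono)
  also have "\<dots> = 4 * (\<Sum>k\<in>(\<lambda>k. k - k0) ` K. 1 / (1 + (real_of_int k)\<^sup>2))"
    by (subst sum.reindex) (auto simp: inj_on_def sum_distrib_left)
  also have "\<dots> \<le> 4 * 5" using assms by (intro mult_left_mono sum_inverse_one_plus_square_le) auto
  finally show ?thesis by simp
qed

text \<open>Since |1 - cnj a| \<le> |a + 1|, the numerator satisfies |\<zeta> + 1| \<le> |\<zeta> +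
  cnj a| + |a + 1|. Each kernel is then dominated by two quadratically decaying terms, centred at
  height 0 and at the height of \<zeta>; the bound is 8 * (20 + 20), for every block and every
  w.\<close>

lemma sum_kernel_sq_horo_le:
  assumes w: "norm w < 1" and K: "finite K"
  shows "(\<Sum>k\<in>K. kernel_sq (horo_point i k) w) \<le> 320"
proof -
  define \<zeta> where "\<zeta> = cayley w"
  have z: "0 < Re \<zeta>" unfolding \<zeta>_def by (rule cayley_Re_pos[OF w])
  define X where "X = ln 2 * (100::real) ^ i"
  have X: "X > 0" by (simp add: X_def)
  define t where "t = Im \<zeta> / (2 * pi * 100 ^ i)"
  have t: "Im \<zeta> = 2 * pi * t * 100 ^ i" by (simp add: t_def)
  have base: "X\<^sup>2 / ((norm (Complex p q))\<^sup>2) \<le> 1 / (1 + y\<^sup>2)"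
    if "X \<le> p" "q = 2 * pi * y * 100 ^ i" for p q y
  proof -
    have "X * \<bar>y\<bar> \<le> (2 * pi * 100 ^ i) * \<bar>y\<bar>"
    proof (rule mult_right_mono)
      have "ln 2 \<le> 2 * pi" using ln_2_less_1 pi_gt3 by linarith
      then show "X \<le> 2 * pi * 100 ^ i" unfolding X_def by (intro mult_right_mono) auto
    qed auto
    then have "(X * \<bar>y\<bar>)\<^sup>2 \<le> ((2 * pi * 100 ^ i) * \<bar>y\<bar>)\<^sup>2" using X by (intro power_mono) auto
    also have "\<dots> = q\<^sup>2" unfolding that by (simp add: power_mult_distrib mult_ac)
    finally have "(X * \<bar>y\<bar>)\<^sup>2 \<le> q\<^sup>2" .
    moreover have "X\<^sup>2 \<le> p\<^sup>2" using X that by (intro power_mono) auto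
    ultimately have "X\<^sup>2 * (1 + y\<^sup>2) \<le> (norm (Complex p q))\<^sup>2"
      by (simp add: cmod_power2 power_mult_distrib algebra_simps)
    moreover have "0 < X\<^sup>2 * (1 + y\<^sup>2)" using X by (simp add: add_pos_nonneg)
    ultimately show ?thesis using X by (simp add: divide_simps add_pos_nonneg)
  qed
  have "kernel_sq (horo_point i k) w \<le> 8 * (1 / (1 + (0 - real_of_int k)\<^sup>2) + 1 / (1 + (t - real_of_int k)\<^sup>2))" for k
  proof -
    define a where "a = horo_zeta i k"
    have a: "Re a = X" "Im a = 2 * pi * of_int k * 100 ^ i" by (simp_all add: a_def Re_horo_zeta Im_horo_zeta X_def)
    have ap: "0 < Re a" using a X by simp
    have "0 < Re (\<zeta> + cnj a)" using ap z by simp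
    then have "\<zeta> + cnj a \<noteq> 0" by (metis less_irrefl zero_complex.sel(1))
    then have ne: "norm (a + 1) > 0" "norm (\<zeta> + cnj a) > 0"
      using plus_one_nonzero[OF ap] by simp_all
    have "norm (1 - cnj a) \<le> norm (a + 1)"
    proof -
      have "(norm (1 - cnj a))\<^sup>2 \<le> (norm (a + 1))\<^sup>2"
        unfolding cmod_power2 using ap by (simp add: power2_eq_square algebra_simps)
      then show ?thesis by (rule power2_le_imp_le) auto
    qed
    then have "norm (\<zeta> + 1) \<le> norm (\<zeta> + cnj a) + norm (a + 1)"
      using norm_triangle_ineq[of "\<zeta> + cnj a" "1 - cnj a"] by simp
    then have "2 * X * norm (\<zeta> + 1) / (norm (a + 1) * norm (\<zeta> + cnj a)) \<le>
        2 * X * (norm (\<zeta> + cnj a) + norm (a + 1)) / (norm (a + 1) * norm (\<zeta> + cnj a))"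
      using X ne by (intro divide_right_mono mult_left_mono) auto
    also have "\<dots> = 2 * (X / norm (a + 1) + X / norm (\<zeta> + cnj a))" using ne by (simp add: field_simps)
    finally have "(2 * X * norm (\<zeta> + 1) / (norm (a + 1) * norm (\<zeta> + cnj a)))\<^sup>2 \<le> (2 * (X / norm (a + 1) + X / norm (\<zeta> + cnj a)))\<^sup>2"
      using X by (intro power_mono) auto
    also have "\<dots> \<le> 8 * ((X / norm (a + 1))\<^sup>2 + (X / norm (\<zeta> + cnj a))\<^sup>2)"
    proof -
      have "(2 * (p + q))\<^sup>2 \<le> 8 * (p\<^sup>2 + q\<^sup>2)" for p q :: real
        using zero_le_power2[of "p - q"] by (simp add: power2_eq_square algebra_simps)
      then show ?thesis .
    qed
    also have "\<dots> \<le> 8 * (1 / (1 + (0 - real_of_int k)\<^sup>2) + 1 / (1 + (t - real_of_int k)\<^sup>2))"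
    proof (intro mult_left_mono add_mono)
      have "a + 1 = Complex (X + 1) (2 * pi * of_int k * 100 ^ i)" using a by (simp add: complex_eq_iff)
      then show "(X / norm (a + 1))\<^sup>2 \<le> 1 / (1 + (0 - real_of_int k)\<^sup>2)"
        using base[of "X + 1" "2 * pi * of_int k * 100 ^ i" "of_int k"] by (simp add: power_divide)
      have "\<zeta> + cnj a = Complex (Re \<zeta> + X) (2 * pi * (t - of_int k) * 100 ^ i)"
        using a t by (simp add: complex_eq_iff algebra_simps)
      then show "(X / norm (\<zeta> + cnj a))\<^sup>2 \<le> 1 / (1 + (t - real_of_int k)\<^sup>2)"
        using base[of "Re \<zeta> + X" "2 * pi * (t - of_int k) * 100 ^ i" "t - of_int k"] z by (simp add: power_divide)
    qed auto
    finally show ?thesis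
      using kernel_sq_cayley[OF ap w] unfolding horo_point_def a_def[symmetric] \<zeta>_def[symmetric] a(1) by simp
  qed
  then have "(\<Sum>k\<in>K. kernel_sq (horo_point i k) w) \<le>
      (\<Sum>k\<in>K. 8 * (1 / (1 + (0 - real_of_int k)\<^sup>2) + 1 / (1 + (t - real_of_int k)\<^sup>2)))" by (intro sum_mono)
  also have "\<dots> = 8 * ((\<Sum>k\<in>K. 1 / (1 + (0 - real_of_int k)\<^sup>2)) + (\<Sum>k\<in>K. 1 / (1 + (t - real_of_int k)\<^sup>2)))"
    by (simp only: sum_distrib_left[symmetric] sum.distrib)
  also have "\<dots> \<le> 8 * (20 + 20)"
    using K by (intro mult_left_mono add_mono sum_inverse_one_plus_shift_le) auto
  finally show ?thesis by simp
qed

subsection \<open>A simply interpolating sequence\<close>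

type_synonym index = "nat \<times> nat \<times> int"

text \<open>The remaining coordinates are 0 and contribute a factor 1 to the Szego weight.\<close>

definition two_point :: "'d \<Rightarrow> 'd \<Rightarrow> complex \<Rightarrow> complex \<Rightarrow> complex ^ 'd::finite" where
  "two_point d1 d2 z w = (\<chi> j. if j = d1 then z else if j = d2 then w else 0)"

fun atom :: "index \<Rightarrow> complex \<Rightarrow> complex \<Rightarrow> complex" where
  "atom (i, j, k) z w = inner_prod i z / inner_prod i (grid_point i j) * (grid_lagrange i j z)\<^sup>2 *
     (horo_prod i w / horo_prod i (horo_point i k) * horo_lagrange i k w)"

text \<open>A majorant in product form: it integrates over the torus by Fubini, and its sum over a
  block is bounded pointwise.\<close>

fun atom_bound :: "index \<Rightarrow> complex \<Rightarrow> complex \<Rightarrow> real" where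
  "atom_bound (i, j, k) z w = (norm (grid_lagrange i j z))\<^sup>2 * kernel_sq (horo_point i k) w"

definition indices :: "index set" where
  "indices = {(i, j, k). j < 100 ^ i}"

fun atom_point :: "'d \<Rightarrow> 'd \<Rightarrow> index \<Rightarrow> complex ^ 'd::finite" where
  "atom_point d1 d2 (i, j, k) = two_point d1 d2 (grid_point i j) (horo_point i k)"

fun atom_weight :: "index \<Rightarrow> real" where
  "atom_weight (i, j, k) = (1 - (grid_radius i)\<^sup>2) * (1 - (norm (horo_point i k))\<^sup>2)"

lemma two_point_polydisc: "norm z < 1 \<Longrightarrow> norm w < 1 \<Longrightarrow> two_point d1 d2 z w \<in> polydisc"
  by (auto simp: polydisc_def two_point_def)

lemma atom_point_polydisc: "atom_point d1 d2 x \<in> polydisc"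
  by (cases x) (auto intro!: two_point_polydisc simp: norm_grid_point grid_radius_less_1 norm_horo_point_less_1)

lemma szego_weight_atom_point:
  assumes "d1 \<noteq> d2" shows "szego_weight (atom_point d1 d2 x) = atom_weight x"
proof -
  obtain i j k where x: "x = (i, j, k)" by (cases x)
  have U: "UNIV = insert d1 (insert d2 (UNIV - {d1, d2}))" by auto
  have "szego_weight (atom_point d1 d2 x) =
      (\<Prod>l\<in>insert d1 (insert d2 (UNIV - {d1, d2})). 1 - (norm (atom_point d1 d2 x $ l))\<^sup>2)"
    unfolding szego_weight_def U[symmetric] ..
  also have "\<dots> = (1 - (norm (grid_point i j))\<^sup>2) * ((1 - (norm (horo_point i k))\<^sup>2) *
      (\<Prod>l\<in>UNIV - {d1, d2}. 1 - (norm (atom_point d1 d2 x $ l))\<^sup>2))"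
    using assms by (subst prod.insert, simp, simp, subst prod.insert) (auto simp: x two_point_def)
  also have "(\<Prod>l\<in>UNIV - {d1, d2}. 1 - (norm (atom_point d1 d2 x $ l))\<^sup>2) = 1"
    by (rule prod.neutral) (auto simp: x two_point_def)
  finally show ?thesis by (simp add: x norm_grid_point)
qed

lemma atom_weight_nonneg: "0 \<le> atom_weight x"
proof -
  obtain i j k where "x = (i, j, k)" by (cases x)
  then show ?thesis
    using grid_radius_less_1[of i] grid_radius_pos[of i] norm_horo_point_less_1[of i k]
    by (auto intro!: mult_nonneg_nonneg simp: abs_square_le_1 less_imp_le)
qed

lemma atom_at_point:
  assumes "(i, j, k) \<in> indices" "(i', j', k') \<in> indices"
  shows "atom (i, j, k) (grid_point i' j') (horo_point i' k') = (if (i, j, k) = (i', j', k') then 1 else 0)"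
proof -
  consider "i' < i" | "i < i'" | "i = i'" by linarith
  then show ?thesis
  proof cases
    case 1
    then show ?thesis by (simp add: inner_prod_grid_point_eq_0)
  next
    case 2
    then show ?thesis by (simp add: horo_prod_horo_point_eq_0)
  next
    case 3
    have "inner_prod i (grid_point i j) \<noteq> 0" "horo_prod i (horo_point i k) \<noteq> 0"
      using norm_inner_prod_grid_point_ge[of i j] norm_horo_prod_horo_point_ge[of i k] by auto
    then show ?thesis using 3 assms
      by (auto simp: indices_def grid_lagrange_grid_point horo_lagrange_horo_point)
  qed
qed

lemma atom_bound_nonneg: "0 \<le> atom_bound x z w"
  by (cases x) (simp add: kernel_sq_nonneg)

lemma norm_atom_le:
  assumes "norm z \<le> 1" "norm w < 1"
  shows "norm (atom x z w) \<le> 324 * atom_bound x z w"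
proof -
  obtain i j k where x: "x = (i, j, k)" by (cases x)
  have 1: "norm (inner_prod i z / inner_prod i (grid_point i j)) \<le> 2"
  proof -
    have "norm (inner_prod i z / inner_prod i (grid_point i j)) \<le> 1 / (1 / 2)"
      unfolding norm_divide using norm_inner_prod_le_1[OF assms(1)] norm_inner_prod_grid_point_ge[of i j]
      by (intro frac_le) auto
    then show ?thesis by simp
  qed
  have 2: "norm (horo_prod i w / horo_prod i (horo_point i k)) \<le> 2"
  proof -
    have "norm (horo_prod i w / horo_prod i (horo_point i k)) \<le> 1 / (1 / 2)"
      unfolding norm_divide using norm_horo_prod_le_1[OF assms(2)] norm_horo_prod_horo_point_ge[of i k]
      by (intro frac_le) auto
    then show ?thesis by simp
  qed
  have "norm (atom x z w) \<le> 2 * (norm (grid_lagrange i j z))\<^sup>2 * (2 * (81 * kernel_sq (horo_point i k) w))"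
    unfolding x atom.simps norm_mult norm_power
    using 1 2 norm_horo_lagrange_le[OF assms(2)] kernel_sq_nonneg by (intro mult_mono) auto
  then show ?thesis by (simp add: x)
qed

lemma atom_holomorphic_fst:
  assumes "norm w < 1"
  shows "continuous_on (cball 0 1) (\<lambda>z. atom x z w)" "(\<lambda>z. atom x z w) holomorphic_on ball 0 1"
proof -
  obtain i j k where x: "x = (i, j, k)" by (cases x)
  have "inner_prod i (grid_point i j) \<noteq> 0" using norm_inner_prod_grid_point_ge[of i j] by auto
  then show "continuous_on (cball 0 1) (\<lambda>z. atom x z w)" "(\<lambda>z. atom x z w) holomorphic_on ball 0 1"
    unfolding x atom.simps grid_lagrange_def
    by (intro continuous_intros holomorphic_intros inner_prod_continuous inner_prod_holomorphic; simp add: grid_point_nonzero)+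
qed

text \<open>Enlarge the index set to a full rectangle, where the sum factors into a grid sum, at
  most 4, and a horocycle sum, at most 320.\<close>

lemma sum_atom_bound_block_le:
  assumes "norm z \<le> 1" "norm w < 1" and J: "finite J" "J \<subseteq> indices" "\<And>x. x \<in> J \<Longrightarrow> fst x = i"
  shows "(\<Sum>x\<in>J. atom_bound x z w) \<le> 1280"
proof -
  define K where "K = (\<lambda>x. snd (snd x)) ` J"
  have K: "finite K" using J by (simp add: K_def)
  have sub: "J \<subseteq> (\<lambda>(j, k). (i, j, k)) ` ({..<100 ^ i} \<times> K)"
  proof
    fix x assume x: "x \<in> J"
    obtain i' j k where e: "x = (i', j, k)" by (cases x)
    have "i' = i" "j < 100 ^ i" "k \<in> K"
      using x J(2) J(3)[OF x] by (auto simp: e indices_def K_def intro!: image_eqI[of _ _ x])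
    then show "x \<in> (\<lambda>(j, k). (i, j, k)) ` ({..<100 ^ i} \<times> K)" by (auto simp: e)
  qed
  have "(\<Sum>x\<in>J. atom_bound x z w) \<le> (\<Sum>x\<in>(\<lambda>(j, k). (i, j, k)) ` ({..<100 ^ i} \<times> K). atom_bound x z w)"
    using K by (intro sum_mono2 sub) (auto simp: atom_bound_nonneg kernel_sq_nonneg)
  also have "\<dots> = (\<Sum>(j, k)\<in>{..<100 ^ i} \<times> K. (norm (grid_lagrange i j z))\<^sup>2 * kernel_sq (horo_point i k) w)"
    by (subst sum.reindex) (auto simp: inj_on_def intro!: sum.cong)
  also have "\<dots> = (\<Sum>j<100 ^ i. (norm (grid_lagrange i j z))\<^sup>2) * (\<Sum>k\<in>K. kernel_sq (horo_point i k) w)"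
    by (simp add: sum_product sum.cartesian_product)
  also have "\<dots> \<le> 4 * 320"
    using sum_grid_lagrange_le[OF assms(1)] sum_kernel_sq_horo_le[OF assms(2) K]
    by (intro mult_mono) (auto intro!: sum_nonneg kernel_sq_nonneg)
  finally show ?thesis by simp
qed

lemma measurable_grid_lagrange [measurable]: "grid_lagrange i j \<in> borel_measurable borel"
  unfolding grid_lagrange_def
  by (intro borel_measurable_continuous_onI continuous_intros) (auto simp: grid_point_nonzero)

lemma measurable_atom_bound [measurable]:
  assumes [measurable]: "f \<in> borel_measurable M" "g \<in> borel_measurable M"
  shows "(\<lambda>y. atom_bound x (f y) (g y)) \<in> borel_measurable M"
proof -
  obtain i j k where x: "x = (i, j, k)" by (cases x)
  show ?thesis unfolding x atom_bound.simps by measurable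
qed

text \<open>Cauchy-Schwarz after splitting |f| into two square roots: pointwise absolute summability
  gives an l^2 bound with weights |f|.\<close>

lemma norm_weighted_sum_square_le:
  fixes A f :: "'a \<Rightarrow> complex"
  assumes "(\<Sum>x\<in>J. norm (f x)) \<le> B"
  shows "(norm (\<Sum>x\<in>J. A x * f x))\<^sup>2 \<le> B * (\<Sum>x\<in>J. (norm (A x))\<^sup>2 * norm (f x))"
proof -
  have "norm (\<Sum>x\<in>J. A x * f x) \<le> (\<Sum>x\<in>J. sqrt (norm (f x)) * (norm (A x) * sqrt (norm (f x))))"
    by (rule order_trans[OF norm_sum]) (auto intro!: sum_mono simp: norm_mult mult_ac real_sqrt_mult[symmetric] simp flip: power2_eq_square)
  then have "(norm (\<Sum>x\<in>J. A x * f x))\<^sup>2 \<le> (\<Sum>x\<in>J. sqrt (norm (f x)) * (norm (A x) * sqrt (norm (f x))))\<^sup>2"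
    by (intro power_mono) auto
  also have "\<dots> \<le> (\<Sum>x\<in>J. (sqrt (norm (f x)))\<^sup>2) * (\<Sum>x\<in>J. (norm (A x) * sqrt (norm (f x)))\<^sup>2)"
    by (rule Cauchy_Schwarz_ineq_sum)
  also have "\<dots> = (\<Sum>x\<in>J. norm (f x)) * (\<Sum>x\<in>J. (norm (A x))\<^sup>2 * norm (f x))"
    by (simp add: power_mult_distrib)
  also have "\<dots> \<le> B * (\<Sum>x\<in>J. (norm (A x))\<^sup>2 * norm (f x))"
    by (intro mult_right_mono assms sum_nonneg) auto
  finally show ?thesis .
qed

text \<open>Distinct blocks are orthogonal in the first variable, and inside one block the atoms are
  absolutely summable.\<close>

lemma circle_atoms_L2:
  assumes w: "norm w < 1" and J: "finite J" "J \<subseteq> indices"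
  shows "(\<integral>\<^sup>+ z. ennreal ((norm (\<Sum>x\<in>J. A x * atom x z w))\<^sup>2) \<partial>circle_measure) \<le>
    (\<integral>\<^sup>+ z. ennreal (134369280 * (\<Sum>x\<in>J. (norm (A x))\<^sup>2 * atom_bound x z w)) \<partial>circle_measure)"
proof -
  define g where "g i z = (\<Sum>x\<in>{x \<in> J. fst x = i}. A x * atom x z w)" for i z
  \<comment> \<open>The constant is 324 * 1280 * 324: the bound on the block sum of atoms times the
    factor in \<open>norm_atom_le\<close> for the remaining weights.\<close>
  define h where "h i z = 134369280 * (\<Sum>x\<in>{x \<in> J. fst x = i}. (norm (A x))\<^sup>2 * atom_bound x z w)" for i z
  have h0: "0 \<le> h i z" for i z
    unfolding h_def by (intro mult_nonneg_nonneg sum_nonneg atom_bound_nonneg) auto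
  have [measurable]: "h i \<in> borel_measurable borel" for i
    unfolding h_def by measurable
  have eq: "(\<Sum>x\<in>J. A x * atom x z w) = (\<Sum>i\<in>fst ` J. g i z)" for z
    unfolding g_def using J by (intro sum.group[symmetric]) auto
  have cont: "continuous_on (sphere 0 1) (g i)" for i
    unfolding g_def
    by (intro continuous_intros continuous_on_subset[OF atom_holomorphic_fst(1)[OF w]]) auto
  have orth_less: "circle_inner (g i) (g i') = 0" if "i < i'" for i i'
  proof -
    \<comment> \<open>With w frozen, everything but the inner product and the squared Lagrange
      polynomial is a constant coefficient.\<close>
    have form: "g i = (\<lambda>z. inner_prod i z * (\<Sum>x\<in>{x \<in> J. fst x = i}.
        (A x / inner_prod i (grid_point i (fst (snd x))) *
          (horo_prod i w / horo_prod i (horo_point i (snd (snd x))) * horo_lagrange i (snd (snd x)) w)) *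
        (grid_lagrange i (fst (snd x)) z)\<^sup>2))" for i
      unfolding g_def sum_distrib_left by (intro ext sum.cong refl) (auto simp: mult_ac)
    show ?thesis unfolding form[of i] form[of i'] by (rule circle_inner_grid_blocks[OF that])
  qed
  have orth: "circle_inner (g i) (g i') = 0" if "i \<noteq> i'" for i i'
    using orth_less[of i i'] orth_less[of i' i] circle_inner_commute[of "g i" "g i'"] that
    by (cases "i < i'") auto
  have "(\<integral>\<^sup>+ z. ennreal ((norm (\<Sum>x\<in>J. A x * atom x z w))\<^sup>2) \<partial>circle_measure) =
      (\<Sum>i\<in>fst ` J. \<integral>\<^sup>+ z. ennreal ((norm (g i z))\<^sup>2) \<partial>circle_measure)"
    unfolding eq using J by (intro circle_pythagoras cont orth) auto
  also have "\<dots> \<le> (\<Sum>i\<in>fst ` J. \<integral>\<^sup>+ z. ennreal (h i z) \<partial>circle_measure)"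
  proof (intro sum_mono nn_integral_circle_mono ennreal_leI)
    fix i z assume z: "norm (z::complex) = 1"
    have le: "norm (atom x z w) \<le> 324 * atom_bound x z w" for x by (rule norm_atom_le) (use z w in auto)
    have "(\<Sum>x\<in>{x \<in> J. fst x = i}. norm (atom x z w)) \<le> (\<Sum>x\<in>{x \<in> J. fst x = i}. 324 * atom_bound x z w)"
      by (intro sum_mono le)
    also have "\<dots> = 324 * (\<Sum>x\<in>{x \<in> J. fst x = i}. atom_bound x z w)" by (simp add: sum_distrib_left)
    also have "\<dots> \<le> 324 * 1280"
      using z w J by (intro mult_left_mono sum_atom_bound_block_le[where i=i]) auto
    finally have "(norm (g i z))\<^sup>2 \<le> (324 * 1280) * (\<Sum>x\<in>{x \<in> J. fst x = i}. (norm (A x))\<^sup>2 * norm (atom x z w))"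
      unfolding g_def by (rule norm_weighted_sum_square_le)
    also have "\<dots> \<le> (324 * 1280) * (\<Sum>x\<in>{x \<in> J. fst x = i}. (norm (A x))\<^sup>2 * (324 * atom_bound x z w))"
      by (intro mult_left_mono sum_mono le) auto
    also have "\<dots> = h i z" unfolding h_def sum_distrib_left by (intro sum.cong refl) simp
    finally show "(norm (g i z))\<^sup>2 \<le> h i z" .
  qed
  also have "\<dots> = (\<integral>\<^sup>+ z. ennreal (\<Sum>i\<in>fst ` J. h i z) \<partial>circle_measure)"
    using h0 by (subst nn_integral_sum[symmetric]) (auto simp: sum_ennreal)
  also have "(\<lambda>z. \<Sum>i\<in>fst ` J. h i z) = (\<lambda>z. 134369280 * (\<Sum>x\<in>J. (norm (A x))\<^sup>2 * atom_bound x z w))"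
    unfolding h_def sum_distrib_left[symmetric] using J by (intro ext arg_cong2[where f=times] refl sum.group) auto
  finally show ?thesis .
qed

text \<open>Two radii are needed: the L^1 estimate uses the same one in both variables, while the
  L^2 estimate has z on the circle and only w inside.\<close>

lemma nn_integral_atom_bound_le:
  assumes d: "d1 \<noteq> (d2 :: 'd::finite)" and r: "0 \<le> r" "r \<le> 1" "0 \<le> s" "s \<le> 1"
  shows "(\<integral>\<^sup>+ y. ennreal (atom_bound x (of_real r * y $ d1) (of_real s * (y :: complex ^ 'd) $ d2)) \<partial>torus_measure) \<le> ennreal (8 * atom_weight x)"
proof -
  obtain i j k where x: "x = (i, j, k)" by (cases x)
  have a: "norm (horo_point i k) < 1" by (rule norm_horo_point_less_1)
  have a1: "0 \<le> 1 - (norm (horo_point i k))\<^sup>2" using a by (simp add: abs_square_le_1 less_imp_le)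
  have "(\<integral>\<^sup>+ y. ennreal (atom_bound x (of_real r * y $ d1) (of_real s * (y :: complex ^ 'd) $ d2)) \<partial>torus_measure) =
      (\<integral>\<^sup>+ y. ennreal ((norm (grid_lagrange i j (of_real r * y $ d1)))\<^sup>2) * ennreal (kernel_sq (horo_point i k) (of_real s * (y :: complex ^ 'd) $ d2)) \<partial>torus_measure)"
    by (intro nn_integral_cong) (simp add: x ennreal_mult kernel_sq_nonneg)
  also have "\<dots> = (\<integral>\<^sup>+ z. ennreal ((norm (grid_lagrange i j (of_real r * z)))\<^sup>2) \<partial>circle_measure) *
      (\<integral>\<^sup>+ w. ennreal (kernel_sq (horo_point i k) (of_real s * w)) \<partial>circle_measure)"
    by (rule nn_integral_torus_two[OF _ _ d]) measurable
  also have "\<dots> \<le> ennreal (4 / 100 ^ i) * ennreal (1 - (norm (horo_point i k))\<^sup>2)"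
    using r by (intro mult_mono nn_integral_grid_lagrange_le nn_integral_kernel_sq_le a) auto
  also have "\<dots> = ennreal (4 / 100 ^ i * (1 - (norm (horo_point i k))\<^sup>2))"
    using a1 by (intro ennreal_mult[symmetric]) auto
  also have "\<dots> \<le> ennreal (8 * atom_weight x)"
  proof (rule ennreal_leI)
    have "4 / 100 ^ i \<le> 8 * (1 - (grid_radius i)\<^sup>2)" using one_minus_grid_radius_square[of i] by simp
    from mult_right_mono[OF this a1]
    show "4 / 100 ^ i * (1 - (norm (horo_point i k))\<^sup>2) \<le> 8 * atom_weight x" by (simp only: x atom_weight.simps mult.assoc)
  qed
  finally show ?thesis .
qed

lemma atom_sv_holomorphic:
  fixes d1 d2 :: "'d::finite"
  shows "sv_holomorphic_on (\<lambda>y :: complex ^ 'd. atom x (y $ d1) (y $ d2)) polydisc"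
proof -
  obtain i j k where x: "x = (i, j, k)" by (cases x)
  have hol1: "(\<lambda>z. inner_prod i z / inner_prod i (grid_point i j) * (grid_lagrange i j z)\<^sup>2) holomorphic_on ball 0 1"
    unfolding grid_lagrange_def using norm_inner_prod_grid_point_ge[of i j]
    by (intro holomorphic_intros inner_prod_holomorphic) (auto simp: grid_point_nonzero)
  have hol2: "(\<lambda>w. horo_prod i w / horo_prod i (horo_point i k) * horo_lagrange i k w) holomorphic_on ball 0 1"
    using norm_horo_prod_horo_point_ge[of i k]
    by (intro holomorphic_intros horo_prod_holomorphic horo_lagrange_holomorphic) auto
  show ?thesis unfolding x atom.simps
    by (intro sv_holomorphic_on_mult sv_holomorphic_on_coordinate[OF hol1] sv_holomorphic_on_coordinate[OF hol2])
      (auto simp: polydisc_def)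
qed

text \<open>The L^1 bound is the triangle inequality, the L^2 bound is orthogonality of blocks for
  fixed w, and interpolation does the rest. The common constant is 8 * 134369280; the L^1 bound
  alone would give 324 * 8 = 2592.\<close>

lemma atoms_hardy_norm_le:
  fixes d1 d2 :: "'d::finite"
  assumes d: "d1 \<noteq> d2" and J: "finite J" "J \<subseteq> indices" and p: "1 \<le> p" "p \<le> 2"
  shows "hardy_norm_powr p (\<lambda>y :: complex ^ 'd. \<Sum>x\<in>J. A x * atom x (y $ d1) (y $ d2)) \<le>
    ennreal (marcinkiewicz_const p * 1074954240 * (\<Sum>x\<in>J. atom_weight x * norm (A x) powr p))"
  unfolding hardy_norm_powr_eq
proof (rule SUP_least)
  fix r :: real assume "r \<in> {0<..<1}"
  then have r: "0 < r" "r < 1" by auto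
  let ?f = "\<lambda>x (y :: complex ^ 'd). atom x (y $ d1) (y $ d2)"
  have f: "sv_holomorphic_on (?f x) polydisc" for x by (rule atom_sv_holomorphic)
  note [measurable] = measurable_scaled[OF f r]
  have scaled_sum: "scaled r (\<lambda>y. \<Sum>x\<in>J. A x * ?f x y) y = (\<Sum>x\<in>J. A x * scaled r (?f x) y)" for A y
    by (simp add: scaled_def)
  have coord: "norm (y $ l) = 1" if "y \<in> torus" for y :: "complex ^ 'd" and l using that by (simp add: torus_def)
  have scaled_atom: "scaled r (?f x) y = atom x (of_real r * y $ d1) (of_real r * y $ d2)" if "y \<in> torus" for x y
    using that by (simp add: scaled_torus scaleR_conv_of_real[where 'a=complex])
  have "(\<integral>\<^sup>+ y. ennreal (norm (\<Sum>x\<in>J. A x * scaled r (?f x) y) powr p) \<partial>torus_measure) \<le>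
    ennreal (marcinkiewicz_const p * 1074954240 * (\<Sum>x\<in>J. atom_weight x * norm (A x) powr p))"
  proof (rule marcinkiewicz)
    interpret prob_space "torus_measure :: (complex ^ 'd) measure" by (rule prob_space_torus_measure)
    show "sigma_finite_measure (torus_measure :: (complex ^ 'd) measure)" by unfold_locales
    show "scaled r (?f x) \<in> borel_measurable torus_measure" for x by measurable
    show "0 \<le> atom_weight x" for x by (rule atom_weight_nonneg)
    show "(\<integral>\<^sup>+ y. ennreal (norm (\<Sum>x\<in>J. A x * scaled r (?f x) y)) \<partial>torus_measure) \<le>
      ennreal (1074954240 * (\<Sum>x\<in>J. atom_weight x * norm (A x)))" for A
    proof -
      have "(\<integral>\<^sup>+ y. ennreal (norm (\<Sum>x\<in>J. A x * scaled r (?f x) y)) \<partial>torus_measure) \<le>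
        (\<integral>\<^sup>+ y. (\<Sum>x\<in>J. ennreal (324 * norm (A x)) * ennreal (atom_bound x (of_real r * y $ d1) (of_real r * y $ d2))) \<partial>torus_measure)"
      proof (rule nn_integral_torus_mono)
        fix y :: "complex ^ 'd" assume y: "y \<in> torus"
        have "norm (\<Sum>x\<in>J. A x * scaled r (?f x) y) \<le> (\<Sum>x\<in>J. norm (A x) * (324 * atom_bound x (of_real r * y $ d1) (of_real r * y $ d2)))"
          unfolding scaled_atom[OF y]
          by (rule order_trans[OF norm_sum], rule sum_mono, unfold norm_mult, rule mult_left_mono[OF norm_atom_le])
            (use r coord[OF y] in \<open>auto simp: norm_mult\<close>)
        then have "ennreal (norm (\<Sum>x\<in>J. A x * scaled r (?f x) y)) \<le>
            ennreal (\<Sum>x\<in>J. norm (A x) * (324 * atom_bound x (of_real r * y $ d1) (of_real r * y $ d2)))" by (rule ennreal_leI)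
        also have "\<dots> = (\<Sum>x\<in>J. ennreal (324 * norm (A x)) * ennreal (atom_bound x (of_real r * y $ d1) (of_real r * y $ d2)))"
          using atom_bound_nonneg
          by (subst sum_ennreal[symmetric]) (auto simp: ennreal_mult[symmetric] mult_ac intro!: sum.cong)
        finally show "ennreal (norm (\<Sum>x\<in>J. A x * scaled r (?f x) y)) \<le> \<dots>" .
      qed
      also have "\<dots> = (\<Sum>x\<in>J. ennreal (324 * norm (A x)) * (\<integral>\<^sup>+ y. ennreal (atom_bound x (of_real r * y $ d1) (of_real r * y $ d2)) \<partial>torus_measure))"
        by (simp add: nn_integral_sum nn_integral_cmult)
      also have "\<dots> \<le> (\<Sum>x\<in>J. ennreal (324 * norm (A x)) * ennreal (8 * atom_weight x))"
        using r by (intro sum_mono mult_left_mono nn_integral_atom_bound_le d) auto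
      also have "\<dots> = ennreal (\<Sum>x\<in>J. 2592 * (atom_weight x * norm (A x)))"
        using atom_weight_nonneg by (subst sum_ennreal[symmetric]) (auto simp: ennreal_mult[symmetric] mult_ac intro!: sum.cong)
      also have "\<dots> \<le> ennreal (1074954240 * (\<Sum>x\<in>J. atom_weight x * norm (A x)))"
        unfolding sum_distrib_left using atom_weight_nonneg by (intro ennreal_leI sum_mono mult_right_mono) auto
      finally show ?thesis .
    qed
    show "(\<integral>\<^sup>+ y. ennreal ((norm (\<Sum>x\<in>J. A x * scaled r (?f x) y))\<^sup>2) \<partial>torus_measure) \<le>
      ennreal (1074954240 * (\<Sum>x\<in>J. atom_weight x * (norm (A x))\<^sup>2))" for A
    proof -
      \<comment> \<open>Radius 1 in the first variable, written \<open>of_real 1\<close> to match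
        \<open>nn_integral_atom_bound_le\<close>: \<open>circle_L2_radial_mono\<close> has moved z
        to the circle.\<close>
      let ?H = "\<lambda>y :: complex ^ 'd. \<Sum>x\<in>J. (norm (A x))\<^sup>2 * atom_bound x (of_real 1 * y $ d1) (of_real r * y $ d2)"
      have "(\<integral>\<^sup>+ y. ennreal ((norm (\<Sum>x\<in>J. A x * scaled r (?f x) y))\<^sup>2) \<partial>torus_measure) \<le>
        (\<integral>\<^sup>+ y. ennreal (134369280 * ?H y) \<partial>torus_measure)"
      proof (rule nn_integral_torus_fiber_mono[where i=d1])
        fix y :: "complex ^ 'd" assume y: "y \<in> torus"
        define w where "w = of_real r * y $ d2"
        have w: "norm w < 1" using r coord[OF y] by (simp add: w_def norm_mult)
        let ?h = "\<lambda>z. \<Sum>x\<in>J. A x * atom x z w"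
        have h: "continuous_on (cball 0 1) ?h" "?h holomorphic_on ball 0 1"
          by (intro continuous_intros holomorphic_intros atom_holomorphic_fst[OF w])+
        have "(\<integral>\<^sup>+ z. ennreal ((norm (\<Sum>x\<in>J. A x * scaled r (?f x) (vec_upd y d1 z)))\<^sup>2) \<partial>circle_measure) =
            (\<integral>\<^sup>+ z. ennreal ((norm (?h (of_real r * z)))\<^sup>2) \<partial>circle_measure)"
        proof (rule nn_integral_circle_cong)
          fix z :: complex assume "norm z = 1"
          then have "vec_upd y d1 z \<in> torus" using y by (auto simp: torus_def vec_upd_nth)
          then show "ennreal ((norm (\<Sum>x\<in>J. A x * scaled r (?f x) (vec_upd y d1 z)))\<^sup>2) = ennreal ((norm (?h (of_real r * z)))\<^sup>2)"
            using d by (simp add: scaled_atom vec_upd_nth w_def)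
        qed
        also have "\<dots> \<le> (\<integral>\<^sup>+ z. ennreal ((norm (?h z))\<^sup>2) \<partial>circle_measure)"
          using r by (intro circle_L2_radial_mono[OF h]) auto
        also have "\<dots> \<le> (\<integral>\<^sup>+ z. ennreal (134369280 * (\<Sum>x\<in>J. (norm (A x))\<^sup>2 * atom_bound x z w)) \<partial>circle_measure)"
          by (rule circle_atoms_L2[OF w J])
        also have "\<dots> = (\<integral>\<^sup>+ z. ennreal (134369280 * ?H (vec_upd y d1 z)) \<partial>circle_measure)"
          using d by (simp add: vec_upd_nth w_def)
        finally show "(\<integral>\<^sup>+ z. ennreal ((norm (\<Sum>x\<in>J. A x * scaled r (?f x) (vec_upd y d1 z)))\<^sup>2) \<partial>circle_measure) \<le> \<dots>" .
      qed measurable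
      also have "\<dots> = (\<integral>\<^sup>+ y. (\<Sum>x\<in>J. ennreal (134369280 * (norm (A x))\<^sup>2) * ennreal (atom_bound x (of_real 1 * y $ d1) (of_real r * y $ d2))) \<partial>torus_measure)"
      proof (rule nn_integral_cong)
        fix y :: "complex ^ 'd"
        have "ennreal (134369280 * ?H y) = ennreal (\<Sum>x\<in>J. 134369280 * (norm (A x))\<^sup>2 * atom_bound x (of_real 1 * y $ d1) (of_real r * y $ d2))"
          by (simp add: sum_distrib_left mult.assoc)
        also have "\<dots> = (\<Sum>x\<in>J. ennreal (134369280 * (norm (A x))\<^sup>2 * atom_bound x (of_real 1 * y $ d1) (of_real r * y $ d2)))"
          using atom_bound_nonneg by (intro sum_ennreal[symmetric]) auto
        also have "\<dots> = (\<Sum>x\<in>J. ennreal (134369280 * (norm (A x))\<^sup>2) * ennreal (atom_bound x (of_real 1 * y $ d1) (of_real r * y $ d2)))"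
          using atom_bound_nonneg by (intro sum.cong refl ennreal_mult) auto
        finally show "ennreal (134369280 * ?H y) = \<dots>" .
      qed
      also have "\<dots> = (\<Sum>x\<in>J. ennreal (134369280 * (norm (A x))\<^sup>2) * (\<integral>\<^sup>+ y. ennreal (atom_bound x (of_real 1 * y $ d1) (of_real r * y $ d2)) \<partial>torus_measure))"
        by (subst nn_integral_sum) (auto simp: nn_integral_cmult simp del: of_real_1)
      also have "\<dots> \<le> (\<Sum>x\<in>J. ennreal (134369280 * (norm (A x))\<^sup>2) * ennreal (8 * atom_weight x))"
        using r by (intro sum_mono mult_left_mono nn_integral_atom_bound_le d) auto
      also have "\<dots> = ennreal (1074954240 * (\<Sum>x\<in>J. atom_weight x * (norm (A x))\<^sup>2))"
        using atom_weight_nonneg unfolding sum_distrib_left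
        by (subst sum_ennreal[symmetric]) (auto simp: ennreal_mult[symmetric] mult_ac intro!: sum.cong)
      finally show ?thesis .
    qed
  qed (use J p in auto)
  then show "(\<integral>\<^sup>+ y. ennreal (norm (scaled r (\<lambda>y. \<Sum>x\<in>J. A x * ?f x y) y) powr p) \<partial>torus_measure) \<le>
    ennreal (marcinkiewicz_const p * 1074954240 * (\<Sum>x\<in>J. atom_weight x * norm (A x) powr p))"
    unfolding scaled_sum .
qed

lemma bij_betw_indices: "bij_betw (from_nat_into indices) UNIV indices"
proof (rule bij_betw_from_nat_into)
  show "countable indices" by auto
  have "inj (\<lambda>n::nat. (n, 0::nat, 0::int))" "range (\<lambda>n::nat. (n, 0::nat, 0::int)) \<subseteq> indices"
    by (auto simp: inj_on_def indices_def)
  then show "infinite indices" using finite_imageD infinite_UNIV_nat finite_subset by metis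
qed

lemma atom_points_simply_interpolating:
  fixes d1 d2 :: "'d::finite"
  assumes d: "d1 \<noteq> d2" and p: "1 \<le> p" "p \<le> 2"
  shows "simply_interpolating p (\<lambda>n. atom_point d1 d2 (from_nat_into indices n))"
proof -
  define e where "e = from_nat_into indices"
  have e: "e n \<in> indices" "e m = e n \<longleftrightarrow> m = n" for m n
    using bij_betw_indices unfolding e_def bij_betw_def inj_on_def by auto
  have inj: "inj_on e J" for J using e by (auto simp: inj_on_def)
  show ?thesis unfolding e_def[symmetric]
  proof (rule simply_interpolating_criterion[where f="\<lambda>n y. atom (e n) (y $ d1) (y $ d2)"])
    show "atom_point d1 d2 (e n) \<in> polydisc" for n by (rule atom_point_polydisc)
    show "sv_holomorphic_on (\<lambda>y :: complex ^ 'd. atom (e n) (y $ d1) (y $ d2)) polydisc" for n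
      by (rule atom_sv_holomorphic)
    show "atom (e m) (atom_point d1 d2 (e n) $ d1) (atom_point d1 d2 (e n) $ d2) = (if m = n then 1 else 0)" for m n
    proof -
      obtain i j k i' j' k' where x: "e m = (i, j, k)" "e n = (i', j', k')" by (metis prod_cases3)
      have "(i, j, k) \<in> indices" "(i', j', k') \<in> indices" using e(1)[of m] e(1)[of n] x by auto
      from atom_at_point[OF this] show ?thesis
        using d e(2)[of m n] by (simp add: x two_point_def)
    qed
    show "0 \<le> marcinkiewicz_const p * 1074954240" using marcinkiewicz_const_nonneg by simp
    show "hardy_norm_powr p (\<lambda>y :: complex ^ 'd. \<Sum>n\<in>J. A n * atom (e n) (y $ d1) (y $ d2)) \<le>
      ennreal (marcinkiewicz_const p * 1074954240 * (\<Sum>n\<in>J. szego_weight (atom_point d1 d2 (e n)) * norm (A n) powr p))"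
      if "finite J" for J A
    proof -
      have inv: "inv_into UNIV e (e n) = n" for n by (rule inv_into_f_f[OF inj]) simp
      have "hardy_norm_powr p (\<lambda>y :: complex ^ 'd. \<Sum>x\<in>e ` J. A (inv_into UNIV e x) * atom x (y $ d1) (y $ d2)) \<le>
        ennreal (marcinkiewicz_const p * 1074954240 * (\<Sum>x\<in>e ` J. atom_weight x * norm (A (inv_into UNIV e x)) powr p))"
        using that e(1) by (intro atoms_hardy_norm_le[OF d _ _ p]) auto
      then show ?thesis
        by (simp add: sum.reindex[OF inj] inv szego_weight_atom_point[OF d])
    qed
  qed (use p in auto)
qed

subsection \<open>Failure of the Carleson condition\<close>

text \<open>A branch of (1 - c^2)^(1/4) (1 - c w)^(-1/2). Its fourth power is normalized in L^1 of
  the circle, while the root itself stays in a sector around the positive axis.\<close>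

definition root_kernel :: "real \<Rightarrow> complex \<Rightarrow> complex" where
  "root_kernel c w = of_real ((1 - c\<^sup>2) powr (1 / 4)) * exp (- (Ln (1 - of_real c * w) / 2))"

lemma Re_one_minus_mult_pos:
  assumes "0 \<le> c" "c < 1" "norm w < 1" shows "0 < Re (1 - of_real c * w)"
proof -
  have "norm (of_real c * w) < 1"
    using assms mult_left_le_one_le[of "norm w" c] by (simp add: norm_mult)
  then show ?thesis using abs_Re_le_cmod[of "of_real c * w"] by simp
qed

lemma root_kernel_holomorphic:
  assumes "0 \<le> c" "c < 1" shows "root_kernel c holomorphic_on ball 0 1"
proof -
  have "1 - of_real c * z \<notin> \<real>\<^sub>\<le>\<^sub>0" if "z \<in> ball 0 1" for z :: complex
  proof -
    have "0 < Re (1 - of_real c * z)" using that by (intro Re_one_minus_mult_pos assms) simp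
    then show ?thesis by (simp only: complex_nonpos_Reals_iff) linarith
  qed
  then show ?thesis unfolding root_kernel_def by (intro holomorphic_intros) auto
qed

lemma norm_root_kernel_power4:
  assumes "0 \<le> c" "c < 1" "norm w < 1"
  shows "norm (root_kernel c w) ^ 4 = kernel_sq (of_real c) w / (1 - c\<^sup>2)"
proof -
  define L where "L = norm (1 - of_real c * w)"
  have ne: "1 - of_real c * w \<noteq> 0" using Re_one_minus_mult_pos[OF assms] by (metis less_irrefl zero_complex.sel(1))
  then have L: "L > 0" by (simp add: L_def)
  have c: "0 < 1 - c\<^sup>2" using assms by (simp add: abs_square_less_1)
  have "norm (exp (- (Ln (1 - of_real c * w) / 2))) = exp (- (ln L / 2))"
    using ne by (simp add: L_def Re_Ln)
  then have "norm (root_kernel c w) ^ 4 = ((1 - c\<^sup>2) powr (1 / 4)) ^ 4 * exp (- (ln L / 2)) ^ 4"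
    by (simp add: root_kernel_def norm_mult power_mult_distrib)
  also have "((1 - c\<^sup>2) powr (1 / 4)) ^ 4 = 1 - c\<^sup>2" using c by (simp add: powr_power)
  also have "exp (- (ln L / 2)) ^ 4 = 1 / L\<^sup>2"
  proof -
    have "exp (- (ln L / 2)) ^ 4 = exp (of_nat 4 * - (ln L / 2))" by (rule exp_of_nat_mult[symmetric])
    also have "of_nat 4 * - (ln L / 2) = - (ln L + ln L)" by simp
    also have "exp \<dots> = 1 / L\<^sup>2"
      by (simp only: exp_minus exp_add inverse_eq_divide exp_ln[OF L] power2_eq_square)
    finally show ?thesis .
  qed
  finally show ?thesis using c by (simp add: kernel_sq_def L_def power2_eq_square)
qed

text \<open>The fourth root of a function with values in the right half-plane has argument at most
  \<open>pi / 4\<close>; this is what allows a series of them to be summed without cancellation.\<close>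

lemma Re_root_kernel_ge:
  assumes "0 \<le> c" "c < 1" "norm w < 1"
  shows "norm (root_kernel c w) / 2 \<le> Re (root_kernel c w)"
proof -
  define L where "L = Ln (1 - of_real c * w)"
  define K where "K = (1 - c\<^sup>2) powr (1 / 4)"
  have K: "K \<ge> 0" by (simp add: K_def)
  have pos: "0 < Re (1 - of_real c * w)" by (rule Re_one_minus_mult_pos[OF assms])
  then have ne: "1 - of_real c * w \<noteq> 0" by (metis less_irrefl zero_complex.sel(1))
  have "\<bar>Im L\<bar> < pi / 2" using Re_Ln_pos_lt[OF ne] pos by (simp add: L_def)
  \<comment> \<open>The argument is below pi / 4; rounding up to pi / 3, whose cosine is 1/2, keeps
    the constant rational.\<close>
  then have "\<bar>Im L / 2\<bar> \<le> pi / 3" by simp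
  then have "cos (pi / 3) \<le> cos \<bar>Im L / 2\<bar>" by (intro cos_monotone_0_pi_le) auto
  then have cos: "1 / 2 \<le> cos (Im L / 2)" by (simp only: cos_60 cos_abs_real)
  have n: "norm (root_kernel c w) = K * exp (- (Re L / 2))"
    using K by (simp add: root_kernel_def K_def[symmetric] L_def[symmetric] norm_mult)
  have "Re (root_kernel c w) = K * (exp (- (Re L / 2)) * cos (Im L / 2))"
    by (simp add: root_kernel_def K_def[symmetric] L_def[symmetric] Re_exp)
  also have "\<dots> \<ge> K * (exp (- (Re L / 2)) * (1 / 2))"
    using K cos by (intro mult_left_mono) auto
  finally show ?thesis unfolding n by simp
qed

lemma norm_root_kernel_le:
  assumes "0 \<le> c" "c < 1" "norm w < 1"
  shows "norm (root_kernel c w) \<le> 1 / (1 - norm w)"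
proof -
  have w: "0 < 1 - norm w" using assms by simp
  have cw: "norm (of_real c :: complex) = c" using assms by simp
  have c: "0 < 1 - c\<^sup>2" "1 - c\<^sup>2 \<le> 1" using assms by (auto simp: abs_square_less_1)
  have "1 - norm w \<le> norm (1 - cnj (of_real c) * w)"
  proof -
    have "norm (of_real c * w) \<le> norm w" using assms mult_left_le_one_le[of "norm w" c] by (simp add: norm_mult)
    then show ?thesis using norm_triangle_ineq2[of 1 "of_real c * w"] by simp
  qed
  then have "norm (root_kernel c w) ^ 4 \<le> 1 / (1 - norm w)\<^sup>2"
    unfolding norm_root_kernel_power4[OF assms] kernel_sq_def cw power_divide
    using c w by (simp add: power2_eq_square[of "1 - c\<^sup>2"]) (intro frac_le power_mono, auto)
  also have "\<dots> \<le> (1 / (1 - norm w)) ^ 4"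
  proof -
    have "1 \<le> 1 / (1 - norm w)" using w by simp
    then have "(1 / (1 - norm w))\<^sup>2 \<le> (1 / (1 - norm w)) ^ 4" by (intro power_increasing) auto
    then show ?thesis by (simp add: power_divide)
  qed
  finally show ?thesis using w by (simp add: power_mono_iff)
qed

section \<open>The test function for a sequence of kernels\<close>

context
  fixes c :: "nat \<Rightarrow> real"
  assumes c: "\<And>m. 0 \<le> c m" "\<And>m. c m < 1"
begin

definition kernel_series :: "complex \<Rightarrow> complex" where
  "kernel_series w = (\<Sum>m. (1 / 2) ^ Suc m * root_kernel (c m) w)"

lemma norm_kernel_series_term:
  assumes "norm w < 1"
  shows "norm ((1 / 2) ^ Suc m * root_kernel (c m) w) \<le> (1 / 2) ^ Suc m * (1 / (1 - norm w))"
  unfolding norm_mult norm_power using norm_root_kernel_le[OF c(1) c(2) assms]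
  by (intro mult_mono) (auto simp: norm_divide)

lemma summable_kernel_series:
  assumes "norm w < 1"
  shows "summable (\<lambda>m. (1 / 2) ^ Suc m * root_kernel (c m) w)"
  by (rule summable_comparison_test'[where N=0, OF _ norm_kernel_series_term[OF assms]])
    (intro summable_mult2, use sums_summable[OF power_half_series] in simp)

lemma kernel_series_holomorphic: "kernel_series holomorphic_on ball 0 1"
proof (rule holomorphic_uniform_sequence[where f="\<lambda>n w. \<Sum>m<n. (1 / 2) ^ Suc m * root_kernel (c m) w"])
  show "(\<lambda>w. \<Sum>m<n. (1 / 2) ^ Suc m * root_kernel (c m) w) holomorphic_on ball 0 1" for n
    by (intro holomorphic_intros root_kernel_holomorphic c)
  fix w :: complex assume w: "w \<in> ball 0 1"
  define e where "e = (1 - norm w) / 2"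
  have e: "e > 0" using w by (simp add: e_def)
  have bd: "norm x \<le> 1 - e" if "x \<in> cball w e" for x
  proof -
    have "norm x \<le> norm w + norm (w - x)" using norm_triangle_ineq4[of w "w - x"] by simp
    moreover have "norm (w - x) \<le> e" using that by (simp add: dist_norm)
    ultimately show ?thesis by (simp add: e_def field_simps)
  qed
  then have sub: "cball w e \<subseteq> ball 0 1" using e by (force simp: le_less_trans)
  have "uniform_limit (cball w e) (\<lambda>n x. \<Sum>m<n. (1 / 2) ^ Suc m * root_kernel (c m) x) kernel_series sequentially"
    unfolding kernel_series_def
  proof (rule Weierstrass_m_test)
    fix n x assume x: "x \<in> cball w e"
    then have "norm x < 1" using sub by auto
    from norm_kernel_series_term[OF this, of n]
    have "norm ((1 / 2) ^ Suc n * root_kernel (c n) x) \<le> (1 / 2) ^ Suc n * (1 / (1 - norm x))" .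
    also have "\<dots> \<le> (1 / 2) ^ Suc n * (1 / e)"
      using bd[OF x] e by (intro mult_left_mono frac_le) auto
    finally show "norm ((1 / 2) ^ Suc n * root_kernel (c n) x) \<le> (1 / 2) ^ Suc n * (1 / e)" .
  next
    show "summable (\<lambda>n. (1 / 2) ^ Suc n * (1 / e))"
      by (intro summable_mult2) (use sums_summable[OF power_half_series] in simp)
  qed
  then show "\<exists>d>0. cball w d \<subseteq> ball 0 1 \<and>
      uniform_limit (cball w d) (\<lambda>n w. \<Sum>m<n. (1 / 2) ^ Suc m * root_kernel (c m) w) kernel_series sequentially"
    using e sub by blast
qed auto

text \<open>All other terms have nonnegative real part and are dropped; the exponent m + 2 combines
  the coefficient 1 / 2^(m+1) with the 1/2 from \<open>Re_root_kernel_ge\<close>.\<close>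

lemma Re_kernel_series_ge:
  assumes w: "norm w < 1"
  shows "(1 / 2) ^ (m + 2) * norm (root_kernel (c m) w) \<le> Re (kernel_series w)"
proof -
  let ?t = "\<lambda>m. (1 / 2) ^ Suc m * root_kernel (c m) w"
  have Re_t: "Re (?t m) = (1 / 2) ^ Suc m * Re (root_kernel (c m) w)" for m
  proof -
    have "?t m = of_real ((1 / 2) ^ Suc m) * root_kernel (c m) w" by simp
    then show ?thesis by (simp only: Re_complex_of_real times_complex.sel Im_complex_of_real mult_zero_left diff_zero)
  qed
  have ge: "(1 / 2) ^ (m + 2) * norm (root_kernel (c m) w) \<le> Re (?t m)" for m
    unfolding Re_t using mult_left_mono[OF Re_root_kernel_ge[OF c(1) c(2) w, of m], of "(1 / 2) ^ Suc m"] by simp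
  have nn: "0 \<le> Re (?t m)" for m by (rule order_trans[OF _ ge]) simp
  have "(1 / 2) ^ (m + 2) * norm (root_kernel (c m) w) \<le> Re (?t m)" by (rule ge)
  also have "\<dots> = (\<Sum>n\<in>{m}. Re (?t n))" by simp
  also have "\<dots> \<le> (\<Sum>n. Re (?t n))"
    using summable_Re[OF summable_kernel_series[OF w]] nn by (intro sum_le_suminf) auto
  also have "\<dots> = Re (kernel_series w)"
    unfolding kernel_series_def using summable_kernel_series[OF w] by (rule Re_suminf[symmetric])
  finally show ?thesis .
qed

lemma Re_kernel_series_pos:
  assumes w: "norm w < 1" shows "0 < Re (kernel_series w)"
proof -
  have "root_kernel (c 0) w \<noteq> 0"
    using c[of 0] by (simp add: root_kernel_def abs_square_eq_1 power2_eq_1_iff)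
  then have "0 < (1 / 2) ^ (0 + 2) * norm (root_kernel (c 0) w)" by simp
  then show ?thesis using Re_kernel_series_ge[OF w, of 0] by linarith
qed

text \<open>Convexity of the fourth power for weights of total mass at most 1, obtained from
  Cauchy-Schwarz used twice.\<close>

lemma weighted_sum_power4_le:
  fixes a x :: "nat \<Rightarrow> real"
  assumes a: "\<And>m. 0 \<le> a m" "(\<Sum>m<n. a m) \<le> 1" and x: "\<And>m. 0 \<le> x m"
  shows "(\<Sum>m<n. a m * x m) ^ 4 \<le> (\<Sum>m<n. a m * x m ^ 4)"
proof -
  have sq: "(\<Sum>m<n. a m * y m)\<^sup>2 \<le> (\<Sum>m<n. a m * (y m)\<^sup>2)" for y :: "nat \<Rightarrow> real"
  proof -
    have "(\<Sum>m<n. a m * y m)\<^sup>2 = (\<Sum>m<n. sqrt (a m) * (sqrt (a m) * y m))\<^sup>2"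
      using a by (simp add: mult.assoc[symmetric])
    also have "\<dots> \<le> (\<Sum>m<n. (sqrt (a m))\<^sup>2) * (\<Sum>m<n. (sqrt (a m) * y m)\<^sup>2)"
      by (rule Cauchy_Schwarz_ineq_sum)
    also have "\<dots> = (\<Sum>m<n. a m) * (\<Sum>m<n. a m * (y m)\<^sup>2)" using a by (simp add: power_mult_distrib)
    also have "\<dots> \<le> 1 * (\<Sum>m<n. a m * (y m)\<^sup>2)" using a by (intro mult_right_mono sum_nonneg) auto
    finally show ?thesis by simp
  qed
  have "(\<Sum>m<n. a m * x m) ^ 4 = ((\<Sum>m<n. a m * x m)\<^sup>2)\<^sup>2" by (simp add: power_mult[symmetric])
  also have "\<dots> \<le> (\<Sum>m<n. a m * (x m)\<^sup>2)\<^sup>2" by (intro power_mono sq) auto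
  also have "\<dots> \<le> (\<Sum>m<n. a m * ((x m)\<^sup>2)\<^sup>2)" by (rule sq)
  finally show ?thesis by (simp add: power_mult[symmetric])
qed

lemma norm_kernel_series_power4_le:
  assumes w: "norm w < 1"
  shows "ennreal (norm (kernel_series w) ^ 4) \<le> (\<Sum>m. ennreal ((1 / 2) ^ Suc m * norm (root_kernel (c m) w) ^ 4))"
proof (rule tendsto_upperbound)
  let ?S = "\<lambda>n. \<Sum>m<n. (1 / 2) ^ Suc m * root_kernel (c m) w"
  show "(\<lambda>n. ennreal (norm (?S n) ^ 4)) \<longlonglongrightarrow> ennreal (norm (kernel_series w) ^ 4)"
    unfolding kernel_series_def
    by (intro tendsto_ennrealI tendsto_power tendsto_norm summable_LIMSEQ summable_kernel_series w)
  have "ennreal (norm (?S n) ^ 4) \<le> (\<Sum>m. ennreal ((1 / 2) ^ Suc m * norm (root_kernel (c m) w) ^ 4))" for n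
  proof -
    have "norm (?S n) \<le> (\<Sum>m<n. (1 / 2) ^ Suc m * norm (root_kernel (c m) w))"
      by (rule order_trans[OF norm_sum]) (simp add: norm_mult norm_power norm_divide)
    then have "norm (?S n) ^ 4 \<le> (\<Sum>m<n. (1 / 2) ^ Suc m * norm (root_kernel (c m) w)) ^ 4"
      by (intro power_mono) auto
    also have "\<dots> \<le> (\<Sum>m<n. (1 / 2) ^ Suc m * norm (root_kernel (c m) w) ^ 4)"
    proof (rule weighted_sum_power4_le)
      have "(\<Sum>m<n. (1 / 2 :: real) ^ Suc m) \<le> (\<Sum>m. (1 / 2) ^ Suc m)"
        using sums_summable[OF power_half_series] by (intro sum_le_suminf) auto
      then show "(\<Sum>m<n. (1 / 2 :: real) ^ Suc m) \<le> 1" using sums_unique[OF power_half_series] by simp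
    qed auto
    finally have "ennreal (norm (?S n) ^ 4) \<le> ennreal (\<Sum>m<n. (1 / 2) ^ Suc m * norm (root_kernel (c m) w) ^ 4)"
      by (rule ennreal_leI)
    also have "\<dots> = (\<Sum>m<n. ennreal ((1 / 2) ^ Suc m * norm (root_kernel (c m) w) ^ 4))"
      by (intro sum_ennreal[symmetric]) auto
    also have "\<dots> \<le> (\<Sum>m. ennreal ((1 / 2) ^ Suc m * norm (root_kernel (c m) w) ^ 4))"
      by (intro sum_le_suminf) auto
    finally show ?thesis .
  qed
  then show "\<forall>\<^sub>F n in sequentially. ennreal (norm (?S n) ^ 4) \<le> (\<Sum>m. ennreal ((1 / 2) ^ Suc m * norm (root_kernel (c m) w) ^ 4))"
    by simp
qed auto

text \<open>The power 4 / p of the series, well defined because its real part is positive. The p-th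
  power of the modulus is then the fourth power of the series, whatever p is.\<close>

definition test_function :: "real \<Rightarrow> 'd \<Rightarrow> complex ^ 'd::finite \<Rightarrow> complex" where
  "test_function p d y = exp (of_real (4 / p) * Ln (kernel_series (y $ d)))"

lemma norm_test_function_powr:
  assumes p: "p > 0" and y: "norm (y $ d) < 1"
  shows "norm (test_function p d y) powr p = norm (kernel_series (y $ d)) ^ 4"
proof -
  define v where "v = kernel_series (y $ d)"
  have "0 < Re v" unfolding v_def by (rule Re_kernel_series_pos[OF y])
  then have v: "v \<noteq> 0" by (metis less_irrefl zero_complex.sel(1))
  have "norm (test_function p d y) = exp (4 / p * ln (norm v))"
    using v p by (simp add: test_function_def v_def[symmetric] Re_Ln Re_divide_of_real)
  then have "norm (test_function p d y) powr p = exp (4 * ln (norm v))"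
    using p by (simp add: powr_def)
  also have "\<dots> = norm v ^ 4" using v exp_of_nat_mult[of 4 "ln (norm v)"] by simp
  finally show ?thesis by (simp add: v_def)
qed

text \<open>By convexity the p-th power is dominated by the average, with weights 1 / 2^(m+1), of
  squared kernels divided by 1 - c_m^2, and each of these has mean at most 1 on every circle inside
  the disc.\<close>

lemma test_function_hardy_space:
  fixes d1 d2 :: "'d::finite"
  assumes p: "p > 0" and d: "d1 \<noteq> d2"
  shows "(test_function p d2 :: complex ^ 'd \<Rightarrow> complex) \<in> hardy_space p"
proof -
  have "(\<lambda>w. exp (of_real (4 / p) * Ln (kernel_series w))) holomorphic_on ball 0 1"
    by (intro holomorphic_intros kernel_series_holomorphic)
      (use Re_kernel_series_pos in \<open>fastforce simp: complex_nonpos_Reals_iff\<close>)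
  then have sv: "sv_holomorphic_on (test_function p d2 :: complex ^ 'd \<Rightarrow> complex) polydisc"
    unfolding test_function_def by (rule sv_holomorphic_on_coordinate) (auto simp: polydisc_def)
  have "hardy_norm_powr p (test_function p d2 :: complex ^ 'd \<Rightarrow> complex) \<le> 1"
    unfolding hardy_norm_powr_eq
  proof (rule SUP_least)
    fix r :: real assume "r \<in> {0<..<1}"
    then have r: "0 < r" "r < 1" by auto
    have nc: "norm (of_real (c m) :: complex) < 1" for m using c[of m] by simp
    have c2: "0 < 1 - (c m)\<^sup>2" for m using c[of m] by (simp add: abs_square_less_1)
    define b where "b m = (1 / 2) ^ Suc m / (1 - (c m)\<^sup>2)" for m
    have b: "b m \<ge> 0" for m using c2[of m] by (simp add: b_def)
    have "(\<integral>\<^sup>+ y. ennreal (norm (scaled r (test_function p d2) y) powr p) \<partial>(torus_measure :: (complex ^ 'd) measure)) \<le>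
      (\<integral>\<^sup>+ y. (\<Sum>m. ennreal (b m) * ennreal (kernel_sq (of_real (c m)) (of_real r * (y :: complex ^ 'd) $ d2))) \<partial>torus_measure)"
    proof (rule nn_integral_torus_mono)
      fix y :: "complex ^ 'd" assume y: "y \<in> torus"
      define w where "w = of_real r * y $ d2"
      have w: "norm w < 1" using r y by (simp add: w_def torus_def norm_mult)
      have yw: "(r *\<^sub>R y) $ d2 = w" by (simp add: w_def scaleR_conv_of_real[where 'a=complex])
      have "ennreal (norm (scaled r (test_function p d2) y) powr p) = ennreal (norm (kernel_series w) ^ 4)"
        using norm_test_function_powr[OF p, of "r *\<^sub>R y" d2] w by (simp only: scaled_torus[OF y] yw)
      also have "\<dots> \<le> (\<Sum>m. ennreal ((1 / 2) ^ Suc m * norm (root_kernel (c m) w) ^ 4))"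
        by (rule norm_kernel_series_power4_le[OF w])
      also have "\<dots> = (\<Sum>m. ennreal (b m) * ennreal (kernel_sq (of_real (c m)) w))"
      proof (rule suminf_cong)
        fix m
        have "(1 / 2) ^ Suc m * norm (root_kernel (c m) w) ^ 4 = b m * kernel_sq (of_real (c m)) w"
          unfolding norm_root_kernel_power4[OF c(1) c(2) w] b_def by simp
        then show "ennreal ((1 / 2) ^ Suc m * norm (root_kernel (c m) w) ^ 4) = ennreal (b m) * ennreal (kernel_sq (of_real (c m)) w)"
          using b kernel_sq_nonneg by (simp only: ennreal_mult)
      qed
      finally show "ennreal (norm (scaled r (test_function p d2) y) powr p) \<le>
        (\<Sum>m. ennreal (b m) * ennreal (kernel_sq (of_real (c m)) (of_real r * y $ d2)))" unfolding w_def .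
    qed
    also have "\<dots> = (\<Sum>m. ennreal (b m) * (\<integral>\<^sup>+ y. ennreal (kernel_sq (of_real (c m)) (of_real r * (y :: complex ^ 'd) $ d2)) \<partial>torus_measure))"
      by (subst nn_integral_suminf) (auto simp: nn_integral_cmult)
    also have "\<dots> \<le> (\<Sum>m. ennreal ((1 / 2) ^ Suc m))"
    proof (intro suminf_le allI summableI)
      fix m
      have one: "emeasure circle_measure UNIV = 1"
        using prob_space.emeasure_space_1[OF prob_space_circle_measure] by simp
      have "(\<integral>\<^sup>+ y. ennreal (kernel_sq (of_real (c m)) (of_real r * (y :: complex ^ 'd) $ d2)) \<partial>torus_measure) =
          (\<integral>\<^sup>+ w. ennreal (kernel_sq (of_real (c m)) (of_real r * w)) \<partial>circle_measure)"
        using nn_integral_torus_two[of "\<lambda>_. 1" "\<lambda>w. ennreal (kernel_sq (of_real (c m)) (of_real r * w))", OF _ _ d] one by simp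
      also have "\<dots> \<le> ennreal (1 - (c m)\<^sup>2)"
        using nn_integral_kernel_sq_le[OF nc[of m], of r] r by simp
      finally have "ennreal (b m) * (\<integral>\<^sup>+ y. ennreal (kernel_sq (of_real (c m)) (of_real r * (y :: complex ^ 'd) $ d2)) \<partial>torus_measure) \<le>
          ennreal (b m) * ennreal (1 - (c m)\<^sup>2)" by (rule mult_left_mono) simp
      also have "\<dots> = ennreal (b m * (1 - (c m)\<^sup>2))"
        using c2[of m] by (intro ennreal_mult[symmetric] b) simp
      also have "b m * (1 - (c m)\<^sup>2) = (1 / 2) ^ Suc m"
        unfolding b_def using c2[of m] by (metis less_irrefl nonzero_eq_divide_eq)
      finally show "ennreal (b m) * (\<integral>\<^sup>+ y. ennreal (kernel_sq (of_real (c m)) (of_real r * (y :: complex ^ 'd) $ d2)) \<partial>torus_measure) \<le>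
          ennreal ((1 / 2) ^ Suc m)" .
    qed
    also have "\<dots> = ennreal 1" by (rule suminf_ennreal_eq[OF _ power_half_series]) simp
    also have "\<dots> = 1" by (rule ennreal_1)
    finally show "(\<integral>\<^sup>+ y. ennreal (norm (scaled r (test_function p d2) y) powr p) \<partial>(torus_measure :: (complex ^ 'd) measure)) \<le> 1" .
  qed
  then have "hardy_norm_powr p (test_function p d2 :: complex ^ 'd \<Rightarrow> complex) < \<top>"
    by (rule le_less_trans) (rule ennreal_one_less_top)
  then show ?thesis using sv by (simp add: hardy_space_def)
qed

end

section \<open>Divergence over the blocks\<close>

text \<open>\<open>c\<close> corresponds to R = 100^n in the half-plane. Block i has about 100^(n-i)
  points \<zeta> with imaginary part between 0 and 2 pi R, and each carries mass of order 100^i / R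
  = 1 / 100^(n-i) in w; the 100^i grid points carry total weight at least 1/2 in z. The product does
  not depend on i.\<close>

lemma block_mass_ge:
  assumes "i \<le> n"
  defines "R \<equiv> (100::real) ^ n"
  defines "c \<equiv> (R - 1) / (R + 1)"
  shows "1 / 68 \<le> (\<Sum>j<100 ^ i. \<Sum>k\<in>{0..int (100 ^ (n - i))}.
    atom_weight (i, j, k) * norm (root_kernel c (horo_point i k)) ^ 4)"
proof -
  have R: "R \<ge> 1" by (simp add: R_def)
  have c: "0 \<le> c" "c < 1" using R by (auto simp: c_def divide_simps)
  define X where "X = ln 2 * (100::real) ^ i"
  have X: "X > 0" by (simp add: X_def)
  have R_split: "R = 100 ^ i * 100 ^ (n - i)" using assms(1) by (simp add: R_def power_add[symmetric])
  have XR: "X \<le> R"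
  proof -
    have "ln 2 * (100::real) ^ i \<le> 1 * 100 ^ i" using ln_2_less_1 by (intro mult_right_mono) auto
    also have "\<dots> \<le> R" unfolding R_def using assms(1) by (simp add: power_increasing)
    finally show ?thesis by (simp add: X_def)
  qed
  have cR: "complex_of_real c = inv_cayley (of_real R)" by (simp add: c_def inv_cayley_def)
  have term_ge: "X / (17 * R) \<le> (1 - (norm (horo_point i k))\<^sup>2) * norm (root_kernel c (horo_point i k)) ^ 4"
    if k: "k \<in> {0..int (100 ^ (n - i))}" for k
  proof -
    define \<zeta> where "\<zeta> = horo_zeta i k"
    have \<zeta>: "Re \<zeta> = X" "Im \<zeta> = 2 * pi * of_int k * 100 ^ i"
      by (simp_all add: \<zeta>_def Re_horo_zeta Im_horo_zeta X_def)
    have zp: "0 < Re \<zeta>" using \<zeta> X by simp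
    have Rp: "0 < Re (complex_of_real R)" using R by simp
    have "0 < Re (\<zeta> + of_real R)" using zp R by simp
    then have ne': "\<zeta> + of_real R \<noteq> 0" by (metis less_irrefl zero_complex.sel(1))
    have ne: "norm (\<zeta> + 1) \<noteq> 0" "norm (complex_of_real R + 1) \<noteq> 0" "norm (\<zeta> + of_real R) \<noteq> 0"
      using plus_one_nonzero[OF zp] plus_one_nonzero[OF Rp] ne' by (simp_all only: norm_eq_zero not_False_eq_True)
    have R1: "R + 1 \<noteq> 0" using R by linarith
    have w: "norm (horo_point i k) < 1" by (rule norm_horo_point_less_1)
    have e1: "1 - (norm (horo_point i k))\<^sup>2 = 4 * X / (norm (\<zeta> + 1))\<^sup>2"
      unfolding horo_point_def using one_minus_norm_inv_cayley[OF zp] by (simp add: \<zeta>_def[symmetric] \<zeta>(1))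
    have e2: "1 - c\<^sup>2 = 4 * R / (norm (complex_of_real R + 1))\<^sup>2"
      using one_minus_norm_inv_cayley[OF Rp] c unfolding cR[symmetric] by simp
    have e3: "kernel_sq (of_real c) (horo_point i k) = (2 * R * norm (\<zeta> + 1) / (norm (complex_of_real R + 1) * norm (\<zeta> + of_real R)))\<^sup>2"
      unfolding cR kernel_sq_cayley[OF Rp w] cayley_horo_point \<zeta>_def[symmetric] by simp
    \<comment> \<open>The factors |\<zeta> + 1| and |R + 1| cancel, leaving an expression in the
      half-plane alone.\<close>
    have mass: "(1 - (norm (horo_point i k))\<^sup>2) * norm (root_kernel c (horo_point i k)) ^ 4 = 4 * X * R / (norm (\<zeta> + of_real R))\<^sup>2"
      unfolding norm_root_kernel_power4[OF c w] e1 e2 e3 using ne R R1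
      by (simp add: power2_eq_square power_mult_distrib field_simps)
    \<comment> \<open>Re \<zeta> + R is at most 2 R and Im \<zeta> at most 2 pi R \<le> 8 R, and 68
      = 2^2 + 8^2.\<close>
    have bound: "(norm (\<zeta> + of_real R))\<^sup>2 \<le> 68 * R\<^sup>2"
    proof -
      have "of_int k \<le> (100::real) ^ (n - i)"
      proof -
        have "real_of_int k \<le> real_of_int (int (100 ^ (n - i)))" using k by (intro of_int_le_iff[THEN iffD2]) simp
        then show ?thesis by simp
      qed
      then have "Im \<zeta> \<le> 2 * pi * 100 ^ (n - i) * 100 ^ i"
        unfolding \<zeta> by (intro mult_right_mono mult_left_mono) auto
      also have "\<dots> = 2 * pi * R" by (simp add: R_split)
      also have "\<dots> \<le> 8 * R" using pi_less_4 R by (intro mult_right_mono) auto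
      finally have "Im \<zeta> \<le> 8 * R" .
      moreover have "0 \<le> Im \<zeta>" using k unfolding \<zeta> by simp
      ultimately have "(Im \<zeta>)\<^sup>2 \<le> (8 * R)\<^sup>2" by (intro power_mono) auto
      moreover have "(X + R)\<^sup>2 \<le> (2 * R)\<^sup>2" using X XR R by (intro power_mono) auto
      ultimately have "(X + R)\<^sup>2 + (Im \<zeta>)\<^sup>2 \<le> (2 * R)\<^sup>2 + (8 * R)\<^sup>2" by (rule add_mono[rotated])
      also have "\<dots> = 68 * R\<^sup>2" by (simp add: power_mult_distrib)
      finally show ?thesis by (simp add: cmod_power2 \<zeta>(1))
    qed
    have "4 * X * R / (68 * R\<^sup>2) \<le> 4 * X * R / (norm (\<zeta> + of_real R))\<^sup>2"
      using bound X R ne(3) by (intro frac_le) auto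
    moreover have "X / (17 * R) = 4 * X * R / (68 * R\<^sup>2)" using R by (simp add: power2_eq_square field_simps)
    ultimately show ?thesis unfolding mass by linarith
  qed
  define G where "G = 1 - (grid_radius i)\<^sup>2"
  have G: "1 / 2 \<le> 100 ^ i * G"
    using one_minus_grid_radius_square[of i] by (simp add: G_def field_simps)
  then have "0 < 100 ^ i * G" by (rule less_le_trans[rotated]) simp
  then have G0: "0 \<le> G" by (simp add: zero_less_mult_iff)
  have "1 / 68 \<le> 1 / 2 * (ln 2 / 17 :: real)" using ln2_ge_two_thirds by simp
  also have "\<dots> \<le> (100 ^ i * G) * (100 ^ (n - i) * (X / (17 * R)))"
  proof -
    have "100 ^ (n - i) * (X / (17 * R)) = ln 2 / 17" by (simp add: X_def R_split)
    then show ?thesis using G by (intro mult_mono) auto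
  qed
  also have "\<dots> = (\<Sum>j<(100::nat) ^ i. G * (100 ^ (n - i) * (X / (17 * R))))" by simp
  also have "\<dots> \<le> (\<Sum>j<(100::nat) ^ i. G * (\<Sum>k\<in>{0..int (100 ^ (n - i))}. X / (17 * R)))"
    using G0 X R by (intro sum_mono mult_left_mono) (auto intro: divide_right_mono)
  also have "\<dots> \<le> (\<Sum>j<(100::nat) ^ i. G * (\<Sum>k\<in>{0..int (100 ^ (n - i))}.
      (1 - (norm (horo_point i k))\<^sup>2) * norm (root_kernel c (horo_point i k)) ^ 4))"
    using G0 by (intro sum_mono mult_left_mono term_ge)
  also have "\<dots> = (\<Sum>j<100 ^ i. \<Sum>k\<in>{0..int (100 ^ (n - i))}.
    atom_weight (i, j, k) * norm (root_kernel c (horo_point i k)) ^ 4)"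
    by (simp add: G_def sum_distrib_left mult.assoc)
  finally show ?thesis .
qed

text \<open>Universality would make the weighted p-th powers of one test function summable. Its
  series contains a kernel for each of infinitely many scales, and scale m alone forces a sum of
  order 2^m.\<close>

lemma atom_points_not_universally_interpolating:
  fixes d1 d2 :: "'d::finite"
  assumes d: "d1 \<noteq> d2" and p: "1 \<le> p"
  shows "\<not> universally_interpolating p (\<lambda>n. atom_point d1 d2 (from_nat_into indices n))"
proof
  assume univ: "universally_interpolating p (\<lambda>n. atom_point d1 d2 (from_nat_into indices n))"
  define e where "e = from_nat_into indices"
  have bij: "bij_betw e UNIV indices" unfolding e_def by (rule bij_betw_indices)
  \<comment> \<open>Isolating term m of the series costs the factor 16^(m+2), the fourth power of
    2^(m+2). With 32^m + 1 blocks of mass at least 1/68, a multiple of 2^m survives.\<close>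
  define N :: "nat \<Rightarrow> nat" where "N m = 32 ^ m" for m
  define c :: "nat \<Rightarrow> real" where "c m = (100 ^ N m - 1) / (100 ^ N m + 1)" for m
  have c: "0 \<le> c m" "c m < 1" for m
  proof -
    have le: "(1::real) \<le> 100 ^ N m" by simp
    then have pos: "(0::real) < 100 ^ N m + 1" by linarith
    show "0 \<le> c m" unfolding c_def using le pos by (intro divide_nonneg_pos) auto
    show "c m < 1" unfolding c_def pos_divide_less_eq[OF pos] by simp
  qed
  let ?g = "test_function c p d2 :: complex ^ 'd \<Rightarrow> complex"
  define h where "h x = szego_weight (atom_point d1 d2 x) * norm (?g (atom_point d1 d2 x)) powr p" for x
  have h0: "0 \<le> h x" for x using szego_weight_pos[OF atom_point_polydisc[of d1 d2 x]] by (simp add: h_def)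
  have "?g \<in> hardy_space p" by (rule test_function_hardy_space[OF c]) (use p d in auto)
  then have "interp_map p (\<lambda>n. atom_point d1 d2 (e n)) ?g \<in> ell_p p"
    using univ unfolding universally_interpolating_def e_def by blast
  then have sum: "summable (\<lambda>n. h (e n))"
    using p by (simp add: ell_p_def norm_interp_map_powr[OF atom_point_polydisc] h_def)
  define S where "S = (\<Sum>n. h (e n))"
  have fin: "(\<Sum>x\<in>B. h x) \<le> S" if "finite B" "B \<subseteq> indices" for B
  proof -
    have inj: "inj_on e UNIV" using bij by (simp add: bij_betw_def)
    define B' where "B' = e -` B"
    have img: "e ` B' = B" using that(2) bij by (auto simp: B'_def bij_betw_def)
    have "finite B'" unfolding B'_def using that(1) inj by (rule finite_vimageI)
    moreover have "(\<Sum>x\<in>B. h x) = (\<Sum>n\<in>B'. h (e n))"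
      unfolding img[symmetric] by (subst sum.reindex) (auto intro: inj_on_subset[OF inj])
    ultimately show ?thesis unfolding S_def using h0 by (simp add: sum_le_suminf[OF sum])
  qed
  have "2 ^ m / 17408 \<le> S" for m
  proof -
    define B where "B = (SIGMA i:{..N m}. {..<(100::nat) ^ i} \<times> {0..int (100 ^ (N m - i))})"
    have hx: "(1 / 16) ^ (m + 2) * (atom_weight (i, j, k) * norm (root_kernel (c m) (horo_point i k)) ^ 4) \<le> h (i, j, k)" for i j k
    proof -
      let ?w = "horo_point i k"
      have w: "norm ?w < 1" by (rule norm_horo_point_less_1)
      have pt: "atom_point d1 d2 (i, j, k) $ d2 = ?w" using d by (simp add: two_point_def)
      have "(1 / 2) ^ (m + 2) * norm (root_kernel (c m) ?w) \<le> norm (kernel_series c ?w)"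
        using Re_kernel_series_ge[OF c w, of m] complex_Re_le_cmod[of "kernel_series c ?w"] by (rule order_trans)
      then have "((1 / 2) ^ (m + 2) * norm (root_kernel (c m) ?w)) ^ 4 \<le> norm (kernel_series c ?w) ^ 4"
        by (intro power_mono) auto
      moreover have "((1 / 2 :: real) ^ (m + 2)) ^ 4 = (1 / 16) ^ (m + 2)"
      proof -
        have "((1 / 2 :: real) ^ (m + 2)) ^ 4 = ((1 / 2) ^ 4) ^ (m + 2)"
          unfolding power_mult[symmetric] by (rule arg_cong[OF mult.commute])
        also have "(1 / 2 :: real) ^ 4 = 1 / 16" by (simp add: power_divide)
        finally show ?thesis .
      qed
      moreover have "norm (?g (atom_point d1 d2 (i, j, k))) powr p = norm (kernel_series c ?w) ^ 4"
        using norm_test_function_powr[where c=c and p=p and y="atom_point d1 d2 (i, j, k)" and d=d2, OF c] p w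
        unfolding pt by simp
      ultimately have "(1 / 16) ^ (m + 2) * norm (root_kernel (c m) ?w) ^ 4 \<le> norm (?g (atom_point d1 d2 (i, j, k))) powr p"
        by (simp only: power_mult_distrib)
      from mult_left_mono[OF this atom_weight_nonneg[of "(i, j, k)"]] show ?thesis
        unfolding h_def szego_weight_atom_point[OF d] by (simp add: mult_ac)
    qed
    \<comment> \<open>17408 = 16^2 * 68.\<close>
    have "2 ^ m / 17408 \<le> (1 / 16) ^ (m + 2) * (real (Suc (N m)) * (1 / 68))"
    proof -
      have "(2::real) ^ m = (1 / 16) ^ m * 32 ^ m" by (simp add: power_mult_distrib[symmetric])
      also have "\<dots> \<le> (1 / 16) ^ m * real (Suc (N m))" by (intro mult_left_mono) (auto simp: N_def)
      finally have "2 ^ m / 17408 \<le> (1 / 16) ^ m * real (Suc (N m)) / 17408" by (rule divide_right_mono) simp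
      then show ?thesis by (simp add: power_add)
    qed
    also have "\<dots> = (1 / 16) ^ (m + 2) * (\<Sum>i\<le>N m. 1 / 68)" by simp
    also have "\<dots> \<le> (1 / 16) ^ (m + 2) * (\<Sum>i\<le>N m. \<Sum>j<100 ^ i. \<Sum>k\<in>{0..int (100 ^ (N m - i))}.
        atom_weight (i, j, k) * norm (root_kernel (c m) (horo_point i k)) ^ 4)"
      unfolding c_def by (intro mult_left_mono sum_mono block_mass_ge) auto
    also have "\<dots> = (\<Sum>i\<le>N m. \<Sum>j<100 ^ i. \<Sum>k\<in>{0..int (100 ^ (N m - i))}.
        (1 / 16) ^ (m + 2) * (atom_weight (i, j, k) * norm (root_kernel (c m) (horo_point i k)) ^ 4))"
      by (simp only: sum_distrib_left)
    also have "\<dots> \<le> (\<Sum>i\<le>N m. \<Sum>j<100 ^ i. \<Sum>k\<in>{0..int (100 ^ (N m - i))}. h (i, j, k))"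
      by (intro sum_mono hx)
    also have "\<dots> = (\<Sum>x\<in>B. h x)"
      unfolding B_def by (simp add: sum.Sigma sum.cartesian_product split_beta')
    also have "\<dots> \<le> S"
      by (rule fin) (auto simp: B_def indices_def)
    finally show ?thesis .
  qed
  then have "2 ^ m \<le> 17408 * S" for m by (simp only: pos_divide_le_eq[of 17408] zero_less_numeral mult.commute[of S])
  moreover obtain m where "17408 * S < 2 ^ m" using real_arch_pow[of 2 "17408 * S"] by auto
  ultimately show False using leD by blast
qed

theorem corollary1p3:
  assumes "CARD('d::finite) \<ge> 2"
  shows "(\<forall>p::real. \<forall>\<Lambda> :: nat \<Rightarrow> complex ^ 'd.
            4 \<le> p \<longrightarrow> (\<forall>n. \<Lambda> n \<in> polydisc) \<longrightarrow> simply_interpolating p \<Lambda>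
            \<longrightarrow> universally_interpolating p \<Lambda>)
       \<and> (\<forall>p::real. 1 \<le> p \<and> p \<le> 2 \<longrightarrow>
            (\<exists>\<Lambda> :: nat \<Rightarrow> complex ^ 'd. (\<forall>n. \<Lambda> n \<in> polydisc) \<and>
               simply_interpolating p \<Lambda> \<and> \<not> universally_interpolating p \<Lambda>))"
proof (intro conjI allI impI)
  fix p :: real and \<Lambda> :: "nat \<Rightarrow> complex ^ 'd"
  assume "4 \<le> p" "\<forall>n. \<Lambda> n \<in> polydisc" "simply_interpolating p \<Lambda>"
  then show "universally_interpolating p \<Lambda>"
    by (intro universally_interpolating_if_simply_interpolating) auto
next
  fix p :: real
  assume p: "1 \<le> p \<and> p \<le> 2"
  obtain d1 d2 :: 'd where d: "d1 \<noteq> d2"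
  proof -
    have "\<not> (\<forall>x y :: 'd. x = y)"
    proof
      assume "\<forall>x y :: 'd. x = y"
      then have "(UNIV :: 'd set) = {undefined}" by auto
      then have "CARD('d) = card {undefined :: 'd}" by (rule arg_cong)
      with assms show False by simp
    qed
    then show ?thesis using that by blast
  qed
  let ?\<Lambda> = "\<lambda>n. atom_point d1 d2 (from_nat_into indices n) :: complex ^ 'd"
  show "\<exists>\<Lambda> :: nat \<Rightarrow> complex ^ 'd. (\<forall>n. \<Lambda> n \<in> polydisc) \<and>
      simply_interpolating p \<Lambda> \<and> \<not> universally_interpolating p \<Lambda>"
    using p by (intro exI[of _ ?\<Lambda>] conjI allI atom_point_polydisc
        atom_points_simply_interpolating[OF d] atom_points_not_universally_interpolating[OF d]) auto
qed

end
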